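(* Derivability in hybrid type-logical grammars and derivability of their translation into first-order linear logic coincide. Moreover, proofs in the two systems produce the same semantic lambda terms.
   Context: Hybrid type-logical grammars combine Lambek connectives $/,\backslash$ (on Lambek formulas) with the lambda-grammar connective $|$ (which may only outscope Lambek connectives); hybrid sequents have the form $x_1^{\alpha_1}:A_1,\ldots,x_n^{\alpha_n}:A_n \vdash M^{\beta}:B$ with $\alpha_i,\beta$ principal types. The flattening function is $f(A) = [A]$ for atomic $A$ and $f(\beta\rightarrow\alpha) = f(\alpha) +\!\!+ f(\beta)$, with $+\!\!+$ list concatenation. Formulas are translated into first-order multiplicative intuitionistic linear logic by $\| p \|^{[C_1,\ldots,C_n]} = p(C_1,\ldots,C_n)$; $\| A|B \|^{f(\beta\rightarrow\alpha)} = \| B \|^{f(\beta)} \multimap \| A \|^{f(\alpha)}$; $\| A/B \|^{[C,D]} = \forall x. \| B \|^{[D,x]} \multimap \| A \|^{[C,x]}$; $\| B\backslash A \|^{[C,D]} = \forall x. \| B \|^{[x,C]} \multimap \| A \|^{[x,D]}$, and $\| A \|_c^{L}$ denotes the universal closure of $\| A \|^L$. A hybrid sequent is translated to $\| A_1 \|^{f(\alpha_1)},\ldots,\| A_n \|^{f(\alpha_n)} \vdash \| B \|^{f(\beta)}$ (closed translations for lexical hypotheses, right-hand side universally closed over variables not free on the left); in particular a sentence sequent $w_1^{1\rightarrow 0}:A_1,\ldots,w_n^{n\rightarrow n-1}:A_n \vdash M^{n\rightarrow 0}:B$ becomes $\| A_1 \|_c^{[0,1]},\ldots,\| A_n \|_c^{[n-1,n]}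 \vdash \| B \|_c^{[0,n]}$. Semantics is via Curry–Howard: elimination rules for $/,\backslash,|,\multimap$ are application, introduction rules are abstraction, and $\forall$ is semantically inert. *)

theory Defs
  imports Main "HOL-Library.Multiset"
begin

section \<open>Lambda terms\<close>

text \<open>
  Terms are locally nameless: free variables are named, bound variables are de Bruijn indices, so
  that equality of terms is alpha-equivalence.  Pairs and their eliminator are only used by the
  semantics of the tensor; prosodic terms do not contain them (see \<open>prosodic\<close> below).
\<close>

type_synonym name = nat

datatype trm =
    Var name
  | Bound nat
  | App trm trm
  | Lam trm
  | Tup trm trm
  | LetTup trm trm  \<comment> \<open>binds two variables in its second argument\<close>

primrec fv :: "trm \<Rightarrow> name set" where
  "fv (Var x) = {x}"
| "fv (Bound i) = {}"
| "fv (App M N) = fv M \<union> fv N"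
| "fv (Lam M) = fv M"
| "fv (Tup M N) = fv M \<union> fv N"
| "fv (LetTup M N) = fv M \<union> fv N"

primrec lc_at :: "nat \<Rightarrow> trm \<Rightarrow> bool" where
  "lc_at k (Var x) = True"
| "lc_at k (Bound i) = (i < k)"
| "lc_at k (App M N) = (lc_at k M \<and> lc_at k N)"
| "lc_at k (Lam M) = lc_at (Suc k) M"
| "lc_at k (Tup M N) = (lc_at k M \<and> lc_at k N)"
| "lc_at k (LetTup M N) = (lc_at k M \<and> lc_at (k + 2) N)"

abbreviation lc :: "trm \<Rightarrow> bool" where
  "lc M \<equiv> lc_at 0 M"

primrec bind_at :: "nat \<Rightarrow> name \<Rightarrow> trm \<Rightarrow> trm" where
  "bind_at k x (Var y) = (if y = x then Bound k else Var y)"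
| "bind_at k x (Bound i) = Bound i"
| "bind_at k x (App M N) = App (bind_at k x M) (bind_at k x N)"
| "bind_at k x (Lam M) = Lam (bind_at (Suc k) x M)"
| "bind_at k x (Tup M N) = Tup (bind_at k x M) (bind_at k x N)"
| "bind_at k x (LetTup M N) = LetTup (bind_at k x M) (bind_at (k + 2) x N)"

text \<open>\<open>lam x M\<close> is \<open>\<lambda>x. M\<close>, and \<open>lettup N x y M\<close> is \<open>let (x, y) = N in M\<close>.\<close>

definition lam :: "name \<Rightarrow> trm \<Rightarrow> trm" where
  "lam x M = Lam (bind_at 0 x M)"

definition lettup :: "trm \<Rightarrow> name \<Rightarrow> name \<Rightarrow> trm \<Rightarrow> trm" where
  "lettup N x y M = LetTup N (bind_at 1 x (bind_at 0 y M))"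

text \<open>\<open>subst x N M\<close> is \<open>M[N/x]\<close>; there is no capture as long as \<open>N\<close> is locally closed.\<close>

primrec subst :: "name \<Rightarrow> trm \<Rightarrow> trm \<Rightarrow> trm" where
  "subst x N (Var y) = (if y = x then N else Var y)"
| "subst x N (Bound i) = Bound i"
| "subst x N (App M M') = App (subst x N M) (subst x N M')"
| "subst x N (Lam M) = Lam (subst x N M)"
| "subst x N (Tup M M') = Tup (subst x N M) (subst x N M')"
| "subst x N (LetTup M M') = LetTup (subst x N M) (subst x N M')"

text \<open>One step of beta-eta reduction.\<close>

inductive red :: "trm \<Rightarrow> trm \<Rightarrow> bool" where
  beta: "lc M \<Longrightarrow> lc N \<Longrightarrow> red (App (lam x M) N) (subst x N M)"
| eta: "lc M \<Longrightarrow> x \<notin> fv M \<Longrightarrow> red (lam x (App M (Var x))) M"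
| appL: "red M M' \<Longrightarrow> red (App M N) (App M' N)"
| appR: "red N N' \<Longrightarrow> red (App M N) (App M N')"
| abs: "red M M' \<Longrightarrow> red (lam x M) (lam x M')"

text \<open>
  Equality of semantic terms: beta-eta equality for functions and for pairs.  The eta rule for
  pairs is the general one, of which the commuting conversions are instances.
\<close>

inductive sem_eq :: "trm \<Rightarrow> trm \<Rightarrow> bool"  (infix "\<approx>" 50) where
  refl: "t \<approx> t"
| sym: "t \<approx> u \<Longrightarrow> u \<approx> t"
| trans: "t \<approx> u \<Longrightarrow> u \<approx> v \<Longrightarrow> t \<approx> v"
| app: "t \<approx> t' \<Longrightarrow> u \<approx> u' \<Longrightarrow> App t u \<approx> App t' u'"
| abs: "t \<approx> t' \<Longrightarrow> lam x t \<approx> lam x t'"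
| tup: "t \<approx> t' \<Longrightarrow> u \<approx> u' \<Longrightarrow> Tup t u \<approx> Tup t' u'"
| lettup: "t \<approx> t' \<Longrightarrow> u \<approx> u' \<Longrightarrow> lettup t x y u \<approx> lettup t' x y u'"
| beta_eta: "red t u \<Longrightarrow> t \<approx> u"
| tup_beta: "lc t \<Longrightarrow> lc u \<Longrightarrow> lc v \<Longrightarrow> x \<noteq> y \<Longrightarrow> y \<notin> fv t \<Longrightarrow>
    lettup (Tup t u) x y v \<approx> subst y u (subst x t v)"
| tup_eta: "lc t \<Longrightarrow> lc u \<Longrightarrow> x \<noteq> y \<Longrightarrow> x \<notin> fv u \<Longrightarrow> y \<notin> fv u \<Longrightarrow>
    lettup t x y (subst z (Tup (Var x) (Var y)) u) \<approx> subst z t u"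

text \<open>Prosodic terms are linear lambda terms: every variable is used exactly once.\<close>

inductive prosodic :: "trm \<Rightarrow> bool" where
  var: "prosodic (Var x)"
| app: "prosodic M \<Longrightarrow> prosodic N \<Longrightarrow> fv M \<inter> fv N = {} \<Longrightarrow> prosodic (App M N)"
| abs: "prosodic M \<Longrightarrow> x \<in> fv M \<Longrightarrow> prosodic (lam x M)"

text \<open>Strings are functions from positions to positions, and concatenation is composition.\<close>

definition cat :: "trm \<Rightarrow> trm \<Rightarrow> trm"  (infixr "\<oplus>" 65) where
  "M \<oplus> N = Lam (App M (App N (Bound 0)))"


section \<open>Simple types and principal types\<close>

datatype 'a ty = TAtom 'a | Fun "'a ty" "'a ty"  (infixr "\<rightarrow>" 60)

text \<open>\<open>T\<close> assigns types to all names; only its values on \<open>fv M\<close> matter.\<close>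

inductive typing :: "(name \<Rightarrow> 'a ty) \<Rightarrow> trm \<Rightarrow> 'a ty \<Rightarrow> bool" where
  var: "typing T (Var x) (T x)"
| app: "typing T M (\<beta> \<rightarrow> \<alpha>) \<Longrightarrow> typing T N \<beta> \<Longrightarrow> typing T (App M N) \<alpha>"
| abs: "typing (T(x := \<beta>)) M \<alpha> \<Longrightarrow> typing T (lam x M) (\<beta> \<rightarrow> \<alpha>)"

text \<open>
  The atomic types are the string positions, which are constants, and type variables.  Prosodic
  types (over the single atomic type \<open>()\<close>) are obtained by forgetting the atoms.
\<close>

datatype pos = Pos nat | PVar nat

abbreviation shape :: "'a ty \<Rightarrow> unit ty" where
  "shape \<equiv> map_ty (\<lambda>_. ())"

text \<open>
  Principality of \<open>T \<turnstile> M : \<beta>\<close>: any other typing is an instance of it.  Prosodic types are fixed by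
  the formulas (a variable of an atomic string type has principal type \<open>1 \<rightarrow> 0\<close>, not \<open>0\<close>), so only
  typings with the same prosodic types compete.  Instances may rename positions as well as type
  variables: positions are merely fixed names for the atoms that occur in the types of the words.
\<close>

definition principal :: "(name \<Rightarrow> pos ty) \<Rightarrow> trm \<Rightarrow> pos ty \<Rightarrow> bool" where
  "principal T M \<beta> \<longleftrightarrow> typing T M \<beta> \<and>
     (\<forall>(T' :: name \<Rightarrow> pos ty) (\<beta>' :: pos ty). typing T' M \<beta>' \<and>
        shape \<beta>' = shape \<beta> \<and> (\<forall>x\<in>fv M. shape (T' x) = shape (T x)) \<longrightarrow>
        (\<exists>h. \<beta>' = map_ty h \<beta> \<and> (\<forall>x\<in>fv M. T' x = map_ty h (T x))))"

primrec flat :: "'a ty \<Rightarrow> 'a list" where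
  "flat (TAtom a) = [a]"
| "flat (\<beta> \<rightarrow> \<alpha>) = flat \<alpha> @ flat \<beta>"


section \<open>Hybrid type-logical grammars\<close>

text \<open>\<open>Under B A\<close> is \<open>B \<setminus> A\<close>, \<open>Over A B\<close> is \<open>A / B\<close> and \<open>Bar A B\<close> is \<open>A | B\<close>.\<close>

datatype 'a lambek =
    LAtom 'a
  | Over "'a lambek" "'a lambek"
  | Under "'a lambek" "'a lambek"

text \<open>
  Lambek formulas have strings as prosodic type.  The atoms \<open>HAtom q\<close> are the atomic formulas of
  lambda grammars with an arbitrary prosodic type, given by a function \<open>sh\<close>; they occur outside
  Lambek formulas only.
\<close>

datatype ('a, 'b) hybrid =
    Lambek "'a lambek"
  | HAtom 'b
  | Bar "('a, 'b) hybrid" "('a, 'b) hybrid"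

abbreviation string_ty :: "unit ty" where
  "string_ty \<equiv> TAtom () \<rightarrow> TAtom ()"

primrec pros :: "('b \<Rightarrow> unit ty) \<Rightarrow> ('a, 'b) hybrid \<Rightarrow> unit ty" where
  "pros sh (Lambek A) = string_ty"
| "pros sh (HAtom q) = sh q"
| "pros sh (Bar A B) = pros sh B \<rightarrow> pros sh A"

text \<open>
  \<open>Hyp x A\<close> is a hypothesis \<open>x : A\<close>.  \<open>Lex w W A\<close> is a lexical hypothesis: the word \<open>w\<close>, to which
  the lexicon assigns the formula \<open>A\<close> and the prosodic term \<open>W\<close> with \<open>w\<close> as its only free variable.
\<close>

datatype ('a, 'b) hyp =
    Hyp (hname: name) "('a, 'b) hybrid"
  | Lex (hname: name) trm "('a, 'b) hybrid"

primrec hyp_pros :: "('b \<Rightarrow> unit ty) \<Rightarrow> ('a, 'b) hyp \<Rightarrow> unit ty" where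
  "hyp_pros sh (Hyp x A) = pros sh A"
| "hyp_pros sh (Lex w W A) = string_ty"

abbreviation hnames :: "('a, 'b) hyp multiset \<Rightarrow> name set" where
  "hnames \<Gamma> \<equiv> hname ` set_mset \<Gamma>"

definition is_label ::
  "('b \<Rightarrow> unit ty) \<Rightarrow> ('a, 'b) hyp multiset \<Rightarrow> trm \<Rightarrow> ('a, 'b) hybrid \<Rightarrow> bool" where
  "is_label sh \<Gamma> M A \<longleftrightarrow> prosodic M \<and> fv M = hnames \<Gamma> \<and>
     (\<exists>T. (\<forall>h\<in>#\<Gamma>. T (hname h) = hyp_pros sh h) \<and> typing T M (pros sh A))"

text \<open>
  Natural deduction for hybrid type-logical grammars: \<open>hyb sh \<Gamma> M t A\<close> means that there is a proof
  of \<open>\<Gamma> \<turnstile> M : A\<close> whose semantic term is \<open>t\<close>.  A hypothesis and its semantic variable have the same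
  name.  The rule \<open>conv\<close> makes prosodic terms available up to beta-eta equality, one step at a time
  and within the linear, simply typed terms.
\<close>

inductive hyb :: "('b \<Rightarrow> unit ty) \<Rightarrow> ('a, 'b) hyp multiset \<Rightarrow> trm \<Rightarrow> trm \<Rightarrow> ('a, 'b) hybrid \<Rightarrow> bool"
  for sh where
  ax: "hyb sh {#Hyp x A#} (Var x) (Var x) A"
| lex: "is_label sh {#Lex w W A#} W A \<Longrightarrow> hyb sh {#Lex w W A#} W (Var w) A"
| overE: "hyb sh \<Gamma> M t (Lambek (Over A B)) \<Longrightarrow> hyb sh \<Delta> N u (Lambek B) \<Longrightarrow>
    hnames \<Gamma> \<inter> hnames \<Delta> = {} \<Longrightarrow> hyb sh (\<Gamma> + \<Delta>) (M \<oplus> N) (App t u) (Lambek A)"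
| underE: "hyb sh \<Gamma> N u (Lambek B) \<Longrightarrow> hyb sh \<Delta> M t (Lambek (Under B A)) \<Longrightarrow>
    hnames \<Gamma> \<inter> hnames \<Delta> = {} \<Longrightarrow> hyb sh (\<Gamma> + \<Delta>) (N \<oplus> M) (App t u) (Lambek A)"
| barE: "hyb sh \<Gamma> M t (Bar A B) \<Longrightarrow> hyb sh \<Delta> N u B \<Longrightarrow>
    hnames \<Gamma> \<inter> hnames \<Delta> = {} \<Longrightarrow> hyb sh (\<Gamma> + \<Delta>) (App M N) (App t u) A"
| overI: "hyb sh (add_mset (Hyp x (Lambek B)) \<Gamma>) (M \<oplus> Var x) t (Lambek A) \<Longrightarrow> x \<notin> fv M \<Longrightarrow>
    hyb sh \<Gamma> M (lam x t) (Lambek (Over A B))"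
| underI: "hyb sh (add_mset (Hyp x (Lambek B)) \<Gamma>) (Var x \<oplus> M) t (Lambek A) \<Longrightarrow> x \<notin> fv M \<Longrightarrow>
    hyb sh \<Gamma> M (lam x t) (Lambek (Under B A))"
| barI: "hyb sh (add_mset (Hyp x B) \<Gamma>) M t A \<Longrightarrow> hyb sh \<Gamma> (lam x M) (lam x t) (Bar A B)"
| conv: "hyb sh \<Gamma> M t A \<Longrightarrow> red M N \<or> red N M \<Longrightarrow> is_label sh \<Gamma> N A \<Longrightarrow> hyb sh \<Gamma> N t A"


section \<open>First-order multiplicative intuitionistic linear logic\<close>

text \<open>
  Formulas are locally nameless, too.  The free first-order terms are the positions and type
  variables from above; there are no function symbols.
\<close>

datatype tm = Pt pos | BVar nat

datatype 'c form =
    Pred 'c "tm list"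
  | Lolli "'c form" "'c form"  (infixr "\<multimap>" 60)
  | Tensor "'c form" "'c form"  (infixr "\<otimes>" 65)
  | Forall "'c form"
  | Exists "'c form"

primrec fv_tm :: "tm \<Rightarrow> nat set" where
  "fv_tm (Pt p) = (case p of Pos n \<Rightarrow> {} | PVar v \<Rightarrow> {v})"
| "fv_tm (BVar i) = {}"

primrec bind_tm :: "nat \<Rightarrow> nat \<Rightarrow> tm \<Rightarrow> tm" where
  "bind_tm k v (Pt p) = (if p = PVar v then BVar k else Pt p)"
| "bind_tm k v (BVar i) = BVar i"

primrec inst_tm :: "nat \<Rightarrow> pos \<Rightarrow> tm \<Rightarrow> tm" where
  "inst_tm k a (Pt p) = Pt p"
| "inst_tm k a (BVar i) = (if i = k then Pt a else BVar i)"

primrec lift_tm :: "tm \<Rightarrow> tm" where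
  "lift_tm (Pt p) = Pt p"
| "lift_tm (BVar i) = BVar (Suc i)"

primrec fv_form :: "'c form \<Rightarrow> nat set" where
  "fv_form (Pred p ts) = (\<Union>t\<in>set ts. fv_tm t)"
| "fv_form (\<phi> \<multimap> \<psi>) = fv_form \<phi> \<union> fv_form \<psi>"
| "fv_form (\<phi> \<otimes> \<psi>) = fv_form \<phi> \<union> fv_form \<psi>"
| "fv_form (Forall \<phi>) = fv_form \<phi>"
| "fv_form (Exists \<phi>) = fv_form \<phi>"

primrec lc_form_at :: "nat \<Rightarrow> 'c form \<Rightarrow> bool" where
  "lc_form_at k (Pred p ts) = (\<forall>i. BVar i \<in> set ts \<longrightarrow> i < k)"
| "lc_form_at k (\<phi> \<multimap> \<psi>) = (lc_form_at k \<phi> \<and> lc_form_at k \<psi>)"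
| "lc_form_at k (\<phi> \<otimes> \<psi>) = (lc_form_at k \<phi> \<and> lc_form_at k \<psi>)"
| "lc_form_at k (Forall \<phi>) = lc_form_at (Suc k) \<phi>"
| "lc_form_at k (Exists \<phi>) = lc_form_at (Suc k) \<phi>"

primrec bind_form :: "nat \<Rightarrow> nat \<Rightarrow> 'c form \<Rightarrow> 'c form" where
  "bind_form k v (Pred p ts) = Pred p (map (bind_tm k v) ts)"
| "bind_form k v (\<phi> \<multimap> \<psi>) = bind_form k v \<phi> \<multimap> bind_form k v \<psi>"
| "bind_form k v (\<phi> \<otimes> \<psi>) = bind_form k v \<phi> \<otimes> bind_form k v \<psi>"
| "bind_form k v (Forall \<phi>) = Forall (bind_form (Suc k) v \<phi>)"
| "bind_form k v (Exists \<phi>) = Exists (bind_form (Suc k) v \<phi>)"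

primrec inst_form :: "nat \<Rightarrow> pos \<Rightarrow> 'c form \<Rightarrow> 'c form" where
  "inst_form k a (Pred p ts) = Pred p (map (inst_tm k a) ts)"
| "inst_form k a (\<phi> \<multimap> \<psi>) = inst_form k a \<phi> \<multimap> inst_form k a \<psi>"
| "inst_form k a (\<phi> \<otimes> \<psi>) = inst_form k a \<phi> \<otimes> inst_form k a \<psi>"
| "inst_form k a (Forall \<phi>) = Forall (inst_form (Suc k) a \<phi>)"
| "inst_form k a (Exists \<phi>) = Exists (inst_form (Suc k) a \<phi>)"

text \<open>\<open>all v \<phi>\<close> is \<open>\<forall>v. \<phi>\<close>, and \<open>all_over V \<phi>\<close> quantifies all variables in the finite set \<open>V\<close>.\<close>

definition all :: "nat \<Rightarrow> 'c form \<Rightarrow> 'c form" where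
  "all v \<phi> = Forall (bind_form 0 v \<phi>)"

definition all_over :: "nat set \<Rightarrow> 'c form \<Rightarrow> 'c form" where
  "all_over V \<phi> = foldr all (sorted_list_of_set V) \<phi>"

type_synonym 'c ctx = "(name \<times> 'c form) multiset"

abbreviation cnames :: "'c ctx \<Rightarrow> name set" where
  "cnames \<Gamma> \<equiv> fst ` set_mset \<Gamma>"

definition fv_ctx :: "'c ctx \<Rightarrow> nat set" where
  "fv_ctx \<Gamma> = (\<Union>(x, \<phi>)\<in>set_mset \<Gamma>. fv_form \<phi>)"

text \<open>
  \<open>mill \<Gamma> t \<phi>\<close> means that there is a natural deduction proof of \<open>\<Gamma> \<turnstile> \<phi>\<close> with semantic term \<open>t\<close>.
  Quantifiers are semantically inert, so \<open>existsE\<close> is just a substitution on semantic terms.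
\<close>

inductive mill :: "'c ctx \<Rightarrow> trm \<Rightarrow> 'c form \<Rightarrow> bool" where
  ax: "lc_form_at 0 \<phi> \<Longrightarrow> mill {#(x, \<phi>)#} (Var x) \<phi>"
| lolliI: "mill (add_mset (x, \<phi>) \<Gamma>) t \<psi> \<Longrightarrow> mill \<Gamma> (lam x t) (\<phi> \<multimap> \<psi>)"
| lolliE: "mill \<Gamma> t (\<phi> \<multimap> \<psi>) \<Longrightarrow> mill \<Delta> u \<phi> \<Longrightarrow> cnames \<Gamma> \<inter> cnames \<Delta> = {} \<Longrightarrow>
    mill (\<Gamma> + \<Delta>) (App t u) \<psi>"
| tensorI: "mill \<Gamma> t \<phi> \<Longrightarrow> mill \<Delta> u \<psi> \<Longrightarrow> cnames \<Gamma> \<inter> cnames \<Delta> = {} \<Longrightarrow>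
    mill (\<Gamma> + \<Delta>) (Tup t u) (\<phi> \<otimes> \<psi>)"
| tensorE: "mill \<Gamma> t (\<phi> \<otimes> \<psi>) \<Longrightarrow> mill (add_mset (x, \<phi>) (add_mset (y, \<psi>) \<Delta>)) u \<chi> \<Longrightarrow>
    cnames \<Gamma> \<inter> cnames \<Delta> = {} \<Longrightarrow> mill (\<Gamma> + \<Delta>) (lettup t x y u) \<chi>"
| forallI: "mill \<Gamma> t \<phi> \<Longrightarrow> v \<notin> fv_ctx \<Gamma> \<Longrightarrow> mill \<Gamma> t (all v \<phi>)"
| forallE: "mill \<Gamma> t (Forall \<phi>) \<Longrightarrow> mill \<Gamma> t (inst_form 0 a \<phi>)"
| existsI: "mill \<Gamma> t (inst_form 0 a \<phi>) \<Longrightarrow> mill \<Gamma> t (Exists \<phi>)"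
| existsE: "mill \<Gamma> t (Exists \<phi>) \<Longrightarrow> mill (add_mset (x, inst_form 0 (PVar v) \<phi>) \<Delta>) u \<chi> \<Longrightarrow>
    v \<notin> fv_form \<phi> \<union> fv_form \<chi> \<union> fv_ctx \<Delta> \<Longrightarrow> cnames \<Gamma> \<inter> cnames \<Delta> = {} \<Longrightarrow>
    mill (\<Gamma> + \<Delta>) (subst x t u) \<chi>"


section \<open>The translation\<close>

text \<open>
  The argument list always has length two.  Its members are lifted when a quantifier is put in
  front, so that the new variable \<open>BVar 0\<close> is distinct from them.
\<close>

fun tr_lambek :: "'a lambek \<Rightarrow> tm list \<Rightarrow> ('a + 'b) form" where
  "tr_lambek (LAtom p) Cs = Pred (Inl p) Cs"
| "tr_lambek (Over A B) [C, D] =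
     Forall (tr_lambek B [lift_tm D, BVar 0] \<multimap> tr_lambek A [lift_tm C, BVar 0])"
| "tr_lambek (Under B A) [C, D] =
     Forall (tr_lambek B [BVar 0, lift_tm C] \<multimap> tr_lambek A [BVar 0, lift_tm D])"

text \<open>
  \<open>tr A \<alpha>\<close> is the translation of \<open>A\<close> with superscript \<open>flat \<alpha>\<close>, for \<open>\<alpha>\<close> whose shape is the
  prosodic type of \<open>A\<close>.
\<close>

fun tr :: "('a, 'b) hybrid \<Rightarrow> pos ty \<Rightarrow> ('a + 'b) form" where
  "tr (Lambek A) \<alpha> = tr_lambek A (map Pt (flat \<alpha>))"
| "tr (HAtom q) \<alpha> = Pred (Inr q) (map Pt (flat \<alpha>))"
| "tr (Bar A B) (\<beta> \<rightarrow> \<alpha>) = tr B \<beta> \<multimap> tr A \<alpha>"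

text \<open>
  \<open>T\<close> gives the types of the hypotheses and words, \<open>L w\<close> the principal type of the prosodic term
  that the lexicon assigns to the word \<open>w\<close>.
\<close>

primrec tr_hyp ::
  "(name \<Rightarrow> pos ty) \<Rightarrow> (name \<Rightarrow> pos ty) \<Rightarrow> ('a, 'b) hyp \<Rightarrow> name \<times> ('a + 'b) form" where
  "tr_hyp T L (Hyp x A) = (x, tr A (T x))"
| "tr_hyp T L (Lex w W A) = (w, all_over (fv_form (tr A (L w))) (tr A (L w)))"

definition tr_left ::
  "(name \<Rightarrow> pos ty) \<Rightarrow> (name \<Rightarrow> pos ty) \<Rightarrow> ('a, 'b) hyp multiset \<Rightarrow> ('a + 'b) ctx" where
  "tr_left T L \<Gamma> = image_mset (tr_hyp T L) \<Gamma>"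

definition tr_right ::
  "(name \<Rightarrow> pos ty) \<Rightarrow> (name \<Rightarrow> pos ty) \<Rightarrow> ('a, 'b) hyp multiset \<Rightarrow> ('a, 'b) hybrid \<Rightarrow> pos ty
     \<Rightarrow> ('a + 'b) form" where
  "tr_right T L \<Gamma> B \<beta> = all_over (fv_form (tr B \<beta>) - fv_ctx (tr_left T L \<Gamma>)) (tr B \<beta>)"

text \<open>
  \<open>T\<close>, \<open>L\<close> and \<open>\<beta>\<close> decorate the hybrid sequent \<open>\<Gamma> \<turnstile> M : B\<close> with principal types.  Words connect
  two string positions, and these are the only positions in the type of a lexical term: its other
  atoms are type variables, to be closed universally by the translation.
\<close>

definition principal_sequent ::
  "('b \<Rightarrow> unit ty) \<Rightarrow> (name \<Rightarrow> pos ty) \<Rightarrow> (name \<Rightarrow> pos ty) \<Rightarrow>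
   ('a, 'b) hyp multiset \<Rightarrow> trm \<Rightarrow> pos ty \<Rightarrow> ('a, 'b) hybrid \<Rightarrow> bool" where
  "principal_sequent sh T L \<Gamma> M \<beta> B \<longleftrightarrow>
     (\<forall>x. count (image_mset hname \<Gamma>) x \<le> 1) \<and> is_label sh \<Gamma> M B \<and>
     (\<forall>h\<in>#\<Gamma>. shape (T (hname h)) = hyp_pros sh h) \<and> shape \<beta> = pros sh B \<and> principal T M \<beta> \<and>
     (\<forall>w W A. Lex w W A \<in># \<Gamma> \<longrightarrow>
        is_label sh {#Lex w W A#} W A \<and>
        (\<exists>i j. T w = TAtom (Pos j) \<rightarrow> TAtom (Pos i)) \<and>
        shape (L w) = pros sh A \<and> principal T W (L w) \<and>
        (\<forall>k. Pos k \<in> set_ty (L w) \<longrightarrow> Pos k \<in> set_ty (T w)))"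

end

theory Submission
  imports Defs "HOL-Library.Countable"
begin

text \<open>
  From hybrid to first-order proofs, the translation is by induction on proofs, for all typings of
  the label with string positions.  A linear term has only one typing derivation under a fixed
  context and type, so conversion steps and the types of subterms cause no ambiguity.

  Conversely, first-order proofs are evaluated in a model in the style of normalization by
  evaluation: worlds are multisets of hybrid hypotheses, and atoms are interpreted by hybrid
  derivability up to equality of semantic terms.  Reflection and reification show that then every
  translated formula is interpreted by hybrid derivability.  To reify a slash one tests it with a
  fresh position; normal forms and a count of the atoms show that a label using this position has the
  form of a concatenation.  Tensor and exists are interpreted by continuations, so they disappear.
  The label obtained from the model may differ from the given one, but both have the same principal
  type.  In principal types every atom occurs at most once negatively, and such a type has only one
  long normal form (the coherence theorem for linear lambda terms).
\<close>

section \<open>Linear lambda terms: substitution, typing and reduction\<close>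

section \<open>Simultaneous substitution\<close>

text \<open>Hybrid rules have first-order images with the very same semantic term. A first-order
  proof, however, may pass through formulas that translate no hybrid formula, such as tensors and
  existentials, so it has no image rule by rule. The model replaces a cut elimination and subformula
  argument, at the price of equality only up to \<open>\<approx>\<close>. First-order sequents
  record types but no labels. Hence labels are quantified away in the model, and the label found at
  the end can be compared with the given one by types alone. Principality enters twice. For a
  lexical term it makes every type used in a proof an instance of \<open>L w\<close>, reachable by
  instantiating the universal closure. For the whole sequent it yields the distinct negative atoms:
  a long normal form can be retyped with fresh ones, and the principal type must specialize to that
  retyping. Eta is delicate: a variable of atomic type cannot be expanded. Subject expansion is
  therefore relative to a prosodic typing of the expanded term, and uniqueness of typing derivations
  carries this condition to subterms.\<close>

primrec msubst :: "(name \<Rightarrow> trm) \<Rightarrow> trm \<Rightarrow> trm" where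
  "msubst \<sigma> (Var y) = \<sigma> y"
| "msubst \<sigma> (Bound i) = Bound i"
| "msubst \<sigma> (App M N) = App (msubst \<sigma> M) (msubst \<sigma> N)"
| "msubst \<sigma> (Lam M) = Lam (msubst \<sigma> M)"
| "msubst \<sigma> (Tup M N) = Tup (msubst \<sigma> M) (msubst \<sigma> N)"
| "msubst \<sigma> (LetTup M N) = LetTup (msubst \<sigma> M) (msubst \<sigma> N)"

lemma finite_fv [simp]: "finite (fv M)"
  by (induction M) auto

lemma subst_msubst: "subst x N M = msubst (Var(x := N)) M"
  by (induction M) auto

lemma msubst_cong: "(\<And>x. x \<in> fv M \<Longrightarrow> \<sigma> x = \<tau> x) \<Longrightarrow> msubst \<sigma> M = msubst \<tau> M"
  by (induction M) auto

lemma msubst_Var [simp]: "msubst Var M = M"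
  by (induction M) auto

lemma msubst_id: "(\<And>x. x \<in> fv M \<Longrightarrow> \<sigma> x = Var x) \<Longrightarrow> msubst \<sigma> M = M"
  using msubst_cong[of M \<sigma> Var] by simp

lemma msubst_msubst: "msubst \<sigma> (msubst \<tau> M) = msubst (\<lambda>x. msubst \<sigma> (\<tau> x)) M"
  by (induction M) auto

lemma fv_msubst: "fv (msubst \<sigma> M) = (\<Union>x\<in>fv M. fv (\<sigma> x))"
  by (induction M) auto

lemma fv_bind_at [simp]: "fv (bind_at k x M) = fv M - {x}"
  by (induction M arbitrary: k) auto

lemma fv_lam [simp]: "fv (lam x M) = fv M - {x}"
  by (simp add: lam_def)

lemma bind_at_fresh: "x \<notin> fv M \<Longrightarrow> bind_at k x M = M"
  by (induction M arbitrary: k) auto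

lemma lc_at_mono: "lc_at k M \<Longrightarrow> k \<le> l \<Longrightarrow> lc_at l M"
  by (induction M arbitrary: k l) force+

lemma lc_at_bind_at: "lc_at k M \<Longrightarrow> lc_at (Suc k) (bind_at k x M)"
  by (induction M arbitrary: k) auto

lemma lc_at_bind_atD: "lc_at l (bind_at k x M) \<Longrightarrow> lc_at l M"
  by (induction M arbitrary: k l) (auto split: if_splits)

lemma lc_lam: "lc M \<Longrightarrow> lc (lam x M)"
  by (simp add: lam_def lc_at_bind_at)

lemma lc_lettup: "lc N \<Longrightarrow> lc M \<Longrightarrow> lc (lettup N x y M)"
  using lc_at_bind_at[of 0 M y, THEN lc_at_bind_at[of "Suc 0" _ x]]
  by (simp add: lettup_def numeral_2_eq_2)

lemma lc_at_msubst: "lc_at k M \<Longrightarrow> (\<And>x. x \<in> fv M \<Longrightarrow> lc (\<sigma> x)) \<Longrightarrow> lc_at k (msubst \<sigma> M)"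
  by (induction M arbitrary: k) (auto intro: lc_at_mono)

lemma msubst_bind_at:
  "(\<And>z. z \<in> fv M \<Longrightarrow> z \<noteq> x \<Longrightarrow> y \<notin> fv (\<sigma> z)) \<Longrightarrow>
    msubst \<sigma> (bind_at k x M) = bind_at k y (msubst (\<sigma>(x := Var y)) M)"
  by (induction M arbitrary: k) (auto simp: bind_at_fresh)

text \<open>An abstraction stores no binder name, so capture is avoided by choosing a fresh name
  whenever a substitution goes under it.\<close>

lemma msubst_lam:
  "(\<And>z. z \<in> fv M \<Longrightarrow> z \<noteq> x \<Longrightarrow> y \<notin> fv (\<sigma> z)) \<Longrightarrow>
    msubst \<sigma> (lam x M) = lam y (msubst (\<sigma>(x := Var y)) M)"
  by (simp add: lam_def msubst_bind_at)

lemma msubst_lettup: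
  assumes "\<And>z. z \<in> fv M \<Longrightarrow> z \<noteq> x \<Longrightarrow> z \<noteq> y \<Longrightarrow> x' \<notin> fv (\<sigma> z) \<and> y' \<notin> fv (\<sigma> z)"
    and "x \<noteq> y" and "x' \<noteq> y'"
  shows "msubst \<sigma> (lettup N x y M) =
    lettup (msubst \<sigma> N) x' y' (msubst (\<sigma>(x := Var x', y := Var y')) M)"
proof -
  have "msubst \<sigma> (bind_at 1 x (bind_at 0 y M)) =
      bind_at 1 x' (msubst (\<sigma>(x := Var x')) (bind_at 0 y M))"
    using assms by (intro msubst_bind_at) auto
  also have "msubst (\<sigma>(x := Var x')) (bind_at 0 y M) =
      bind_at 0 y' (msubst (\<sigma>(x := Var x', y := Var y')) M)"
    using assms by (intro msubst_bind_at) auto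
  finally show ?thesis by (simp add: lettup_def)
qed

lemma lam_alpha: "y \<notin> fv M - {x} \<Longrightarrow> lam x M = lam y (msubst (Var(x := Var y)) M)"
  using msubst_lam[of M x y Var] by auto

text \<open>Local closure at \<open>k\<close> excludes a dangling \<open>Bound k\<close>, the only
  term other than \<open>Var x\<close> that could produce the index replacing
  \<open>x\<close>.\<close>

lemma bind_at_inject: "bind_at k x M = bind_at k x N \<Longrightarrow> lc_at k M \<Longrightarrow> lc_at k N \<Longrightarrow> M = N"
proof (induction M arbitrary: N k)
  case (Var y)
  then show ?case by (cases N) (auto split: if_splits)
next
  case (Bound i)
  then show ?case by (cases N) (auto split: if_splits)
next
  case (App M1 M2)
  then show ?case by (cases N) (auto split: if_splits)
next
  case (Lam M)
  then show ?case by (cases N) (auto split: if_splits)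
next
  case (Tup M1 M2)
  then show ?case by (cases N) (auto split: if_splits)
next
  case (LetTup M1 M2)
  from LetTup.prems show ?case
    by (cases N) (auto split: if_splits dest: LetTup.IH(1)[of k] LetTup.IH(2)[of "Suc (Suc k)"])
qed

lemma lam_inject:
  assumes "lam x M = lam y N" and "lc M" and "lc N"
  shows "M = msubst (Var(y := Var x)) N" and "fv N - {y} = fv M - {x}"
proof -
  show fv: "fv N - {y} = fv M - {x}"
    using assms(1) by (metis fv_lam)
  have "lam y N = lam x (msubst (Var(y := Var x)) N)"
    using fv by (intro lam_alpha) auto
  with assms show "M = msubst (Var(y := Var x)) N"
    by (auto simp: lam_def intro!: bind_at_inject[of 0 x] lc_at_msubst)
qed

lemma fresh_name: "finite S \<Longrightarrow> \<exists>x::name. x \<notin> S"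
  by (rule ex_new_if_finite) auto

text \<open>Variables have size \<open>0\<close>, so that a linear substitution adds the sizes.\<close>

primrec tsize :: "trm \<Rightarrow> nat" where
  "tsize (Var x) = 0"
| "tsize (Bound i) = 0"
| "tsize (App M N) = Suc (tsize M + tsize N)"
| "tsize (Lam M) = Suc (tsize M)"
| "tsize (Tup M N) = Suc (tsize M + tsize N)"
| "tsize (LetTup M N) = Suc (tsize M + tsize N)"

lemma tsize_bind_at [simp]: "tsize (bind_at k x M) = tsize M"
  by (induction M arbitrary: k) auto

lemma tsize_lam [simp]: "tsize (lam x M) = Suc (tsize M)"
  by (simp add: lam_def)

lemma tsize_rename: "tsize (msubst (Var(x := Var y)) M) = tsize M"
  by (induction M) auto

lemma App_lam [simp]: "App M N \<noteq> lam x P" "lam x P \<noteq> App M N" "Var y \<noteq> lam x P" "lam x P \<noteq> Var y"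
  by (auto simp: lam_def)

lemma subst_lam:
  "y \<notin> fv N \<Longrightarrow> y \<noteq> x \<Longrightarrow> subst x N (lam y M) = lam y (subst x N M)"
  by (subst subst_msubst, subst msubst_lam[where y = y])
    (auto simp: subst_msubst intro!: arg_cong2[where f = lam] msubst_cong)

lemma subst_fresh: "x \<notin> fv M \<Longrightarrow> subst x N M = M"
  unfolding subst_msubst by (rule msubst_id) auto

lemma fv_subst: "x \<in> fv M \<Longrightarrow> fv (subst x N M) = fv M - {x} \<union> fv N"
  unfolding subst_msubst by (auto simp: fv_msubst split: if_splits)

lemma lc_subst: "lc M \<Longrightarrow> lc N \<Longrightarrow> lc (subst x N M)"
  unfolding subst_msubst by (rule lc_at_msubst) auto


section \<open>Linear terms\<close>

lemma prosodic_lc: "prosodic M \<Longrightarrow> lc M"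
  by (induction rule: prosodic.induct) (auto intro: lc_lam)

lemma prosodic_msubst:
  "prosodic M \<Longrightarrow> (\<And>x. x \<in> fv M \<Longrightarrow> prosodic (\<sigma> x)) \<Longrightarrow>
    (\<And>x y. x \<in> fv M \<Longrightarrow> y \<in> fv M \<Longrightarrow> x \<noteq> y \<Longrightarrow> fv (\<sigma> x) \<inter> fv (\<sigma> y) = {}) \<Longrightarrow>
    prosodic (msubst \<sigma> M)"
proof (induction arbitrary: \<sigma> rule: prosodic.induct)
  case (var x)
  then show ?case by simp
next
  case (app M N)
  have "prosodic (msubst \<sigma> M)" "prosodic (msubst \<sigma> N)"
    using app.prems by (auto intro!: app.IH)
  moreover have "fv (msubst \<sigma> M) \<inter> fv (msubst \<sigma> N) = {}"
    using app.prems(2) app.hyps(3) by (fastforce simp: fv_msubst)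
  ultimately show ?case by (simp add: prosodic.app)
next
  case (abs M x)
  obtain y where y: "y \<notin> (\<Union>z\<in>fv M. fv (\<sigma> z))"
    using fresh_name[of "\<Union>z\<in>fv M. fv (\<sigma> z)"] by auto
  have "prosodic (msubst (\<sigma>(x := Var y)) M)"
  proof (rule abs.IH)
    show "prosodic ((\<sigma>(x := Var y)) z)" if "z \<in> fv M" for z
      using that abs.prems(1) by (auto intro: prosodic.var)
    show "fv ((\<sigma>(x := Var y)) u) \<inter> fv ((\<sigma>(x := Var y)) v) = {}"
      if "u \<in> fv M" "v \<in> fv M" "u \<noteq> v" for u v
      using that abs.prems(2)[of u v] y by auto
  qed
  moreover have "y \<in> fv (msubst (\<sigma>(x := Var y)) M)"
    using abs.hyps by (auto simp: fv_msubst)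
  ultimately have "prosodic (lam y (msubst (\<sigma>(x := Var y)) M))"
    by (rule prosodic.abs)
  moreover have "msubst \<sigma> (lam x M) = lam y (msubst (\<sigma>(x := Var y)) M)"
    using y by (intro msubst_lam) auto
  ultimately show ?case by simp
qed

lemma prosodic_rename: "prosodic M \<Longrightarrow> y \<notin> fv M - {x} \<Longrightarrow> prosodic (msubst (Var(x := Var y)) M)"
  by (rule prosodic_msubst) (auto intro: prosodic.var)

lemma prosodic_subst:
  "prosodic M \<Longrightarrow> prosodic N \<Longrightarrow> fv N \<inter> (fv M - {x}) = {} \<Longrightarrow> prosodic (subst x N M)"
  unfolding subst_msubst by (rule prosodic_msubst) (auto intro: prosodic.var)

inductive_cases prosodic_AppE: "prosodic (App M N)"

lemma prosodic_App: "prosodic (App M N) \<longleftrightarrow> prosodic M \<and> prosodic N \<and> fv M \<inter> fv N = {}"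
  by (auto intro: prosodic.app elim!: prosodic_AppE)

text \<open>Inversion returns some other binder, which \<open>lam_inject\<close> renames to
  \<open>x\<close>. Local closure matters: \<open>lam x (Bound 0)\<close> is the identity, hence
  prosodic, although its body is not.\<close>

lemma prosodic_lamD:
  assumes "prosodic (lam x M)" and "lc M"
  shows "prosodic M" and "x \<in> fv M"
proof -
  from assms(1) obtain y N where N: "lam x M = lam y N" "prosodic N" "y \<in> fv N"
    by cases auto
  note inj = lam_inject[OF N(1) assms(2) prosodic_lc[OF N(2)]]
  have "x \<notin> fv N - {y}" using inj(2) by auto
  then show "prosodic M"
    using N(2) prosodic_rename by (subst inj(1)) auto
  show "x \<in> fv M"
    using N(3) by (subst inj(1)) (auto simp: fv_msubst)
qed

lemma prosodic_lam: "lc M \<Longrightarrow> prosodic (lam x M) \<longleftrightarrow> prosodic M \<and> x \<in> fv M"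
  using prosodic_lamD prosodic.abs by blast

lemma prosodic_not [simp]: "\<not> prosodic (Bound i)" "\<not> prosodic (Tup M N)" "\<not> prosodic (LetTup M N)"
  by (auto elim: prosodic.cases simp: lam_def)

lemma prosodic_cases_fresh:
  assumes "prosodic M" and "finite S"
  obtains (var) x where "M = Var x"
  | (app) M1 M2 where "M = App M1 M2" "prosodic M1" "prosodic M2" "fv M1 \<inter> fv M2 = {}"
  | (abs) x M1 where "M = lam x M1" "prosodic M1" "x \<in> fv M1" "x \<notin> S"
  using assms(1)
proof cases
  case (abs N x)
  obtain y where y: "y \<notin> S \<union> fv N"
    using fresh_name[of "S \<union> fv N"] assms(2) by auto
  then have "M = lam y (msubst (Var(x := Var y)) N)"
    using abs(1) by (simp add: lam_alpha)
  moreover have "prosodic (msubst (Var(x := Var y)) N)"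
    using abs(2) y by (intro prosodic_rename) auto
  moreover have "y \<in> fv (msubst (Var(x := Var y)) N)"
    using abs(3) by (auto simp: fv_msubst)
  ultimately show thesis using y that(3) by blast
qed (use that in auto)

text \<open>Induction under the Barendregt convention. It runs on the size because a renamed body is
  not a subterm but has the same size as the original one.\<close>

lemma prosodic_induct_fresh [consumes 2, case_names var app abs]:
  assumes "prosodic M" and "finite S"
    and var: "\<And>x. P (Var x)"
    and app: "\<And>M N. prosodic M \<Longrightarrow> P M \<Longrightarrow> prosodic N \<Longrightarrow> P N \<Longrightarrow> fv M \<inter> fv N = {} \<Longrightarrow> P (App M N)"
    and abs: "\<And>M x. prosodic M \<Longrightarrow> P M \<Longrightarrow> x \<in> fv M \<Longrightarrow> x \<notin> S \<Longrightarrow> P (lam x M)"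
  shows "P M"
  using assms(1)
proof (induction "tsize M" arbitrary: M rule: less_induct)
  case less
  from less.prems assms(2) show ?case
  proof (cases rule: prosodic_cases_fresh)
    case (var x)
    then show ?thesis by (simp add: assms(3))
  next
    case (app M1 M2)
    then show ?thesis by (simp add: assms(4) less.hyps)
  next
    case (abs x M1)
    then show ?thesis by (simp add: assms(5) less.hyps)
  qed
qed

lemma tsize_subst: "prosodic M \<Longrightarrow> x \<in> fv M \<Longrightarrow> tsize (subst x N M) = tsize M + tsize N"
proof -
  assume "prosodic M"
  moreover have "finite ({x} \<union> fv N)" by simp
  ultimately show "x \<in> fv M \<Longrightarrow> tsize (subst x N M) = tsize M + tsize N"
  proof (induction rule: prosodic_induct_fresh)
    case (app M1 M2)
    then show ?case
      by (cases "x \<in> fv M1"; cases "x \<in> fv M2") (auto simp: subst_fresh)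
  qed (auto simp: subst_lam)
qed


section \<open>Typing\<close>

lemma typing_lc: "typing T M \<alpha> \<Longrightarrow> lc M"
  by (induction rule: typing.induct) (auto intro: lc_lam)

lemma typing_cong: "typing T M \<alpha> \<Longrightarrow> (\<And>x. x \<in> fv M \<Longrightarrow> T x = T' x) \<Longrightarrow> typing T' M \<alpha>"
proof (induction arbitrary: T' rule: typing.induct)
  case (var T x)
  then show ?case by (auto intro: typing.var[of T'])
next
  case (app T M \<beta> \<alpha> N)
  then show ?case by (auto intro: typing.app)
next
  case (abs T x \<beta> M \<alpha>)
  then show ?case by (auto intro!: typing.abs)
qed

lemma typing_msubst:
  "typing T M \<alpha> \<Longrightarrow> (\<And>x. x \<in> fv M \<Longrightarrow> typing T' (\<sigma> x) (T x)) \<Longrightarrow> typing T' (msubst \<sigma> M) \<alpha>"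
proof (induction arbitrary: T' \<sigma> rule: typing.induct)
  case (var T x)
  then show ?case by simp
next
  case (app T M \<beta> \<alpha> N)
  have "typing T' (msubst \<sigma> M) (\<beta> \<rightarrow> \<alpha>)" "typing T' (msubst \<sigma> N) \<beta>"
    using app.prems by (auto intro: app.IH)
  then show ?case by (auto intro: typing.app)
next
  case (abs T x \<beta> M \<alpha>)
  obtain y where y: "y \<notin> (\<Union>z\<in>fv M. fv (\<sigma> z))"
    using fresh_name[of "\<Union>z\<in>fv M. fv (\<sigma> z)"] by auto
  have "typing (T'(y := \<beta>)) (msubst (\<sigma>(x := Var y)) M) \<alpha>"
  proof (rule abs.IH)
    fix z assume z: "z \<in> fv M"
    show "typing (T'(y := \<beta>)) ((\<sigma>(x := Var y)) z) ((T(x := \<beta>)) z)"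
    proof (cases "z = x")
      case True
      then show ?thesis using typing.var[of "T'(y := \<beta>)" y] by simp
    next
      case False
      with z have "typing T' (\<sigma> z) (T z)" by (auto intro: abs.prems)
      then have "typing (T'(y := \<beta>)) (\<sigma> z) (T z)"
        by (rule typing_cong) (use y z in auto)
      with False show ?thesis by simp
    qed
  qed
  then have "typing T' (lam y (msubst (\<sigma>(x := Var y)) M)) (\<beta> \<rightarrow> \<alpha>)"
    by (rule typing.abs)
  moreover have "msubst \<sigma> (lam x M) = lam y (msubst (\<sigma>(x := Var y)) M)"
    using y by (intro msubst_lam) auto
  ultimately show ?case by simp
qed

lemma typing_subst:
  assumes "typing (T(x := \<beta>)) M \<alpha>" and "typing T N \<beta>"
  shows "typing T (subst x N M) \<alpha>"
  unfolding subst_msubst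
  by (rule typing_msubst[OF assms(1)]) (auto intro: assms(2) typing.var)

inductive_cases typing_VarE: "typing T (Var x) \<alpha>"
inductive_cases typing_AppE: "typing T (App M N) \<alpha>"

lemma typing_Var: "typing T (Var x) \<alpha> \<longleftrightarrow> \<alpha> = T x"
  by (auto intro: typing.var elim!: typing_VarE)

lemma typing_App: "typing T (App M N) \<alpha> \<longleftrightarrow> (\<exists>\<beta>. typing T M (\<beta> \<rightarrow> \<alpha>) \<and> typing T N \<beta>)"
  by (auto intro: typing.app elim!: typing_AppE)

lemma typing_lam:
  assumes "lc M"
  shows "typing T (lam x M) \<tau> \<longleftrightarrow> (\<exists>\<beta> \<alpha>. \<tau> = \<beta> \<rightarrow> \<alpha> \<and> typing (T(x := \<beta>)) M \<alpha>)"
proof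
  assume "typing T (lam x M) \<tau>"
  then obtain y \<beta> N \<alpha> where N: "lam x M = lam y N" "\<tau> = \<beta> \<rightarrow> \<alpha>" "typing (T(y := \<beta>)) N \<alpha>"
    by cases auto
  note inj = lam_inject[OF N(1) assms typing_lc[OF N(3)]]
  have "typing (T(x := \<beta>)) (msubst (Var(y := Var x)) N) \<alpha>"
    by (rule typing_msubst[OF N(3)]) (use inj(2) in \<open>auto simp: typing_Var\<close>)
  with N(2) inj(1) show "\<exists>\<beta> \<alpha>. \<tau> = \<beta> \<rightarrow> \<alpha> \<and> typing (T(x := \<beta>)) M \<alpha>" by auto
qed (auto intro: typing.abs)

lemma typing_map_ty: "typing T M \<alpha> \<Longrightarrow> typing (\<lambda>x. map_ty f (T x)) M (map_ty f \<alpha>)"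
proof (induction rule: typing.induct)
  case (abs T x \<beta> M \<alpha>)
  have "(\<lambda>y. map_ty f ((T(x := \<beta>)) y)) = (\<lambda>y. map_ty f (T y))(x := map_ty f \<beta>)" by auto
  with abs.IH show ?case by (simp add: typing.abs)
qed (auto simp: typing_Var typing_App)

lemma typing_upd_fresh: "x \<notin> fv M \<Longrightarrow> typing (T(x := \<beta>)) M \<alpha> \<longleftrightarrow> typing T M \<alpha>"
  by (auto intro: typing_cong)

text \<open>The single occurrence of \<open>x\<close> leaves a single copy of \<open>N\<close>,
  whose type is the type wanted for \<open>x\<close>. With several copies the types could
  disagree.\<close>

lemma typing_subst_linear:
  assumes "prosodic M" and "lc N"
  shows "x \<in> fv M \<Longrightarrow> x \<notin> fv N \<Longrightarrow> typing T (subst x N M) \<alpha> \<Longrightarrow>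
    \<exists>\<beta>. typing (T(x := \<beta>)) M \<alpha> \<and> typing T N \<beta>"
proof -
  have "finite ({x} \<union> fv N)" by simp
  with assms(1) show "x \<in> fv M \<Longrightarrow> x \<notin> fv N \<Longrightarrow> typing T (subst x N M) \<alpha> \<Longrightarrow>
    \<exists>\<beta>. typing (T(x := \<beta>)) M \<alpha> \<and> typing T N \<beta>"
  proof (induction arbitrary: T \<alpha> rule: prosodic_induct_fresh)
    case (var y)
    then show ?case by (auto simp: typing_Var)
  next
    case (app M1 M2)
    show ?case
    proof (cases "x \<in> fv M1")
      case True
      with app.hyps have x: "x \<notin> fv M2" by auto
      from app.prems x obtain \<beta> where "typing T (subst x N M1) (\<beta> \<rightarrow> \<alpha>)" "typing T M2 \<beta>"
        by (auto simp: typing_App subst_fresh)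
      from app.IH(1)[OF True app.prems(2) this(1)] obtain \<gamma> where
        \<gamma>: "typing (T(x := \<gamma>)) M1 (\<beta> \<rightarrow> \<alpha>)" "typing T N \<gamma>" by blast
      have "typing (T(x := \<gamma>)) M2 \<beta>"
        by (rule typing_cong[OF \<open>typing T M2 \<beta>\<close>]) (use x in auto)
      with \<gamma> show ?thesis by (blast intro: typing.app)
    next
      case False
      with app.prems have x: "x \<in> fv M2" by auto
      from app.prems False obtain \<beta> where "typing T M1 (\<beta> \<rightarrow> \<alpha>)" "typing T (subst x N M2) \<beta>"
        by (auto simp: typing_App subst_fresh)
      from app.IH(2)[OF x app.prems(2) this(2)] obtain \<gamma> where
        \<gamma>: "typing (T(x := \<gamma>)) M2 \<beta>" "typing T N \<gamma>" by blast
      have "typing (T(x := \<gamma>)) M1 (\<beta> \<rightarrow> \<alpha>)"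
        by (rule typing_cong[OF \<open>typing T M1 (\<beta> \<rightarrow> \<alpha>)\<close>]) (use False in auto)
      with \<gamma> show ?thesis by (blast intro: typing.app)
    qed
  next
    case (abs M y)
    from abs.hyps abs.prems have x: "x \<in> fv M" "x \<noteq> y" "y \<notin> fv N" by auto
    with abs.prems have *: "typing T (lam y (subst x N M)) \<alpha>" by (simp add: subst_lam)
    have "lc (subst x N M)" using abs.hyps assms(2) by (simp add: lc_subst prosodic_lc)
    with * obtain \<gamma> \<delta> where \<alpha>: "\<alpha> = \<gamma> \<rightarrow> \<delta>" "typing (T(y := \<gamma>)) (subst x N M) \<delta>"
      by (auto simp: typing_lam)
    from abs.IH[OF x(1) abs.prems(2) \<alpha>(2)] obtain \<beta> where
      \<beta>: "typing (T(y := \<gamma>, x := \<beta>)) M \<delta>" "typing (T(y := \<gamma>)) N \<beta>" by blast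
    have "typing (T(x := \<beta>, y := \<gamma>)) M \<delta>"
      using \<beta>(1) x(2) by (simp add: fun_upd_twist)
    moreover have "typing T N \<beta>"
      by (rule typing_cong[OF \<beta>(2)]) (use x in auto)
    ultimately show ?case unfolding \<alpha>(1) by (blast intro: typing.abs)
  qed
qed


section \<open>Reduction\<close>

primrec open_at :: "nat \<Rightarrow> name \<Rightarrow> trm \<Rightarrow> trm" where
  "open_at k y (Var x) = Var x"
| "open_at k y (Bound i) = (if i = k then Var y else Bound i)"
| "open_at k y (App M N) = App (open_at k y M) (open_at k y N)"
| "open_at k y (Lam M) = Lam (open_at (Suc k) y M)"
| "open_at k y (Tup M N) = Tup (open_at k y M) (open_at k y N)"
| "open_at k y (LetTup M N) = LetTup (open_at k y M) (open_at (k + 2) y N)"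

lemma open_at_lc: "lc_at k M \<Longrightarrow> open_at k y M = M"
  by (induction M arbitrary: k) auto

lemma lc_at_open_at: "lc_at (Suc k) M \<Longrightarrow> lc_at k (open_at k y M)"
  by (induction M arbitrary: k) auto

lemma open_at_bind_at:
  "y \<noteq> x \<Longrightarrow> k \<noteq> j \<Longrightarrow> open_at k y (bind_at j x M) = bind_at j x (open_at k y M)"
  by (induction M arbitrary: k j) auto

text \<open>The binder on the right captures both the occurrences of \<open>x\<close> and a dangling
  index \<open>k\<close>. Merging the two under a fresh \<open>y\<close> gives the same abstraction
  with a locally closed body.\<close>

lemma bind_at_open_at:
  "y \<notin> fv M \<Longrightarrow> bind_at k y (msubst (Var(x := Var y)) (open_at k y M)) = bind_at k x M"
  by (induction M arbitrary: k) auto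

lemma tsize_open_at [simp]: "tsize (open_at k y M) = tsize M"
  by (induction M arbitrary: k) auto

lemma fv_subst_subset: "fv (subst x N M) \<subseteq> fv M - {x} \<union> fv N"
  unfolding subst_msubst by (auto simp: fv_msubst split: if_splits)

lemma red_fv: "red M N \<Longrightarrow> fv N \<subseteq> fv M"
proof (induction rule: red.induct)
  case (beta M N x)
  then show ?case using fv_subst_subset[of x N M] by simp
qed auto

text \<open>The set \<open>S\<close> collects the binders used in the derivation: opening with one
  of them would let \<open>abs\<close> capture the new name.\<close>

lemma red_open_at:
  "red M N \<Longrightarrow> \<exists>S. finite S \<and> (\<forall>y k. y \<notin> S \<longrightarrow> red (open_at k y M) (open_at k y N))"
proof (induction rule: red.induct)
  case (beta M N x)
  have "lc (App (lam x M) N)" "lc (subst x N M)"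
    using beta by (auto intro: lc_lam lc_subst)
  then have "\<forall>y k. red (open_at k y (App (lam x M) N)) (open_at k y (subst x N M))"
    using red.beta[OF beta] by (simp add: open_at_lc[OF lc_at_mono] del: open_at.simps)
  then show ?case by blast
next
  case (eta M x)
  have "lc (lam x (App M (Var x)))"
    using eta by (auto intro: lc_lam)
  then have "\<forall>y k. red (open_at k y (lam x (App M (Var x)))) (open_at k y M)"
    using red.eta[OF eta] eta(1) by (simp add: open_at_lc[OF lc_at_mono])
  then show ?case by blast
next
  case (abs M M' x)
  then obtain S where S: "finite S" "\<forall>y k. y \<notin> S \<longrightarrow> red (open_at k y M) (open_at k y M')"
    by blast
  have "red (open_at k y (lam x M)) (open_at k y (lam x M'))" if "y \<notin> insert x S" for y k
    using that S(2) red.abs[of "open_at (Suc k) y M" "open_at (Suc k) y M'" x]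
    by (simp add: lam_def open_at_bind_at)
  with S(1) show ?case by (intro exI[of _ "insert x S"]) simp
next
  case (appL M M' N)
  then show ?case by (auto intro: red.appL)
next
  case (appR N N' M)
  then show ?case by (auto intro: red.appR)
qed

lemma red_msubst:
  "red M N \<Longrightarrow> (\<And>x. lc (\<sigma> x)) \<Longrightarrow> red (msubst \<sigma> M) (msubst \<sigma> N)"
proof (induction arbitrary: \<sigma> rule: red.induct)
  case (beta M N x)
  obtain y where y: "y \<notin> (\<Union>z\<in>fv M. fv (\<sigma> z))"
    using fresh_name[of "\<Union>z\<in>fv M. fv (\<sigma> z)"] by auto
  let ?M = "msubst (\<sigma>(x := Var y)) M"
  have "red (App (lam y ?M) (msubst \<sigma> N)) (subst y (msubst \<sigma> N) ?M)"
    using beta by (intro red.beta lc_at_msubst) auto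
  moreover have "msubst \<sigma> (lam x M) = lam y ?M"
    using y by (intro msubst_lam) auto
  moreover have "subst y (msubst \<sigma> N) ?M = msubst \<sigma> (subst x N M)"
    unfolding subst_msubst msubst_msubst
    by (rule msubst_cong) (use y in \<open>auto intro!: msubst_id\<close>)
  ultimately show ?case by simp
next
  case (eta M x)
  obtain y where y: "y \<notin> (\<Union>z\<in>fv M. fv (\<sigma> z))"
    using fresh_name[of "\<Union>z\<in>fv M. fv (\<sigma> z)"] by auto
  have "msubst \<sigma> (lam x (App M (Var x))) = lam y (msubst (\<sigma>(x := Var y)) (App M (Var x)))"
    using y by (intro msubst_lam) auto
  also have "msubst (\<sigma>(x := Var y)) (App M (Var x)) = App (msubst \<sigma> M) (Var y)"
    using eta(2) by (auto intro: msubst_cong)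
  finally show ?case
    using eta y by (auto simp: fv_msubst intro!: red.eta lc_at_msubst)
next
  case (abs M M' x)
  obtain y where y: "y \<notin> (\<Union>z\<in>fv M. fv (\<sigma> z))"
    using fresh_name[of "\<Union>z\<in>fv M. fv (\<sigma> z)"] by auto
  have "red (msubst (\<sigma>(x := Var y)) M) (msubst (\<sigma>(x := Var y)) M')"
    using abs.prems by (intro abs.IH) auto
  moreover have "msubst \<sigma> (lam x M) = lam y (msubst (\<sigma>(x := Var y)) M)"
    using y by (intro msubst_lam) auto
  moreover have "msubst \<sigma> (lam x M') = lam y (msubst (\<sigma>(x := Var y)) M')"
    using y red_fv[OF abs.hyps] by (intro msubst_lam) auto
  ultimately show ?case by (simp add: red.abs)
qed (auto intro: red.appL red.appR)

text \<open>
  The rules \<open>appL\<close>, \<open>appR\<close> and \<open>abs\<close> of \<open>red\<close> also apply to terms with dangling indices, which the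
  surrounding \<open>lam\<close> then binds; opening them shows that these can be avoided.
\<close>

lemma red_induct_lc [consumes 2, case_names beta eta appL appR abs]:
  assumes "red M N" and "lc M"
    and beta: "\<And>M N x. lc M \<Longrightarrow> lc N \<Longrightarrow> P (App (lam x M) N) (subst x N M)"
    and eta: "\<And>M x. lc M \<Longrightarrow> x \<notin> fv M \<Longrightarrow> P (lam x (App M (Var x))) M"
    and appL: "\<And>M M' N. red M M' \<Longrightarrow> lc M \<Longrightarrow> lc M' \<Longrightarrow> lc N \<Longrightarrow> P M M' \<Longrightarrow>
      P (App M N) (App M' N)"
    and appR: "\<And>M N N'. red N N' \<Longrightarrow> lc M \<Longrightarrow> lc N \<Longrightarrow> lc N' \<Longrightarrow> P N N' \<Longrightarrow>
      P (App M N) (App M N')"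
    and abs: "\<And>M M' x. red M M' \<Longrightarrow> lc M \<Longrightarrow> lc M' \<Longrightarrow> P M M' \<Longrightarrow> P (lam x M) (lam x M')"
  shows "P M N"
proof -
  have "lc N \<and> P M N"
    using assms(1,2)
  proof (induction "tsize M" arbitrary: M N rule: less_induct)
    case less
    from less.prems(1) show ?case
    proof cases
      case (beta M N x)
      then show ?thesis by (auto intro: assms(3) lc_subst)
    next
      case (eta x)
      then show ?thesis by (auto intro: assms(4))
    next
      case (appL M M' N)
      with less.hyps[of M M'] less.prems(2) show ?thesis by (auto intro: assms(5))
    next
      case (appR N N' M)
      with less.hyps[of N N'] less.prems(2) show ?thesis by (auto intro: assms(6))
    next
      case (abs L L' x)
      from red_open_at[OF abs(3)] obtain S where
        S: "finite S" "\<forall>y k. y \<notin> S \<longrightarrow> red (open_at k y L) (open_at k y L')" by blast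
      obtain y where y: "y \<notin> S \<union> fv L \<union> fv L'"
        using fresh_name[of "S \<union> fv L \<union> fv L'"] S(1) by auto
      let ?o = "\<lambda>L. msubst (Var(x := Var y)) (open_at 0 y L)"
      have "red (?o L) (?o L')"
        using S(2) y by (intro red_msubst) auto
      moreover have "lc_at 1 L"
        using less.prems(2) abs(1) by (auto simp: lam_def dest: lc_at_bind_atD)
      then have "lc (?o L)"
        by (intro lc_at_msubst lc_at_open_at) auto
      moreover have "M = lam y (?o L)" "N = lam y (?o L')"
        using abs y by (auto simp: lam_def bind_at_open_at)
      moreover have "tsize (?o L) < tsize M"
        using abs(1) by (simp add: tsize_rename)
      ultimately show ?thesis
        using less.hyps[of "?o L" "?o L'"] assms(7)[of "?o L" "?o L'" y] by (auto intro: lc_lam)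
    qed
  qed
  then show ?thesis ..
qed

text \<open>A linear step neither copies nor erases: a beta or eta contraction loses exactly one
  application and one abstraction. Normalization therefore needs only the size, no types.\<close>

lemma red_prosodic:
  assumes "red M N" and "prosodic M"
  shows "prosodic N \<and> fv N = fv M \<and> tsize N < tsize M"
  using assms(1) prosodic_lc[OF assms(2)] assms(2)
proof (induction rule: red_induct_lc)
  case (beta M N x)
  then have M: "prosodic M" "x \<in> fv M" and N: "prosodic N" "(fv M - {x}) \<inter> fv N = {}"
    by (auto simp: prosodic_App prosodic_lam)
  then show ?case
    by (auto simp: fv_subst tsize_subst intro!: prosodic_subst)
next
  case (eta M x)
  then show ?case by (auto simp: prosodic_lam prosodic_App)
next
  case (appL M M' N)
  then show ?case by (auto simp: prosodic_App)
next
  case (appR M N N')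
  then show ?case by (auto simp: prosodic_App)
next
  case (abs M M' x)
  then show ?case by (auto simp: prosodic_lam)
qed

lemma red_typing:
  assumes "red M N" and "typing T M \<alpha>"
  shows "typing T N \<alpha>"
  using assms(1) typing_lc[OF assms(2)] assms(2)
proof (induction arbitrary: T \<alpha> rule: red_induct_lc)
  case (beta M N x)
  then obtain \<beta> where "typing (T(x := \<beta>)) M \<alpha>" "typing T N \<beta>"
    by (fastforce simp: typing_App typing_lam)
  then show ?case by (rule typing_subst)
next
  case (eta M x)
  then obtain \<beta> \<gamma> \<delta> where "\<alpha> = \<beta> \<rightarrow> \<gamma>" "typing (T(x := \<beta>)) M (\<delta> \<rightarrow> \<gamma>)"
    "typing (T(x := \<beta>)) (Var x) \<delta>"
    by (fastforce simp: typing_App typing_lam)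
  then show ?case using eta(2) by (simp add: typing_upd_fresh typing_Var)
next
  case (appL M M' N)
  then show ?case by (fastforce simp: typing_App)
next
  case (appR M N N')
  then show ?case by (fastforce simp: typing_App)
next
  case (abs M M' x)
  from abs.prems obtain \<beta> \<gamma> where "\<alpha> = \<beta> \<rightarrow> \<gamma>" "typing (T(x := \<beta>)) M \<gamma>"
    unfolding typing_lam[OF abs.hyps(2)] by blast
  with abs.IH[of "T(x := \<beta>)" \<gamma>] show ?case by (blast intro: typing.abs)
qed

lemma reds_prosodic: "red\<^sup>*\<^sup>* M N \<Longrightarrow> prosodic M \<Longrightarrow> prosodic N \<and> fv N = fv M"
  by (induction rule: rtranclp_induct) (use red_prosodic in auto)

lemma reds_typing: "red\<^sup>*\<^sup>* M N \<Longrightarrow> typing T M \<alpha> \<Longrightarrow> typing T N \<alpha>"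
  by (induction rule: rtranclp_induct) (use red_typing in auto)

lemma reds_App: "red\<^sup>*\<^sup>* M M' \<Longrightarrow> red\<^sup>*\<^sup>* N N' \<Longrightarrow> red\<^sup>*\<^sup>* (App M N) (App M' N')"
proof -
  assume "red\<^sup>*\<^sup>* M M'" "red\<^sup>*\<^sup>* N N'"
  have "red\<^sup>*\<^sup>* (App M N) (App M' N)"
    using \<open>red\<^sup>*\<^sup>* M M'\<close>
    by (induction rule: rtranclp_induct) (auto intro: red.appL rtranclp.rtrancl_into_rtrancl)
  moreover have "red\<^sup>*\<^sup>* (App M' N) (App M' N')"
    using \<open>red\<^sup>*\<^sup>* N N'\<close>
    by (induction rule: rtranclp_induct) (auto intro: red.appR rtranclp.rtrancl_into_rtrancl)
  ultimately show ?thesis by (rule rtranclp_trans)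
qed

lemma reds_lam: "red\<^sup>*\<^sup>* M M' \<Longrightarrow> red\<^sup>*\<^sup>* (lam x M) (lam x M')"
  by (induction rule: rtranclp_induct) (auto intro: red.abs rtranclp.rtrancl_into_rtrancl)


section \<open>Normalization and uniqueness of typing derivations\<close>

section \<open>Normal forms\<close>

inductive ne :: "trm \<Rightarrow> bool" and nf :: "trm \<Rightarrow> bool" where
  ne_var: "ne (Var x)"
| ne_app: "ne M \<Longrightarrow> nf N \<Longrightarrow> ne (App M N)"
| nf_ne: "ne M \<Longrightarrow> nf M"
| nf_lam: "nf M \<Longrightarrow> nf (lam x M)"

lemma ne_nf_lc: "(ne M \<longrightarrow> lc M) \<and> (nf N \<longrightarrow> lc N)"
  by (rule ne_nf.induct) (auto intro: lc_lam)

lemmas nf_lc = ne_nf_lc[THEN conjunct2, rule_format]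

inductive_cases ne_AppE: "ne (App M N)"

lemma not_ne_lam [simp]: "\<not> ne (lam x M)"
  by (auto elim: ne.cases simp: lam_def)

lemma ne_nf_rename:
  "(ne M \<longrightarrow> (\<forall>f. ne (msubst (\<lambda>x. Var (f x)) M))) \<and>
   (nf N \<longrightarrow> (\<forall>f. nf (msubst (\<lambda>x. Var (f x)) N)))"
proof (rule ne_nf.induct)
  fix M x
  assume IH: "\<forall>f. nf (msubst (\<lambda>x. Var (f x)) M)"
  show "\<forall>f. nf (msubst (\<lambda>x. Var (f x)) (lam x M))"
  proof
    fix f :: "name \<Rightarrow> name"
    obtain y where y: "y \<notin> f ` fv M"
      using fresh_name[of "f ` fv M"] by auto
    have "msubst (\<lambda>x. Var (f x)) (lam x M) = lam y (msubst ((\<lambda>x. Var (f x))(x := Var y)) M)"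
      using y by (intro msubst_lam) auto
    moreover have "(\<lambda>x. Var (f x))(x := Var y) = (\<lambda>z. Var ((f(x := y)) z))" by auto
    ultimately show "nf (msubst (\<lambda>x. Var (f x)) (lam x M))"
      using IH by (metis nf_lam)
  qed
qed (auto intro: ne_var ne_app nf_ne)

lemma nf_rename: "nf N \<Longrightarrow> nf (msubst (Var(x := Var y)) N)"
proof -
  assume "nf N"
  moreover have "Var(x := Var y) = (\<lambda>z. Var ((id(x := y)) z))" by auto
  ultimately show ?thesis using ne_nf_rename by metis
qed

lemma nf_cases_fresh:
  assumes "nf M" and "finite S"
  obtains (ne) "ne M" | (lam) x M' where "M = lam x M'" "nf M'" "x \<notin> S"
  using assms(1)
proof cases
  case (nf_lam M' x)
  obtain y where y: "y \<notin> S \<union> fv M'"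
    using fresh_name[of "S \<union> fv M'"] assms(2) by auto
  then have "M = lam y (msubst (Var(x := Var y)) M')"
    using nf_lam(1) by (simp add: lam_alpha)
  with nf_rename[OF nf_lam(2)] y that(2) show thesis by blast
qed (use that in auto)

lemma progress: "prosodic M \<Longrightarrow> nf M \<or> (\<exists>N. red M N)"
proof (induction rule: prosodic.induct)
  case (app M N)
  show ?case
  proof (cases "nf M \<and> nf N")
    case True
    then have "nf M" ..
    then show ?thesis
    proof cases
      case nf_ne
      with True show ?thesis by (auto intro: ne_nf.intros)
    next
      case (nf_lam P x)
      with True have "red (App M N) (subst x N P)" by (auto intro: red.beta nf_lc)
      then show ?thesis by blast
    qed
  next
    case False
    with app.IH show ?thesis by (auto intro: red.appL red.appR)
  qed
qed (auto intro: ne_nf.intros red.abs)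

lemma normalize: "prosodic M \<Longrightarrow> \<exists>N. red\<^sup>*\<^sup>* M N \<and> nf N"
proof (induction "tsize M" arbitrary: M rule: less_induct)
  case less
  show ?case
  proof (cases "nf M")
    case False
    with progress[OF less.prems] obtain M' where M': "red M M'" by blast
    with less.hyps[of M'] red_prosodic[OF M' less.prems] obtain N where "red\<^sup>*\<^sup>* M' N" "nf N"
      by blast
    with M' show ?thesis by (meson converse_rtranclp_into_rtranclp)
  qed auto
qed

primrec head :: "trm \<Rightarrow> name" where
  "head (Var x) = x"
| "head (App M N) = head M"
| "head (Bound i) = undefined"
| "head (Lam M) = undefined"
| "head (Tup M N) = undefined"
| "head (LetTup M N) = undefined"

lemma ne_nf_head: "(ne M \<longrightarrow> head M \<in> fv M) \<and> (nf N \<longrightarrow> True)"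
  by (rule ne_nf.induct) auto

lemmas ne_head = ne_nf_head[THEN conjunct1, rule_format]

text \<open>The type of the head fixes the types of all arguments along the spine and of what
  remains after them.\<close>

lemma ne_typing_unique:
  "ne M \<Longrightarrow> typing T M \<alpha> \<Longrightarrow> typing T' M \<alpha>' \<Longrightarrow> T (head M) = T' (head M) \<Longrightarrow> \<alpha> = \<alpha>'"
proof (induction M arbitrary: \<alpha> \<alpha>')
  case (App M N)
  then show ?case by (auto simp: typing_App elim!: ne_AppE)
qed (auto simp: typing_Var elim: ne.cases)

text \<open>Isolates the application of the head to its first argument \<open>R\<close>. This is the
  part that becomes a redex when an abstraction is substituted for the head.\<close>

lemma ne_head_split:
  assumes "ne P" and "prosodic P" and "P \<noteq> Var (head P)" and "y \<notin> fv P"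
  shows "\<exists>P0 R. P = subst y (App (Var (head P)) R) P0 \<and> prosodic P0 \<and> prosodic R \<and> y \<in> fv P0 \<and>
    fv P = insert (head P) (fv P0 - {y} \<union> fv R) \<and> fv P0 \<inter> fv R = {} \<and>
    head P \<notin> fv P0 \<and> head P \<notin> fv R"
  using assms
proof (induction P rule: trm.induct)
  case (App M N)
  show ?case
  proof (cases "M = Var (head M)")
    case True
    then obtain x where "M = Var x" by blast
    with App.prems show ?thesis
      by (intro exI[of _ "Var y"] exI[of _ N]) (auto simp: prosodic_App intro: prosodic.var)
  next
    case False
    with App.IH(1) App.prems obtain P0 R where
      *: "M = subst y (App (Var (head M)) R) P0" "prosodic P0" "prosodic R" "y \<in> fv P0"
      "fv M = insert (head M) (fv P0 - {y} \<union> fv R)" "fv P0 \<inter> fv R = {}"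
      "head M \<notin> fv P0" "head M \<notin> fv R"
      by (auto simp: prosodic_App elim!: ne_AppE)
    have N: "prosodic N" "fv M \<inter> fv N = {}" "y \<notin> fv N"
      using App.prems by (auto simp: prosodic_App)
    then have "App M N = subst y (App (Var (head M)) R) (App P0 N)"
      using *(1) by (simp add: subst_fresh)
    moreover have "prosodic (App P0 N)"
      using * N by (auto simp: prosodic_App)
    moreover have "fv (App M N) = insert (head M) (fv (App P0 N) - {y} \<union> fv R)"
      "fv (App P0 N) \<inter> fv R = {}" "head M \<notin> fv (App P0 N)" "y \<in> fv (App P0 N)"
      using * N by auto
    ultimately show ?thesis using *(3,8) by (intro exI[of _ "App P0 N"] exI[of _ R]) simp
  qed
qed (auto elim: ne.cases)


section \<open>Uniqueness of typing derivations\<close>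

text \<open>
  A linear term under a fixed context and a fixed type has only one typing derivation: the type at
  which \<open>N\<close> is cut into \<open>P\<close> is determined.  The induction is on the size of the cut, with the size
  of \<open>N\<close> as a secondary measure; if \<open>P\<close> is normal with head \<open>x\<close> and \<open>N\<close> is an abstraction, then the
  cut is reduced to two smaller ones.
\<close>

lemma cut_type_unique:
  assumes "prosodic P" and "prosodic N" and "x \<in> fv P" and "fv P \<inter> fv N = {}"
    and "typing (T(x := \<beta>1)) P \<alpha>" and "typing T N \<beta>1"
    and "typing (T(x := \<beta>2)) P \<alpha>" and "typing T N \<beta>2"
  shows "\<beta>1 = \<beta>2"
proof -
  have "\<forall>x T \<beta>1 \<beta>2 \<alpha>. prosodic P \<longrightarrow> prosodic N \<longrightarrow> x \<in> fv P \<longrightarrow> fv P \<inter> fv N = {} \<longrightarrow>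
    typing (T(x := \<beta>1)) P \<alpha> \<longrightarrow> typing T N \<beta>1 \<longrightarrow>
    typing (T(x := \<beta>2)) P \<alpha> \<longrightarrow> typing T N (\<beta>2 :: 'a ty) \<longrightarrow> \<beta>1 = \<beta>2"
  proof (induction "(P, N)" arbitrary: P N
      rule: wf_induct_rule[OF wf_measures[of "[\<lambda>(P, N). tsize P + tsize N, \<lambda>(P, N). tsize N]"]])
    case (1 P N)
    have IH: "\<beta>1 = \<beta>2"
      if "tsize P' + tsize N' < tsize P + tsize N \<or>
        tsize P' + tsize N' = tsize P + tsize N \<and> tsize N' < tsize N"
        and "prosodic P'" "prosodic N'" "x \<in> fv P'" "fv P' \<inter> fv N' = {}"
        "typing (T(x := \<beta>1)) P' \<alpha>" "typing T N' \<beta>1"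
        "typing (T(x := \<beta>2)) P' \<alpha>" "typing T N' \<beta>2"
      for P' N' x T \<alpha> and \<beta>1 \<beta>2 :: "'a ty"
      using 1[of P' N'] that by simp
    show ?case
    proof (intro allI impI)
      fix x T and \<beta>1 \<beta>2 \<alpha> :: "'a ty"
      assume P: "prosodic P" and N: "prosodic N" and x: "x \<in> fv P" and disj: "fv P \<inter> fv N = {}"
        and t1: "typing (T(x := \<beta>1)) P \<alpha>" and n1: "typing T N \<beta>1"
        and t2: "typing (T(x := \<beta>2)) P \<alpha>" and n2: "typing T N \<beta>2"
      have "finite (insert x (fv P \<union> fv N))" by simp
      with N show "\<beta>1 = \<beta>2"
      proof (cases rule: prosodic_cases_fresh)
        case (var y)
        with n1 n2 show ?thesis by (simp add: typing_Var)
      next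
        case (app N1 N2)
        \<comment> \<open>The argument \<open>N2\<close> moves across the cut, so that
          \<open>x\<close> now stands for the function \<open>N1\<close>. The total size is
          unchanged and the second measure drops.\<close>
        let ?P = "subst x (App (Var x) N2) P"
        from n1 n2 app(1) obtain \<delta>1 \<delta>2 where
          \<delta>: "typing T N1 (\<delta>1 \<rightarrow> \<beta>1)" "typing T N2 \<delta>1" "typing T N1 (\<delta>2 \<rightarrow> \<beta>2)" "typing T N2 \<delta>2"
          by (auto simp: typing_App)
        have xN: "x \<notin> fv N1" "x \<notin> fv N2" using x disj app by auto
        have ty: "typing (T(x := \<delta> \<rightarrow> \<beta>)) ?P \<alpha>"
          if "typing (T(x := \<beta>)) P \<alpha>" "typing T N2 \<delta>" for \<beta> \<delta>
          unfolding subst_msubst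
        proof (rule typing_msubst[OF that(1)])
          fix z
          have "typing (T(x := \<delta> \<rightarrow> \<beta>)) N2 \<delta>"
            using that(2) xN(2) by (simp only: typing_upd_fresh simp_thms)
          then have "typing (T(x := \<delta> \<rightarrow> \<beta>)) (App (Var x) N2) \<beta>"
            unfolding typing_App typing_Var by auto
          then show "typing (T(x := \<delta> \<rightarrow> \<beta>)) ((Var(x := App (Var x) N2)) z) ((T(x := \<beta>)) z)"
            by (cases "z = x") (simp_all add: typing_Var)
        qed
        have "(\<delta>1 \<rightarrow> \<beta>1) = (\<delta>2 \<rightarrow> \<beta>2)"
        proof (rule IH[OF _ _ app(2) _ _ ty[OF t1 \<delta>(2)] \<delta>(1) ty[OF t2 \<delta>(4)] \<delta>(3)])
          show "prosodic ?P"
            using P app disj xN by (intro prosodic_subst) (auto simp: prosodic_App intro: prosodic.var)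
          show "tsize ?P + tsize N1 < tsize P + tsize N \<or>
              tsize ?P + tsize N1 = tsize P + tsize N \<and> tsize N1 < tsize N"
            using app(1) by (simp add: tsize_subst[OF P x])
          show "x \<in> fv ?P" "fv ?P \<inter> fv N1 = {}"
            using x disj app xN by (auto simp: fv_subst)
        qed
        then show ?thesis by simp
      next
        case (abs w Q)
        note N_eq = abs(1) and Q = abs(2,3) and w = abs(4)
        show ?thesis
        proof (cases "nf P")
          case False
          then obtain P' where red: "red P P'" using progress[OF P] by blast
          from red_prosodic[OF red P] show ?thesis
            using x disj by (intro IH[OF _ _ N _ _ red_typing[OF red t1] n1 red_typing[OF red t2] n2]) auto
        next
          case True
          moreover have "finite (insert x (fv P \<union> fv N))" by simp
          ultimately show ?thesis
          proof (cases rule: nf_cases_fresh)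
            case (lam u P1)
            have lc: "lc P1" using lam(2) by (rule nf_lc)
            have u: "u \<noteq> x" "u \<notin> fv N" using lam(3) by auto
            from t1 obtain \<gamma> \<delta> where \<gamma>: "\<alpha> = \<gamma> \<rightarrow> \<delta>" "typing (T(x := \<beta>1, u := \<gamma>)) P1 \<delta>"
              unfolding lam(1) typing_lam[OF lc] by blast
            from t2 \<gamma>(1) have \<gamma>': "typing (T(x := \<beta>2, u := \<gamma>)) P1 \<delta>"
              unfolding lam(1) typing_lam[OF lc] by blast
            show ?thesis
            proof (rule IH[of P1 N x "T(u := \<gamma>)" \<beta>1 \<delta> \<beta>2])
              show "typing (T(u := \<gamma>, x := \<beta>1)) P1 \<delta>" "typing (T(u := \<gamma>, x := \<beta>2)) P1 \<delta>"
                using \<gamma>(2) \<gamma>' u(1) by (simp_all only: fun_upd_twist[of u x] not_False_eq_True)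
              show "typing (T(u := \<gamma>)) N \<beta>1" "typing (T(u := \<gamma>)) N \<beta>2"
                using n1 n2 u(2) by (simp_all only: typing_upd_fresh not_False_eq_True)
              show "prosodic P1" using P lam(1) lc by (simp add: prosodic_lam)
              show "x \<in> fv P1" "fv P1 \<inter> fv N = {}" using x u disj lam(1) by auto
            qed (use N lam(1) in auto)
          next
            case ne
            show ?thesis
            proof (cases "head P = x")
              case True
              show ?thesis
              proof (cases "P = Var x")
                case True
                with t1 t2 show ?thesis by (simp add: typing_Var)
              next
                case False
                obtain y where y: "y \<notin> insert x (insert w (fv P \<union> fv N))"
                  using fresh_name[of "insert x (insert w (fv P \<union> fv N))"] by auto
                from ne_head_split[OF ne P, of y] y False True obtain P0 R where
                  P0: "P = subst y (App (Var x) R) P0" "prosodic P0" "prosodic R" "y \<in> fv P0"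
                  "fv P = insert x (fv P0 - {y} \<union> fv R)" "fv P0 \<inter> fv R = {}"
                  "x \<notin> fv P0" "x \<notin> fv R" by auto
                have split: "\<exists>\<rho> \<tau>. \<beta> = \<rho> \<rightarrow> \<tau> \<and> typing (T(y := \<tau>)) P0 \<alpha> \<and> typing T R \<rho> \<and>
                    typing (T(w := \<rho>)) Q \<tau>"
                  if t: "typing (T(x := \<beta>)) P \<alpha>" and n: "typing T N \<beta>" for \<beta>
                proof -
                  have "y \<notin> fv (App (Var x) R)" using y P0 by auto
                  moreover have "lc (App (Var x) R)" using P0(3) by (simp add: prosodic_lc)
                  ultimately obtain \<tau> where
                    \<tau>: "typing (T(x := \<beta>, y := \<tau>)) P0 \<alpha>" "typing (T(x := \<beta>)) (App (Var x) R) \<tau>"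
                    using typing_subst_linear[OF P0(2) _ P0(4)] t unfolding P0(1) by blast
                  from \<tau>(2) obtain \<rho> where \<rho>: "\<beta> = \<rho> \<rightarrow> \<tau>" "typing (T(x := \<beta>)) R \<rho>"
                    unfolding typing_App typing_Var by auto
                  have "typing (T(y := \<tau>)) P0 \<alpha>"
                    by (rule typing_cong[OF \<tau>(1)]) (use P0(7) in auto)
                  moreover have "typing T R \<rho>"
                    by (rule typing_cong[OF \<rho>(2)]) (use P0(8) in auto)
                  moreover have "typing (T(w := \<rho>)) Q \<tau>"
                    using n \<rho>(1) unfolding N_eq typing_lam[OF prosodic_lc[OF Q(1)]] by blast
                  ultimately show ?thesis using \<rho>(1) by blast
                qed
                from split[OF t1 n1] obtain \<rho>1 \<tau>1 where
                  s1: "\<beta>1 = \<rho>1 \<rightarrow> \<tau>1" "typing (T(y := \<tau>1)) P0 \<alpha>" "typing T R \<rho>1"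
                    "typing (T(w := \<rho>1)) Q \<tau>1" by blast
                from split[OF t2 n2] obtain \<rho>2 \<tau>2 where
                  s2: "\<beta>2 = \<rho>2 \<rightarrow> \<tau>2" "typing (T(y := \<tau>2)) P0 \<alpha>" "typing T R \<rho>2"
                    "typing (T(w := \<rho>2)) Q \<tau>2" by blast
                have size: "tsize P = Suc (tsize P0 + tsize R)" "tsize N = Suc (tsize Q)"
                  using N_eq by (simp_all add: P0(1) tsize_subst[OF P0(2,4)])
                have fvQ: "fv Q \<inter> fv R = {}" "fv Q \<inter> fv P0 = {}" "w \<notin> fv R" "w \<notin> fv P0"
                  using disj N_eq P0 w y by auto
                \<comment> \<open>Cutting \<open>lam w Q\<close> for the head gives the redex of
                  \<open>lam w Q\<close> and \<open>R\<close>. The cut of its contractum into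
                  \<open>P0\<close> comes first: only when the result types agree do the two typings
                  of \<open>Q\<close> share a goal type, as the cut of \<open>R\<close> into
                  \<open>Q\<close> demands.\<close>
                have "\<tau>1 = \<tau>2"
                proof (rule IH[OF _ P0(2) _ P0(4) _ s1(2) _ s2(2)])
                  show "tsize P0 + tsize (subst w R Q) < tsize P + tsize N \<or>
                    tsize P0 + tsize (subst w R Q) = tsize P + tsize N \<and>
                      tsize (subst w R Q) < tsize N"
                    using size by (simp add: tsize_subst[OF Q])
                  show "prosodic (subst w R Q)" using Q P0(3) fvQ by (intro prosodic_subst) auto
                  show "fv P0 \<inter> fv (subst w R Q) = {}"
                    using fvQ P0(6) Q by (auto simp: fv_subst)
                  show "typing T (subst w R Q) \<tau>1" "typing T (subst w R Q) \<tau>2"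
                    using s1 s2 by (blast intro: typing_subst)+
                qed
                moreover from this have "\<rho>1 = \<rho>2"
                  using s2(4) Q P0(3) fvQ size by (intro IH[OF _ Q(1) P0(3) Q(2) _ s1(4,3) _ s2(3)]) auto
                ultimately show ?thesis using s1(1) s2(1) by simp
              qed
            next
              case False
              with ne x obtain P1 P2 where P12: "P = App P1 P2" "ne P1" "nf P2"
                by (auto elim: ne.cases)
              from t1 t2 obtain \<gamma>1 \<gamma>2 where
                \<gamma>: "typing (T(x := \<beta>1)) P1 (\<gamma>1 \<rightarrow> \<alpha>)" "typing (T(x := \<beta>1)) P2 \<gamma>1"
                "typing (T(x := \<beta>2)) P1 (\<gamma>2 \<rightarrow> \<alpha>)" "typing (T(x := \<beta>2)) P2 \<gamma>2"
                unfolding P12(1) typing_App by blast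
              \<comment> \<open>The head differs from \<open>x\<close>, so it has the same type in
                both typings. This fixes the type of the argument \<open>P2\<close>, and the cut
                descends into whichever of \<open>P1\<close> and \<open>P2\<close> contains
                \<open>x\<close>.\<close>
              have "(\<gamma>1 \<rightarrow> \<alpha>) = (\<gamma>2 \<rightarrow> \<alpha>)"
                by (rule ne_typing_unique[OF P12(2) \<gamma>(1,3)]) (use False P12(1) in auto)
              then have eq: "\<gamma>2 = \<gamma>1" by simp
              have pros: "prosodic P1" "prosodic P2" "fv P1 \<inter> fv P2 = {}"
                using P P12(1) by (auto simp: prosodic_App)
              show ?thesis
              proof (cases "x \<in> fv P1")
                case True
                show ?thesis
                  by (rule IH[OF _ pros(1) N True _ \<gamma>(1) n1 \<gamma>(3)[unfolded eq] n2])
                    (use P12(1) disj in auto)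
              next
                case False
                with x P12(1) have x2: "x \<in> fv P2" by auto
                show ?thesis
                  by (rule IH[OF _ pros(2) N x2 _ \<gamma>(2) n1 \<gamma>(4)[unfolded eq] n2])
                    (use P12(1) disj in auto)
              qed
            qed
          qed
        qed
      qed
    qed
  qed
  with assms show ?thesis by blast
qed

text \<open>An application is the cut of \<open>M\<close> for a fresh \<open>y\<close> into
  \<open>y\<close> applied to \<open>N\<close>.\<close>

lemma App_type_unique:
  assumes "prosodic (App M N)" and "typing T M (\<beta>1 \<rightarrow> \<alpha>)" and "typing T N \<beta>1"
    and "typing T M (\<beta>2 \<rightarrow> \<alpha>)" and "typing T N \<beta>2"
  shows "\<beta>1 = \<beta>2"
proof -
  obtain y where y: "y \<notin> fv M \<union> fv N" using fresh_name[of "fv M \<union> fv N"] by auto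
  have *: "typing (T(y := \<beta> \<rightarrow> \<alpha>)) (App (Var y) N) \<alpha>" if "typing T N \<beta>" for \<beta>
    unfolding typing_App typing_Var using that y by (intro exI[of _ \<beta>] conjI typing_cong[OF that]) auto
  have "(\<beta>1 \<rightarrow> \<alpha>) = (\<beta>2 \<rightarrow> \<alpha>)"
    using assms(1) y
    by (intro cut_type_unique[OF _ _ _ _ *[OF assms(3)] assms(2) *[OF assms(5)] assms(4)])
      (auto simp: prosodic_App intro: prosodic.var)
  then show ?thesis by simp
qed

lemma typing_shape: "typing T M \<alpha> \<Longrightarrow> typing (\<lambda>x. shape (T x)) M (shape \<alpha>)"
  by (rule typing_map_ty)

lemma shape_Fun: "shape \<alpha> = \<beta> \<rightarrow> \<gamma> \<Longrightarrow> \<exists>\<beta>' \<gamma>'. \<alpha> = \<beta>' \<rightarrow> \<gamma>' \<and> shape \<beta>' = \<beta> \<and> shape \<gamma>' = \<gamma>"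
  by (cases \<alpha>) auto

text \<open>
  The type of a redex is determined by the types of the whole term, so that eta-expansion is not
  obstructed by atomic types.
\<close>

lemma red_typing_converse:
  assumes "red M N" and "prosodic M" and "typing T N \<alpha>" and "typing U M (shape \<alpha>)"
    and "\<And>x. x \<in> fv M \<Longrightarrow> U x = shape (T x)"
  shows "typing T M \<alpha>"
  using assms(1) prosodic_lc[OF assms(2)] assms(2-)
proof (induction arbitrary: T U \<alpha> rule: red_induct_lc)
  case (beta M N x)
  then have M: "prosodic M" "x \<in> fv M" and N: "prosodic N" "(fv M - {x}) \<inter> fv N = {}"
    by (auto simp: prosodic_App prosodic_lam)
  obtain y where y: "y \<notin> fv M \<union> fv N" using fresh_name[of "fv M \<union> fv N"] by auto
  let ?M = "msubst (Var(x := Var y)) M"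
  have eq: "lam x M = lam y ?M" "subst x N M = subst y N ?M"
  proof -
    show "lam x M = lam y ?M" using y by (intro lam_alpha) auto
    show "subst x N M = subst y N ?M"
      unfolding subst_msubst msubst_msubst by (rule msubst_cong) (use y in auto)
  qed
  have "prosodic ?M" "y \<in> fv ?M"
    using M y by (auto intro!: prosodic_rename simp: fv_msubst)
  with typing_subst_linear[of ?M N y T \<alpha>] beta.prems(2) y beta(2)
  obtain \<beta> where "typing (T(y := \<beta>)) ?M \<alpha>" "typing T N \<beta>"
    unfolding eq(2) by auto
  then show ?case unfolding eq(1) by (blast intro: typing.intros)
next
  case (eta M x)
  have "lc (App M (Var x))" using eta(1) by simp
  \<comment> \<open>Here \<open>U\<close> is used: it types the eta-redex at the shape of
    \<open>\<alpha>\<close>, which must then be an arrow.\<close>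
  from eta.prems(3)[unfolded typing_lam[OF this]] obtain \<beta> \<gamma> where "shape \<alpha> = \<beta> \<rightarrow> \<gamma>" by blast
  then obtain \<beta>' \<gamma>' where \<alpha>: "\<alpha> = \<beta>' \<rightarrow> \<gamma>'" using shape_Fun by blast
  have "typing (T(x := \<beta>')) M (\<beta>' \<rightarrow> \<gamma>')"
    by (rule typing_cong[OF eta.prems(2)[unfolded \<alpha>]]) (use eta(2) in auto)
  moreover have "typing (T(x := \<beta>')) (Var x) \<beta>'" by (simp add: typing_Var)
  ultimately show ?case unfolding \<alpha> by (blast intro: typing.intros)
next
  case (appL M M' N)
  from appL.prems(2) obtain \<beta> where \<beta>: "typing T M' (\<beta> \<rightarrow> \<alpha>)" "typing T N \<beta>"
    by (auto simp: typing_App)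
  from appL.prems(3) obtain \<gamma> where \<gamma>: "typing U M (\<gamma> \<rightarrow> shape \<alpha>)" "typing U N \<gamma>"
    by (auto simp: typing_App)
  have red: "red (App M N) (App M' N)" using appL.hyps(1) by (rule red.appL)
  note p = red_prosodic[OF red appL.prems(1)]
  \<comment> \<open>Both are argument types of the reduced application, one under \<open>U\<close>
    and one from the shapes of the \<open>T\<close>-typing. Their equality hands the prosodic typing
    required by the induction hypothesis to the subterm.\<close>
  have "\<gamma> = shape \<beta>"
  proof (rule App_type_unique[of M' N U _ "shape \<alpha>"])
    show "prosodic (App M' N)" using p by blast
    show "typing U M' (\<gamma> \<rightarrow> shape \<alpha>)" using red_typing[OF appL.hyps(1) \<gamma>(1)] .
    show "typing U M' (shape \<beta> \<rightarrow> shape \<alpha>)"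
      by (rule typing_cong[OF typing_shape[OF \<beta>(1), simplified]]) (use red_fv[OF appL.hyps(1)] appL.prems(4) in auto)
    show "typing U N (shape \<beta>)"
      by (rule typing_cong[OF typing_shape[OF \<beta>(2)]]) (use red_fv[OF appL.hyps(1)] appL.prems(4) in auto)
  qed (rule \<gamma>(2))
  with \<gamma>(1) have "typing U M (shape (\<beta> \<rightarrow> \<alpha>))" by simp
  moreover have "prosodic M" using appL.prems(1) by (simp add: prosodic_App)
  ultimately have "typing T M (\<beta> \<rightarrow> \<alpha>)"
    using appL.IH[OF _ \<beta>(1)] appL.prems(4) by auto
  with \<beta>(2) show ?case by (blast intro: typing.intros)
next
  case (appR M N N')
  from appR.prems(2) obtain \<beta> where \<beta>: "typing T M (\<beta> \<rightarrow> \<alpha>)" "typing T N' \<beta>"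
    by (auto simp: typing_App)
  from appR.prems(3) obtain \<gamma> where \<gamma>: "typing U M (\<gamma> \<rightarrow> shape \<alpha>)" "typing U N \<gamma>"
    by (auto simp: typing_App)
  have red: "red (App M N) (App M N')" using appR.hyps(1) by (rule red.appR)
  note p = red_prosodic[OF red appR.prems(1)]
  have "\<gamma> = shape \<beta>"
  proof (rule App_type_unique[of M N' U _ "shape \<alpha>"])
    show "prosodic (App M N')" using p by blast
    show "typing U N' \<gamma>" using red_typing[OF appR.hyps(1) \<gamma>(2)] .
    show "typing U M (shape \<beta> \<rightarrow> shape \<alpha>)"
      by (rule typing_cong[OF typing_shape[OF \<beta>(1), simplified]]) (use red_fv[OF appR.hyps(1)] appR.prems(4) in auto)
    show "typing U N' (shape \<beta>)"
      by (rule typing_cong[OF typing_shape[OF \<beta>(2)]]) (use red_fv[OF appR.hyps(1)] appR.prems(4) in auto)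
  qed (rule \<gamma>(1))
  with \<gamma>(2) have "typing U N (shape \<beta>)" by simp
  moreover have "prosodic N" using appR.prems(1) by (simp add: prosodic_App)
  ultimately have "typing T N \<beta>"
    using appR.IH[OF _ \<beta>(2)] appR.prems(4) by auto
  with \<beta>(1) show ?case by (blast intro: typing.intros)
next
  case (abs M M' x)
  from red_prosodic[OF abs.hyps(1)] abs.prems(1) abs.hyps
  have lc': "lc M'" and M: "prosodic M" by (auto simp: prosodic_lam)
  from abs.prems(2) obtain \<beta> \<gamma> where \<beta>: "\<alpha> = \<beta> \<rightarrow> \<gamma>" "typing (T(x := \<beta>)) M' \<gamma>"
    unfolding typing_lam[OF lc'] by blast
  with abs.prems(3) have "typing (U(x := shape \<beta>)) M (shape \<gamma>)"
    unfolding typing_lam[OF abs.hyps(2)] by auto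
  then have "typing (T(x := \<beta>)) M \<gamma>"
    by (rule abs.IH[OF M \<beta>(2)]) (use abs.prems(4) in auto)
  then show ?case unfolding \<beta>(1) by (rule typing.abs)
qed

lemma reds_typing_converse:
  assumes "red\<^sup>*\<^sup>* M N" and "prosodic M" and "typing T N \<alpha>" and "typing U M (shape \<alpha>)"
    and "\<And>x. x \<in> fv M \<Longrightarrow> U x = shape (T x)"
  shows "typing T M \<alpha>"
  using assms
proof (induction rule: converse_rtranclp_induct)
  case (step M M')
  then have "typing T M' \<alpha>"
    using red_prosodic[OF step.hyps(1)] red_typing[OF step.hyps(1)] by auto
  with step show ?case by (blast intro: red_typing_converse)
qed auto


section \<open>Labels and the invariants of hybrid proofs\<close>

section \<open>Labels\<close>

lemma cat_lam: "z \<notin> fv M \<union> fv N \<Longrightarrow> M \<oplus> N = lam z (App M (App N (Var z)))"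
  by (simp add: cat_def lam_def bind_at_fresh)

lemma fv_cat [simp]: "fv (M \<oplus> N) = fv M \<union> fv N"
  by (auto simp: cat_def)

lemma prosodic_cat: "prosodic (M \<oplus> N) \<longleftrightarrow> prosodic M \<and> prosodic N \<and> fv M \<inter> fv N = {}"
proof
  assume "prosodic (M \<oplus> N)"
  then obtain y P where P: "M \<oplus> N = lam y P" "prosodic P"
    by cases (auto simp: cat_def)
  from P(1) have bind: "bind_at 0 y P = App M (App N (Bound 0))"
    by (simp add: cat_def lam_def)
  then obtain M' N' Q where Q: "P = App M' (App N' Q)"
    "bind_at 0 y M' = M" "bind_at 0 y N' = N" "bind_at 0 y Q = Bound 0"
    by (cases P; cases "case P of App _ R \<Rightarrow> R") (auto split: if_splits)
  with P(2) have Q': "prosodic M'" "prosodic N'" "prosodic Q" "fv M' \<inter> fv N' = {}"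
    "fv M' \<inter> fv Q = {}" "fv N' \<inter> fv Q = {}" by (auto simp: prosodic_App)
  from Q(4) Q'(3) have "Q = Var y" by (cases Q) (auto split: if_splits)
  with Q' have "y \<notin> fv M'" "y \<notin> fv N'" by auto
  with Q Q' show "prosodic M \<and> prosodic N \<and> fv M \<inter> fv N = {}"
    by (simp add: bind_at_fresh)
next
  assume *: "prosodic M \<and> prosodic N \<and> fv M \<inter> fv N = {}"
  obtain z where z: "z \<notin> fv M \<union> fv N" using fresh_name[of "fv M \<union> fv N"] by auto
  with * show "prosodic (M \<oplus> N)"
    by (auto simp: cat_lam prosodic_lam prosodic_App prosodic_lc intro: prosodic.var)
qed

lemma typing_cat:
  assumes "lc M" and "lc N"
  shows "typing T (M \<oplus> N) \<tau> \<longleftrightarrow>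
    (\<exists>\<alpha> \<beta> \<gamma>. \<tau> = \<alpha> \<rightarrow> \<gamma> \<and> typing T N (\<alpha> \<rightarrow> \<beta>) \<and> typing T M (\<beta> \<rightarrow> \<gamma>))"
proof -
  obtain z where z: "z \<notin> fv M \<union> fv N" using fresh_name[of "fv M \<union> fv N"] by auto
  have "lc (App M (App N (Var z)))" using assms by simp
  then have "typing T (M \<oplus> N) \<tau> \<longleftrightarrow>
      (\<exists>\<alpha> \<gamma>. \<tau> = \<alpha> \<rightarrow> \<gamma> \<and> typing (T(z := \<alpha>)) (App M (App N (Var z))) \<gamma>)"
    unfolding cat_lam[OF z] by (rule typing_lam)
  also have "\<dots> \<longleftrightarrow> (\<exists>\<alpha> \<gamma>. \<tau> = \<alpha> \<rightarrow> \<gamma> \<and>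
      (\<exists>\<beta>. typing (T(z := \<alpha>)) M (\<beta> \<rightarrow> \<gamma>) \<and> typing (T(z := \<alpha>)) N (\<alpha> \<rightarrow> \<beta>)))"
    unfolding typing_App typing_Var by auto
  also have "\<dots> \<longleftrightarrow> (\<exists>\<alpha> \<gamma>. \<tau> = \<alpha> \<rightarrow> \<gamma> \<and>
      (\<exists>\<beta>. typing T M (\<beta> \<rightarrow> \<gamma>) \<and> typing T N (\<alpha> \<rightarrow> \<beta>)))"
    using z by (simp only: typing_upd_fresh Un_iff de_Morgan_disj simp_thms)
  finally show ?thesis by blast
qed

definition uniq :: "'a multiset \<Rightarrow> bool" where
  "uniq A \<longleftrightarrow> (\<forall>x. count A x \<le> 1)"

lemma uniq_empty [simp]: "uniq {#}"
  by (simp add: uniq_def)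

lemma uniq_union: "uniq (A + B) \<longleftrightarrow> uniq A \<and> uniq B \<and> set_mset A \<inter> set_mset B = {}"
proof -
  have *: "m + n \<le> 1 \<longleftrightarrow> m \<le> 1 \<and> n \<le> 1 \<and> (m = 0 \<or> n = 0)" for m n :: nat
    by arith
  have "uniq (A + B) \<longleftrightarrow>
      (\<forall>x. count A x \<le> 1 \<and> count B x \<le> 1 \<and> (count A x = 0 \<or> count B x = 0))"
    by (simp only: uniq_def count_union *)
  also have "\<dots> \<longleftrightarrow> uniq A \<and> uniq B \<and> (\<forall>x. x \<notin># A \<or> x \<notin># B)"
    by (auto simp only: uniq_def not_in_iff)
  also have "(\<forall>x. x \<notin># A \<or> x \<notin># B) \<longleftrightarrow> set_mset A \<inter> set_mset B = {}" by blast
  finally show ?thesis .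
qed

lemma uniq_add_mset [simp]: "uniq (add_mset x A) \<longleftrightarrow> x \<notin># A \<and> uniq A"
proof -
  have "uniq {#x#}" by (simp add: uniq_def)
  then show ?thesis using uniq_union[of "{#x#}" A] by auto
qed

lemma is_label_typing:
  assumes "is_label sh \<Gamma> M A" and "\<And>h. h \<in># \<Gamma> \<Longrightarrow> U (hname h) = hyp_pros sh h"
  shows "typing U M (pros sh A)"
proof -
  from assms(1) obtain T where T: "\<forall>h\<in>#\<Gamma>. T (hname h) = hyp_pros sh h" "typing T M (pros sh A)"
    and fv: "fv M = hnames \<Gamma>" by (auto simp: is_label_def)
  show ?thesis by (rule typing_cong[OF T(2)]) (use T(1) fv assms(2) in auto)
qed

lemma hname_neq: "x \<notin> hnames \<Gamma> \<Longrightarrow> h \<in># \<Gamma> \<Longrightarrow> hname h \<noteq> x"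
  by blast

lemma is_labelI:
  assumes "prosodic M" and "fv M = hnames \<Gamma>" and "typing T M \<alpha>" and "shape \<alpha> = pros sh A"
    and "\<And>h. h \<in># \<Gamma> \<Longrightarrow> shape (T (hname h)) = hyp_pros sh h"
  shows "is_label sh \<Gamma> M A"
  unfolding is_label_def
  using assms(1,2,4,5) typing_shape[OF assms(3)] by (auto intro!: exI[of _ "\<lambda>x. shape (T x)"])

lemma uniq_hyp_pros:
  assumes "uniq (image_mset hname \<Gamma>)"
  shows "\<exists>U. \<forall>h\<in>#\<Gamma>. U (hname h) = hyp_pros sh h"
  using assms
proof (induction \<Gamma>)
  case (add h \<Gamma>)
  then obtain U where "\<forall>h\<in>#\<Gamma>. U (hname h) = hyp_pros sh h" by auto
  moreover have "hname g \<noteq> hname h" if "g \<in># \<Gamma>" for g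
    using imageI[OF that, of hname] add.prems by auto
  ultimately show ?case
    by (intro exI[of _ "U(hname h := hyp_pros sh h)"]) auto
qed simp

lemma hyb_invariant:
  assumes "hyb sh \<Gamma> M t A"
  shows "uniq (image_mset hname \<Gamma>) \<and> is_label sh \<Gamma> M A"
proof -
  \<comment> \<open>\<open>is_label\<close> asserts only one suitable assignment. The induction
    proves the typing for all of them, so that both premises of an elimination rule can be typed by
    a common one.\<close>
  have "uniq (image_mset hname \<Gamma>) \<and> prosodic M \<and> fv M = hnames \<Gamma> \<and>
    (\<forall>U. (\<forall>h\<in>#\<Gamma>. U (hname h) = hyp_pros sh h) \<longrightarrow> typing U M (pros sh A))"
    using assms
  proof (induction rule: hyb.induct)
    case (ax x A)
    then show ?case by (auto simp: typing_Var intro: prosodic.var)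
  next
    case (lex w W A)
    then show ?case using is_label_typing[OF lex] by (auto simp: is_label_def)
  next
    case (overE \<Gamma> M t A B \<Delta> N u)
    then have "lc M" "lc N" by (auto simp: prosodic_lc)
    have "typing U (M \<oplus> N) string_ty"
      if U: "\<forall>h\<in>#\<Gamma> + \<Delta>. U (hname h) = hyp_pros sh h" for U
    proof -
      have "typing U M string_ty" "typing U N string_ty" using overE.IH U by auto
      then show ?thesis unfolding typing_cat[OF \<open>lc M\<close> \<open>lc N\<close>] by blast
    qed
    with overE \<open>lc M\<close> \<open>lc N\<close> show ?case by (auto simp: uniq_union prosodic_cat)
  next
    case (underE \<Gamma> N u B \<Delta> M t A)
    then have "lc M" "lc N" by (auto simp: prosodic_lc)
    have "typing U (N \<oplus> M) string_ty"
      if U: "\<forall>h\<in>#\<Gamma> + \<Delta>. U (hname h) = hyp_pros sh h" for U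
    proof -
      have "typing U M string_ty" "typing U N string_ty" using underE.IH U by auto
      then show ?thesis unfolding typing_cat[OF \<open>lc N\<close> \<open>lc M\<close>] by blast
    qed
    with underE \<open>lc M\<close> \<open>lc N\<close> show ?case by (auto simp: uniq_union prosodic_cat)
  next
    case (barE \<Gamma> M t A B \<Delta> N u)
    have "typing U (App M N) (pros sh A)"
      if U: "\<forall>h\<in>#\<Gamma> + \<Delta>. U (hname h) = hyp_pros sh h" for U
    proof -
      have "typing U M (pros sh B \<rightarrow> pros sh A)" "typing U N (pros sh B)" using barE.IH U by auto
      then show ?thesis by (rule typing.app)
    qed
    with barE show ?case by (auto simp: uniq_union prosodic_App)
  next
    case (overI x B \<Gamma> M t A)
    then have M: "prosodic M" "x \<notin> hnames \<Gamma>" by (auto simp: prosodic_cat)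
    then have lc: "lc M" "lc (Var x)" by (auto simp: prosodic_lc)
    have "typing U M string_ty" if U: "\<forall>h\<in>#\<Gamma>. U (hname h) = hyp_pros sh h" for U
    proof -
      have "\<forall>h\<in>#add_mset (Hyp x (Lambek B)) \<Gamma>. (U(x := string_ty)) (hname h) = hyp_pros sh h"
        using U hname_neq[OF M(2)] by simp
      with overI.IH have "typing (U(x := string_ty)) (M \<oplus> Var x) (pros sh (Lambek A))" by blast
      then have "typing (U(x := string_ty)) (M \<oplus> Var x) string_ty" by simp
      then have "typing (U(x := string_ty)) M string_ty"
        unfolding typing_cat[OF lc] typing_Var by auto
      then show ?thesis using overI.hyps(2) by (simp only: typing_upd_fresh simp_thms)
    qed
    moreover have "insert x (fv M) = insert x (hnames \<Gamma>)" using overI.IH by simp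
    then have "fv M = hnames \<Gamma>" using insert_ident[OF overI.hyps(2) M(2)] by blast
    ultimately show ?case using overI M lc by (auto intro!: lc_lam)
  next
    case (underI x B \<Gamma> M t A)
    then have M: "prosodic M" "x \<notin> hnames \<Gamma>" by (auto simp: prosodic_cat)
    then have lc: "lc M" "lc (Var x)" by (auto simp: prosodic_lc)
    have "typing U M string_ty" if U: "\<forall>h\<in>#\<Gamma>. U (hname h) = hyp_pros sh h" for U
    proof -
      have "\<forall>h\<in>#add_mset (Hyp x (Lambek B)) \<Gamma>. (U(x := string_ty)) (hname h) = hyp_pros sh h"
        using U hname_neq[OF M(2)] by simp
      with underI.IH have "typing (U(x := string_ty)) (Var x \<oplus> M) (pros sh (Lambek A))" by blast
      then have "typing (U(x := string_ty)) (Var x \<oplus> M) string_ty" by simp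
      then have "typing (U(x := string_ty)) M string_ty"
        unfolding typing_cat[OF lc(2,1)] typing_Var by auto
      then show ?thesis using underI.hyps(2) by (simp only: typing_upd_fresh simp_thms)
    qed
    moreover have "insert x (fv M) = insert x (hnames \<Gamma>)" using underI.IH by simp
    then have "fv M = hnames \<Gamma>" using insert_ident[OF underI.hyps(2) M(2)] by blast
    ultimately show ?case using underI M lc by (auto intro!: lc_lam)
  next
    case (barI x B \<Gamma> M t A)
    then have x: "x \<notin> hnames \<Gamma>" by auto
    have "typing U (lam x M) (pros sh B \<rightarrow> pros sh A)"
      if U: "\<forall>h\<in>#\<Gamma>. U (hname h) = hyp_pros sh h" for U
    proof -
      have "\<forall>h\<in>#add_mset (Hyp x B) \<Gamma>. (U(x := pros sh B)) (hname h) = hyp_pros sh h"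
        using U hname_neq[OF x] by simp
      with barI.IH have "typing (U(x := pros sh B)) M (pros sh A)" by blast
      then show ?thesis by (rule typing.abs)
    qed
    with barI x show ?case by (auto intro!: lc_lam prosodic.abs)
  next
    case (conv \<Gamma> M t A N)
    then show ?case using is_label_typing[OF conv.hyps(3)] by (auto simp: is_label_def)
  qed
  with uniq_hyp_pros[of \<Gamma> sh] show ?thesis by (auto simp: is_label_def)
qed

lemmas hyb_uniq = hyb_invariant[THEN conjunct1]
lemmas hyb_label = hyb_invariant[THEN conjunct2]

lemma red_label: "red M N \<Longrightarrow> is_label sh \<Gamma> M A \<Longrightarrow> is_label sh \<Gamma> N A"
  using red_prosodic red_typing by (fastforce simp: is_label_def)

lemma hyb_reds: "red\<^sup>*\<^sup>* M N \<Longrightarrow> hyb sh \<Gamma> M t A \<Longrightarrow> hyb sh \<Gamma> N t A"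
proof (induction rule: rtranclp_induct)
  case (step N N')
  then show ?case by (blast intro: hyb.conv hyb_label red_label)
qed

text \<open>Every expansion step of \<open>conv\<close> has to reach a label. Reduction preserves
  labels, so checking the largest term \<open>N\<close> suffices.\<close>

lemma hyb_expand: "red\<^sup>*\<^sup>* N M \<Longrightarrow> is_label sh \<Gamma> N A \<Longrightarrow> hyb sh \<Gamma> M t A \<Longrightarrow> hyb sh \<Gamma> N t A"
proof (induction rule: converse_rtranclp_induct)
  case (step N N')
  then show ?case by (blast intro: hyb.conv red_label)
qed


section \<open>The translation, and first-order proofs from hybrid proofs\<close>

section \<open>First-order formulas\<close>

primrec ren_tm :: "(pos \<Rightarrow> pos) \<Rightarrow> tm \<Rightarrow> tm" where
  "ren_tm g (Pt p) = Pt (g p)"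
| "ren_tm g (BVar i) = BVar i"

primrec ren_form :: "(pos \<Rightarrow> pos) \<Rightarrow> 'c form \<Rightarrow> 'c form" where
  "ren_form g (Pred p ts) = Pred p (map (ren_tm g) ts)"
| "ren_form g (\<phi> \<multimap> \<psi>) = ren_form g \<phi> \<multimap> ren_form g \<psi>"
| "ren_form g (\<phi> \<otimes> \<psi>) = ren_form g \<phi> \<otimes> ren_form g \<psi>"
| "ren_form g (Forall \<phi>) = Forall (ren_form g \<phi>)"
| "ren_form g (Exists \<phi>) = Exists (ren_form g \<phi>)"

primrec points :: "'c form \<Rightarrow> pos set" where
  "points (Pred p ts) = {a. Pt a \<in> set ts}"
| "points (\<phi> \<multimap> \<psi>) = points \<phi> \<union> points \<psi>"
| "points (\<phi> \<otimes> \<psi>) = points \<phi> \<union> points \<psi>"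
| "points (Forall \<phi>) = points \<phi>"
| "points (Exists \<phi>) = points \<phi>"

lemma finite_fv_form [simp]: "finite (fv_form \<phi>)"
proof (induction \<phi>)
  case (Pred p ts)
  have "finite (fv_tm t)" for t by (cases t) (auto split: pos.splits)
  then show ?case by simp
qed auto

lemma finite_fv_ctx [simp]: "finite (fv_ctx \<Gamma>)"
  by (auto simp: fv_ctx_def)

lemma points_fv_form: "PVar v \<in> points \<phi> \<Longrightarrow> v \<in> fv_form \<phi>"
  by (induction \<phi>) force+

lemma ren_tm_id [simp]: "ren_tm (\<lambda>p. p) t = t"
  by (cases t) auto

lemma ren_form_id [simp]: "ren_form (\<lambda>p. p) \<phi> = \<phi>"
  by (induction \<phi>) (auto intro: map_idI)

lemma ren_form_cong: "(\<And>p. p \<in> points \<phi> \<Longrightarrow> g p = h p) \<Longrightarrow> ren_form g \<phi> = ren_form h \<phi>"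
proof (induction \<phi>)
  case (Pred p ts)
  have "ren_tm g t = ren_tm h t" if "t \<in> set ts" for t
    using that Pred by (cases t rule: tm.exhaust) auto
  then show ?case by simp
qed auto

lemma inst_form_ren_bind:
  "lc_form_at k \<phi> \<Longrightarrow> inst_form k a (ren_form g (bind_form k v \<phi>)) = ren_form (g(PVar v := a)) \<phi>"
proof (induction \<phi> arbitrary: k)
  case (Pred p ts)
  have "inst_tm k a (ren_tm g (bind_tm k v t)) = ren_tm (g(PVar v := a)) t" if "t \<in> set ts" for t
    using that Pred by (cases t rule: tm.exhaust) auto
  then show ?case by (simp del: fun_upd_apply)
qed auto

lemma lc_bind_form: "lc_form_at k \<phi> \<Longrightarrow> lc_form_at (Suc k) (bind_form k v \<phi>)"
proof (induction \<phi> arbitrary: k)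
  case (Pred p ts)
  have "i < Suc k" if "BVar i = bind_tm k v t" "t \<in> set ts" for i t
    using that Pred by (cases t rule: tm.exhaust) (auto split: if_splits intro: less_SucI)
  then show ?case by auto
qed auto

lemma lc_all: "lc_form_at 0 \<phi> \<Longrightarrow> lc_form_at 0 (all v \<phi>)"
  by (simp add: all_def lc_bind_form)

lemma lc_foldr_all: "lc_form_at 0 \<phi> \<Longrightarrow> lc_form_at 0 (foldr all vs \<phi>)"
  by (induction vs) (auto intro: lc_all)

text \<open>Removing one quantifier leaves a partly instantiated formula; the renaming
  \<open>g\<close> accumulates the instances chosen so far, which turns successive eliminations into
  one simultaneous renaming.\<close>

lemma mill_instantiate:
  "mill \<Gamma> t (ren_form g (foldr all vs \<phi>)) \<Longrightarrow> lc_form_at 0 \<phi> \<Longrightarrow>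
    mill \<Gamma> t (ren_form (\<lambda>p. if p \<in> PVar ` set vs then f p else g p) \<phi>)"
proof (induction vs arbitrary: g)
  case (Cons v vs)
  from Cons.prems(1) have "mill \<Gamma> t (Forall (ren_form g (bind_form 0 v (foldr all vs \<phi>))))"
    by (simp add: all_def[of v])
  from forallE[OF this, of "f (PVar v)"]
  have "mill \<Gamma> t (ren_form (g(PVar v := f (PVar v))) (foldr all vs \<phi>))"
    by (simp add: inst_form_ren_bind lc_foldr_all Cons.prems(2))
  from Cons.IH[OF this Cons.prems(2)] show ?case
    by (rule back_subst[of "\<lambda>g. mill \<Gamma> t (ren_form g \<phi>)"]) auto
qed simp

lemma mill_all_over:
  "mill \<Gamma> t \<phi> \<Longrightarrow> finite V \<Longrightarrow> V \<inter> fv_ctx \<Gamma> = {} \<Longrightarrow> mill \<Gamma> t (all_over V \<phi>)"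
proof -
  assume *: "mill \<Gamma> t \<phi>" and "finite V" and V: "V \<inter> fv_ctx \<Gamma> = {}"
  have "mill \<Gamma> t (foldr all vs \<phi>)" if "set vs \<inter> fv_ctx \<Gamma> = {}" for vs
    using that * by (induction vs) (auto intro: forallI)
  with \<open>finite V\<close> V show ?thesis by (simp add: all_over_def)
qed


section \<open>The translation\<close>

lemma tr_lambek_inst:
  "inst_form k a (tr_lambek A [c, d]) = tr_lambek A [inst_tm k a c, inst_tm k a d]"
proof -
  have "inst_tm (Suc k) a (lift_tm c) = lift_tm (inst_tm k a c)" for k c
    by (cases c) auto
  then show ?thesis by (induction A arbitrary: k c d) auto
qed

lemma tr_lambek_bind:
  "bind_form k v (tr_lambek A [c, d]) = tr_lambek A [bind_tm k v c, bind_tm k v d]"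
proof -
  have "bind_tm (Suc k) v (lift_tm c) = lift_tm (bind_tm k v c)" for k c
    by (cases c) auto
  then show ?thesis by (induction A arbitrary: k c d) auto
qed

lemma tr_lambek_ren:
  "ren_form g (tr_lambek A [c, d]) = tr_lambek A [ren_tm g c, ren_tm g d]"
proof -
  have "ren_tm g (lift_tm c) = lift_tm (ren_tm g c)" for c
    by (cases c) auto
  then show ?thesis by (induction A arbitrary: c d) auto
qed

lemma tr_lambek_points: "points (tr_lambek A [c, d]) \<subseteq> {p. c = Pt p \<or> d = Pt p}"
proof (induction A arbitrary: c d)
  case (Over A B)
  have "lift_tm t = Pt p \<longleftrightarrow> t = Pt p" for t p by (cases t) auto
  with Over[of "lift_tm d" "BVar 0"] Over[of "lift_tm c" "BVar 0"] show ?case by fastforce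
next
  case (Under B A)
  have "lift_tm t = Pt p \<longleftrightarrow> t = Pt p" for t p by (cases t) auto
  with Under[of "BVar 0" "lift_tm c"] Under[of "BVar 0" "lift_tm d"] show ?case by fastforce
qed auto

lemma tr_lambek_lc:
  "(\<And>i. c = BVar i \<Longrightarrow> i < k) \<Longrightarrow> (\<And>i. d = BVar i \<Longrightarrow> i < k) \<Longrightarrow> lc_form_at k (tr_lambek A [c, d])"
proof -
  have lift: "i < Suc k" if "lift_tm t = BVar i" "\<And>i. t = BVar i \<Longrightarrow> i < k" for t i k
    using that by (cases t) auto
  show "(\<And>i. c = BVar i \<Longrightarrow> i < k) \<Longrightarrow> (\<And>i. d = BVar i \<Longrightarrow> i < k) \<Longrightarrow> ?thesis"
  proof (induction A arbitrary: k c d)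
    case (LAtom p)
    then show ?case by auto
  next
    case (Over A B)
    show ?case using Over.prems by (auto intro!: Over.IH dest: lift)
  next
    case (Under B A)
    show ?case using Under.prems by (auto intro!: Under.IH dest: lift)
  qed
qed

lemma shape_string: "shape \<alpha> = string_ty \<Longrightarrow> \<exists>a b. \<alpha> = TAtom a \<rightarrow> TAtom b"
proof -
  assume "shape \<alpha> = string_ty"
  then obtain \<beta> \<gamma> where "\<alpha> = \<beta> \<rightarrow> \<gamma>" "shape \<beta> = TAtom ()" "shape \<gamma> = TAtom ()"
    using shape_Fun by blast
  then show ?thesis by (cases \<beta>; cases \<gamma>) auto
qed

lemma flat_map_ty: "flat (map_ty f \<alpha>) = map f (flat \<alpha>)"
  by (induction \<alpha>) auto

lemma set_flat: "set (flat \<alpha>) = set_ty \<alpha>"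
  by (induction \<alpha>) auto

lemma tr_ren: "shape \<alpha> = pros sh A \<Longrightarrow> tr A (map_ty g \<alpha>) = ren_form g (tr A \<alpha>)"
proof (induction A arbitrary: \<alpha>)
  case (Lambek A)
  then obtain a b where "\<alpha> = TAtom a \<rightarrow> TAtom b" using shape_string[of \<alpha>] by auto
  then show ?case by (simp add: tr_lambek_ren)
next
  case (HAtom q)
  then show ?case by (simp add: flat_map_ty)
next
  case (Bar A B)
  then obtain \<beta> \<gamma> where "\<alpha> = \<beta> \<rightarrow> \<gamma>" "shape \<beta> = pros sh B" "shape \<gamma> = pros sh A"
    using shape_Fun[of \<alpha>] by auto
  with Bar show ?case by simp
qed

lemma tr_points: "shape \<alpha> = pros sh A \<Longrightarrow> points (tr A \<alpha>) \<subseteq> set_ty \<alpha>"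
proof (induction A arbitrary: \<alpha>)
  case (Lambek A)
  then obtain a b where "\<alpha> = TAtom a \<rightarrow> TAtom b" using shape_string[of \<alpha>] by auto
  then show ?case using tr_lambek_points[of A "Pt b" "Pt a"] by auto
next
  case (HAtom q)
  then show ?case by (auto simp: set_flat)
next
  case (Bar A B)
  then obtain \<beta> \<gamma> where "\<alpha> = \<beta> \<rightarrow> \<gamma>" "shape \<beta> = pros sh B" "shape \<gamma> = pros sh A"
    using shape_Fun[of \<alpha>] by auto
  with Bar show ?case by fastforce
qed

lemma tr_lc: "shape \<alpha> = pros sh A \<Longrightarrow> lc_form_at 0 (tr A \<alpha>)"
proof (induction A arbitrary: \<alpha>)
  case (Lambek A)
  then obtain a b where "\<alpha> = TAtom a \<rightarrow> TAtom b" using shape_string[of \<alpha>] by auto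
  then show ?case by (auto intro: tr_lambek_lc)
next
  case (HAtom q)
  then show ?case by auto
next
  case (Bar A B)
  then obtain \<beta> \<gamma> where "\<alpha> = \<beta> \<rightarrow> \<gamma>" "shape \<beta> = pros sh B" "shape \<gamma> = pros sh A"
    using shape_Fun[of \<alpha>] by auto
  with Bar show ?case by simp
qed

lemma fst_tr_hyp [simp]: "fst (tr_hyp T L h) = hname h"
  by (cases h) auto

lemma cnames_tr_left: "cnames (tr_left T L \<Gamma>) = hnames \<Gamma>"
  by (simp add: tr_left_def image_image)

lemma tr_left_cong:
  assumes "\<And>x. x \<in> hnames \<Gamma> \<Longrightarrow> T x = T' x"
  shows "tr_left T L \<Gamma> = tr_left T' L \<Gamma>"
proof -
  have "tr_hyp T L h = tr_hyp T' L h" if "h \<in># \<Gamma>" for h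
    using assms[OF imageI[OF that]] by (cases h) auto
  then show ?thesis by (simp add: tr_left_def cong: image_mset_cong)
qed


section \<open>From hybrid proofs to first-order proofs\<close>

definition lexical ::
  "('b \<Rightarrow> unit ty) \<Rightarrow> (name \<Rightarrow> pos ty) \<Rightarrow> (name \<Rightarrow> pos ty) \<Rightarrow> name \<Rightarrow> trm \<Rightarrow> ('a, 'b) hybrid \<Rightarrow> bool"
  where
  "lexical sh T L w W A \<longleftrightarrow> is_label sh {#Lex w W A#} W A \<and> shape (L w) = pros sh A \<and>
     principal T W (L w) \<and> (\<forall>k. Pos k \<in> set_ty (L w) \<longrightarrow> Pos k \<in> set_ty (T w))"

lemma principal_cong:
  assumes "\<And>x. x \<in> fv M \<Longrightarrow> T x = T' x"
  shows "principal T M \<alpha> \<longleftrightarrow> principal T' M \<alpha>"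
proof -
  have "typing T M \<alpha> \<longleftrightarrow> typing T' M \<alpha>"
    using assms by (metis typing_cong)
  then show ?thesis using assms by (simp add: principal_def)
qed

lemma lexical_cong: "T w = T' w \<Longrightarrow> lexical sh T L w W A \<longleftrightarrow> lexical sh T' L w W A"
proof -
  assume *: "T w = T' w"
  have "principal T W (L w) \<longleftrightarrow> principal T' W (L w)" if "is_label sh {#Lex w W A#} W A"
    by (rule principal_cong) (use that * in \<open>auto simp: is_label_def\<close>)
  with * show ?thesis unfolding lexical_def by auto
qed

lemma map_ty_fixed: "map_ty h \<alpha> = \<alpha> \<Longrightarrow> p \<in> set_ty \<alpha> \<Longrightarrow> h p = p"
  by (induction \<alpha>) auto

text \<open>By principality, \<open>\<beta>\<close> arises from \<open>L w\<close> by a map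
  \<open>h\<close> that fixes the atoms of \<open>T w\<close>. All positions of \<open>L w\<close>
  are among these, so \<open>h\<close> changes type variables only, and these are what the closure
  quantifies.\<close>

lemma lexical_mill:
  assumes "lexical sh T L w W A" and "typing T W \<beta>" and "shape \<beta> = pros sh A"
  shows "mill {#tr_hyp T L (Lex w W A)#} (Var w) (tr A \<beta>)"
proof -
  from assms(1) have fv: "fv W = {w}" and L: "shape (L w) = pros sh A" "principal T W (L w)"
    and pos: "\<And>k. Pos k \<in> set_ty (L w) \<Longrightarrow> Pos k \<in> set_ty (T w)"
    by (auto simp: lexical_def is_label_def)
  from L(2) assms(2,3) L(1) obtain h where h: "\<beta> = map_ty h (L w)" "T w = map_ty h (T w)"
    unfolding principal_def fv by force
  let ?\<phi> = "tr A (L w)"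
  let ?vs = "sorted_list_of_set (fv_form ?\<phi>)"
  have lc: "lc_form_at 0 ?\<phi>" using L(1) by (rule tr_lc)
  have "mill {#(w, foldr all ?vs ?\<phi>)#} (Var w) (ren_form (\<lambda>p. p) (foldr all ?vs ?\<phi>))"
    using lc by (auto intro: mill.ax lc_foldr_all)
  from mill_instantiate[OF this lc, of h]
  have "mill {#(w, foldr all ?vs ?\<phi>)#} (Var w)
      (ren_form (\<lambda>p. if p \<in> PVar ` fv_form ?\<phi> then h p else p) ?\<phi>)"
    by simp
  also have "ren_form (\<lambda>p. if p \<in> PVar ` fv_form ?\<phi> then h p else p) ?\<phi> = ren_form h ?\<phi>"
  proof (rule ren_form_cong)
    fix p assume p: "p \<in> points ?\<phi>"
    show "(if p \<in> PVar ` fv_form ?\<phi> then h p else p) = h p"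
    proof (cases p)
      case (Pos k)
      then have "p \<in> set_ty (T w)" using p tr_points[OF L(1)] pos by blast
      with map_ty_fixed[OF h(2)[symmetric]] show ?thesis by simp
    next
      case (PVar v)
      with p show ?thesis by (auto dest: points_fv_form)
    qed
  qed
  also have "\<dots> = tr A \<beta>" using h(1) tr_ren[OF L(1)] by simp
  finally show ?thesis by (simp add: all_over_def)
qed

text \<open>The induction invariant on contexts. Principality of the whole sequent is not inherited
  by subproofs, but the shapes of the hypotheses and the principality of the lexical terms
  are.\<close>

definition decorated ::
  "('b \<Rightarrow> unit ty) \<Rightarrow> (name \<Rightarrow> pos ty) \<Rightarrow> (name \<Rightarrow> pos ty) \<Rightarrow> ('a, 'b) hyp multiset \<Rightarrow> bool" where
  "decorated sh T L \<Gamma> \<longleftrightarrow> (\<forall>h\<in>#\<Gamma>. shape (T (hname h)) = hyp_pros sh h) \<and>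
     (\<forall>w W A. Lex w W A \<in># \<Gamma> \<longrightarrow> lexical sh T L w W A)"

lemma decorated_union: "decorated sh T L (\<Gamma> + \<Delta>) \<longleftrightarrow> decorated sh T L \<Gamma> \<and> decorated sh T L \<Delta>"
  by (auto simp: decorated_def)

lemma decorated_Hyp:
  assumes "decorated sh T L \<Gamma>" and "x \<notin> hnames \<Gamma>" and "shape \<tau> = pros sh B"
  shows "decorated sh (T(x := \<tau>)) L (add_mset (Hyp x B) \<Gamma>)"
proof -
  have neq: "hname h \<noteq> x" if "h \<in># \<Gamma>" for h using hname_neq[OF assms(2) that] .
  have "lexical sh (T(x := \<tau>)) L w W A" if "Lex w W A \<in># \<Gamma>" for w W A
  proof -
    have "lexical sh T L w W A" using that assms(1) by (simp add: decorated_def)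
    then show ?thesis by (subst lexical_cong[where T' = T]) (use neq[OF that] in auto)
  qed
  then show ?thesis using assms(1,3) neq by (auto simp: decorated_def)
qed

lemma label_type:
  assumes "is_label sh \<Gamma> M A" and "decorated sh T L \<Gamma>"
  shows "typing (\<lambda>x. shape (T x)) M (pros sh A)"
  by (rule is_label_typing[OF assms(1)]) (use assms(2) in \<open>auto simp: decorated_def\<close>)

lemma cat_type_unique:
  assumes "prosodic (M \<oplus> N)" and "typing T M (\<beta>1 \<rightarrow> \<gamma>)" and "typing T N (\<alpha> \<rightarrow> \<beta>1)"
    and "typing T M (\<beta>2 \<rightarrow> \<gamma>)" and "typing T N (\<alpha> \<rightarrow> \<beta>2)"
  shows "\<beta>1 = \<beta>2"
proof -
  obtain z where z: "z \<notin> fv M \<union> fv N" using fresh_name[of "fv M \<union> fv N"] by auto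
  have z': "typing (T(z := \<alpha>)) (Var z) \<alpha>" by (simp add: typing_Var)
  have M: "typing (T(z := \<alpha>)) M \<tau>" if "typing T M \<tau>" for \<tau>
    by (rule typing_cong[OF that]) (use z in auto)
  have N: "typing (T(z := \<alpha>)) N \<tau>" if "typing T N \<tau>" for \<tau>
    by (rule typing_cong[OF that]) (use z in auto)
  have "prosodic (App M (App N (Var z)))"
    using assms(1) z by (auto simp: prosodic_cat prosodic_App intro: prosodic.var)
  then show ?thesis
    using M[OF assms(2)] typing.app[OF N[OF assms(3)] z'] M[OF assms(4)]
      typing.app[OF N[OF assms(5)] z']
    by (rule App_type_unique)
qed

text \<open>The type between the two strings could a priori be compound. Its shape types the same
  concatenation as the prosodic string types do, so by uniqueness it is an atom, that is, a string
  position.\<close>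

lemma cat_types:
  assumes "typing T (M \<oplus> N) \<alpha>" and "prosodic (M \<oplus> N)" and "shape \<alpha> = string_ty"
    and "typing (\<lambda>x. shape (T x)) M string_ty" and "typing (\<lambda>x. shape (T x)) N string_ty"
  obtains a b c where "\<alpha> = TAtom a \<rightarrow> TAtom c" and "typing T N (TAtom a \<rightarrow> TAtom b)"
    and "typing T M (TAtom b \<rightarrow> TAtom c)"
proof -
  from assms(2) have "lc M" "lc N" by (auto simp: prosodic_cat prosodic_lc)
  from assms(3) obtain a c where \<alpha>: "\<alpha> = TAtom a \<rightarrow> TAtom c" using shape_string by blast
  from assms(1) \<alpha> obtain \<beta> where
    \<beta>: "typing T N (TAtom a \<rightarrow> \<beta>)" "typing T M (\<beta> \<rightarrow> TAtom c)"
    unfolding typing_cat[OF \<open>lc M\<close> \<open>lc N\<close>] by blast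
  have "shape \<beta> = TAtom ()"
    using typing_shape[OF \<beta>(1)] typing_shape[OF \<beta>(2)]
    by (intro cat_type_unique[OF assms(2) _ _ assms(4,5)]) auto
  then obtain b where "\<beta> = TAtom b" by (cases \<beta>) auto
  with \<alpha> \<beta> show thesis by (intro that) auto
qed

lemma finite_fv_tm [simp]: "finite (fv_tm t)"
  by (cases t) (auto split: pos.splits)

lemma hyb_mill:
  assumes "hyb sh \<Gamma> M t A" and "decorated sh T L \<Gamma>" and "typing T M \<beta>" and "shape \<beta> = pros sh A"
  shows "mill (tr_left T L \<Gamma>) t (tr A \<beta>)"
  using assms
proof (induction arbitrary: T \<beta> rule: hyb.induct)
  case (ax x A)
  then show ?case by (auto simp: tr_left_def typing_Var intro!: mill.ax tr_lc)
next
  case (lex w W A)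
  have "lexical sh T L w W A" using lex.prems(1) by (simp add: decorated_def)
  from lexical_mill[OF this lex.prems(2,3)] show ?case by (simp add: tr_left_def)
next
  case (overE \<Gamma> M t A B \<Delta> N u)
  from overE.prems(1) have dec: "decorated sh T L \<Gamma>" "decorated sh T L \<Delta>"
    by (simp_all add: decorated_union)
  have "prosodic (M \<oplus> N)"
    using hyb_label[OF hyb.overE[OF overE.hyps]] by (simp add: is_label_def)
  then obtain a b c where abc: "\<beta> = TAtom a \<rightarrow> TAtom c" "typing T N (TAtom a \<rightarrow> TAtom b)"
    "typing T M (TAtom b \<rightarrow> TAtom c)"
    using overE.prems label_type[OF hyb_label[OF overE.hyps(1)] dec(1)]
      label_type[OF hyb_label[OF overE.hyps(2)] dec(2)]
    by (auto elim: cat_types)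
  have "mill (tr_left T L \<Gamma>) t (tr (Lambek (Over A B)) (TAtom b \<rightarrow> TAtom c))"
    using dec(1) abc(3) by (intro overE.IH) auto
  \<comment> \<open>The quantifier is instantiated with \<open>a\<close>, the outer end of the
    argument string, which the typing of the concatenation provides.\<close>
  then have "mill (tr_left T L \<Gamma>) t (tr_lambek B [Pt b, Pt a] \<multimap> tr_lambek A [Pt c, Pt a])"
    using forallE[of "tr_left T L \<Gamma>" t _ a] by (fastforce simp: tr_lambek_inst)
  moreover have "mill (tr_left T L \<Delta>) u (tr (Lambek B) (TAtom a \<rightarrow> TAtom b))"
    using dec(2) abc(2) by (intro overE.IH) auto
  ultimately have "mill (tr_left T L \<Gamma> + tr_left T L \<Delta>) (App t u) (tr_lambek A [Pt c, Pt a])"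
    using overE.hyps(3) by (intro mill.lolliE) (auto simp: cnames_tr_left)
  then show ?case by (simp add: tr_left_def abc(1))
next
  case (underE \<Gamma> N u B \<Delta> M t A)
  from underE.prems(1) have dec: "decorated sh T L \<Gamma>" "decorated sh T L \<Delta>"
    by (simp_all add: decorated_union)
  have "prosodic (N \<oplus> M)"
    using hyb_label[OF hyb.underE[OF underE.hyps]] by (simp add: is_label_def)
  then obtain a b c where abc: "\<beta> = TAtom a \<rightarrow> TAtom c" "typing T M (TAtom a \<rightarrow> TAtom b)"
    "typing T N (TAtom b \<rightarrow> TAtom c)"
    using underE.prems label_type[OF hyb_label[OF underE.hyps(1)] dec(1)]
      label_type[OF hyb_label[OF underE.hyps(2)] dec(2)]
    by (auto elim: cat_types)
  have "mill (tr_left T L \<Delta>) t (tr (Lambek (Under B A)) (TAtom a \<rightarrow> TAtom b))"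
    using dec(2) abc(2) by (intro underE.IH) auto
  then have "mill (tr_left T L \<Delta>) t (tr_lambek B [Pt c, Pt b] \<multimap> tr_lambek A [Pt c, Pt a])"
    using forallE[of "tr_left T L \<Delta>" t _ c] by (fastforce simp: tr_lambek_inst)
  moreover have "mill (tr_left T L \<Gamma>) u (tr (Lambek B) (TAtom b \<rightarrow> TAtom c))"
    using dec(1) abc(3) by (intro underE.IH) auto
  ultimately have "mill (tr_left T L \<Delta> + tr_left T L \<Gamma>) (App t u) (tr_lambek A [Pt c, Pt a])"
    using underE.hyps(3) by (intro mill.lolliE) (auto simp: cnames_tr_left)
  then show ?case by (simp add: tr_left_def abc(1) add.commute)
next
  case (barE \<Gamma> M t A B \<Delta> N u)
  from barE.prems(1) have dec: "decorated sh T L \<Gamma>" "decorated sh T L \<Delta>"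
    by (simp_all add: decorated_union)
  have pros: "prosodic (App M N)"
    using hyb_label[OF hyb.barE[OF barE.hyps]] by (simp add: is_label_def)
  from barE.prems(2) obtain \<gamma> where \<gamma>: "typing T M (\<gamma> \<rightarrow> \<beta>)" "typing T N \<gamma>"
    by (auto simp: typing_App)
  have "shape \<gamma> = pros sh B"
    using typing_shape[OF \<gamma>(1)] typing_shape[OF \<gamma>(2)] barE.prems(3)
      label_type[OF hyb_label[OF barE.hyps(1)] dec(1)] label_type[OF hyb_label[OF barE.hyps(2)] dec(2)]
    by (intro App_type_unique[OF pros]) auto
  then have "mill (tr_left T L \<Gamma>) t (tr (Bar A B) (\<gamma> \<rightarrow> \<beta>))" "mill (tr_left T L \<Delta>) u (tr B \<gamma>)"
    using dec \<gamma> barE.prems(3) by (auto intro!: barE.IH simp del: tr.simps)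
  then have "mill (tr_left T L \<Gamma> + tr_left T L \<Delta>) (App t u) (tr A \<beta>)"
    using barE.hyps(3) by (intro mill.lolliE) (auto simp: cnames_tr_left)
  then show ?case by (simp add: tr_left_def)
next
  case (overI x B \<Gamma> M t A)
  have x: "x \<notin> hnames \<Gamma>" using hyb_uniq[OF overI.hyps(1)] by simp
  from overI.prems(3) obtain d c where \<beta>: "\<beta> = TAtom d \<rightarrow> TAtom c"
    using shape_string[of \<beta>] by auto
  obtain v where v: "v \<notin> fv_ctx (tr_left T L \<Gamma>) \<union> fv_tm (Pt c) \<union> fv_tm (Pt d)"
    using ex_new_if_finite[OF infinite_UNIV_nat] finite_fv_ctx finite_fv_tm by (metis finite_UnI)
  then have v': "c \<noteq> PVar v" "d \<noteq> PVar v" by auto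
  \<comment> \<open>As \<open>flat\<close> puts the result first, this type of \<open>x\<close> has
    superscript \<open>[d, v]\<close>: the hypothesis continues the string of \<open>M\<close> at
    \<open>d\<close> up to a new end \<open>v\<close>, the eigenvariable of the quantifier.\<close>
  let ?T = "T(x := TAtom (PVar v) \<rightarrow> TAtom d)"
  have "prosodic M" using hyb_label[OF overI.hyps(1)] by (simp add: is_label_def prosodic_cat)
  then have lc: "lc M" "lc (Var x)" by (simp_all add: prosodic_lc)
  have "typing ?T M (TAtom d \<rightarrow> TAtom c)"
    by (rule typing_cong[OF overI.prems(2)[unfolded \<beta>]]) (use overI.hyps(2) in auto)
  moreover have "typing ?T (Var x) (TAtom (PVar v) \<rightarrow> TAtom d)" by (simp add: typing_Var)
  ultimately have ty: "typing ?T (M \<oplus> Var x) (TAtom (PVar v) \<rightarrow> TAtom c)"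
    unfolding typing_cat[OF lc] by blast
  have dec: "decorated sh ?T L (add_mset (Hyp x (Lambek B)) \<Gamma>)"
    using overI.prems(1) x by (rule decorated_Hyp) simp
  have "mill (tr_left ?T L (add_mset (Hyp x (Lambek B)) \<Gamma>)) t
      (tr (Lambek A) (TAtom (PVar v) \<rightarrow> TAtom c))"
    by (rule overI.IH[OF dec ty]) simp
  moreover have "tr_left ?T L \<Gamma> = tr_left T L \<Gamma>"
    by (rule tr_left_cong) (use x in auto)
  ultimately have "mill (add_mset (x, tr_lambek B [Pt d, Pt (PVar v)]) (tr_left T L \<Gamma>)) t
      (tr_lambek A [Pt c, Pt (PVar v)])"
    by (simp add: tr_left_def)
  from forallI[OF lolliI[OF this]] v
  have "mill (tr_left T L \<Gamma>) (lam x t)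
      (all v (tr_lambek B [Pt d, Pt (PVar v)] \<multimap> tr_lambek A [Pt c, Pt (PVar v)]))"
    by blast
  then show ?case using v' by (simp add: all_def tr_lambek_bind \<beta>)
next
  case (underI x B \<Gamma> M t A)
  have x: "x \<notin> hnames \<Gamma>" using hyb_uniq[OF underI.hyps(1)] by simp
  from underI.prems(3) obtain d c where \<beta>: "\<beta> = TAtom d \<rightarrow> TAtom c"
    using shape_string[of \<beta>] by auto
  obtain v where v: "v \<notin> fv_ctx (tr_left T L \<Gamma>) \<union> fv_tm (Pt c) \<union> fv_tm (Pt d)"
    using ex_new_if_finite[OF infinite_UNIV_nat] finite_fv_ctx finite_fv_tm by (metis finite_UnI)
  then have v': "c \<noteq> PVar v" "d \<noteq> PVar v" by auto
  let ?T = "T(x := TAtom c \<rightarrow> TAtom (PVar v))"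
  have "prosodic M" using hyb_label[OF underI.hyps(1)] by (simp add: is_label_def prosodic_cat)
  then have lc: "lc (Var x)" "lc M" by (simp_all add: prosodic_lc)
  have "typing ?T M (TAtom d \<rightarrow> TAtom c)"
    by (rule typing_cong[OF underI.prems(2)[unfolded \<beta>]]) (use underI.hyps(2) in auto)
  moreover have "typing ?T (Var x) (TAtom c \<rightarrow> TAtom (PVar v))" by (simp add: typing_Var)
  ultimately have ty: "typing ?T (Var x \<oplus> M) (TAtom d \<rightarrow> TAtom (PVar v))"
    unfolding typing_cat[OF lc] by blast
  have dec: "decorated sh ?T L (add_mset (Hyp x (Lambek B)) \<Gamma>)"
    using underI.prems(1) x by (rule decorated_Hyp) simp
  have "mill (tr_left ?T L (add_mset (Hyp x (Lambek B)) \<Gamma>)) t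
      (tr (Lambek A) (TAtom d \<rightarrow> TAtom (PVar v)))"
    by (rule underI.IH[OF dec ty]) simp
  moreover have "tr_left ?T L \<Gamma> = tr_left T L \<Gamma>"
    by (rule tr_left_cong) (use x in auto)
  ultimately have "mill (add_mset (x, tr_lambek B [Pt (PVar v), Pt c]) (tr_left T L \<Gamma>)) t
      (tr_lambek A [Pt (PVar v), Pt d])"
    by (simp add: tr_left_def)
  from forallI[OF lolliI[OF this]] v
  have "mill (tr_left T L \<Gamma>) (lam x t)
      (all v (tr_lambek B [Pt (PVar v), Pt c] \<multimap> tr_lambek A [Pt (PVar v), Pt d]))"
    by blast
  then show ?case using v' by (simp add: all_def tr_lambek_bind \<beta>)
next
  case (barI x B \<Gamma> M t A)
  have x: "x \<notin> hnames \<Gamma>" using hyb_uniq[OF barI.hyps] by simp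
  from barI.prems(3) obtain \<gamma> \<delta> where
    \<beta>: "\<beta> = \<gamma> \<rightarrow> \<delta>" "shape \<gamma> = pros sh B" "shape \<delta> = pros sh A"
    using shape_Fun[of \<beta>] by auto
  have "lc M" using hyb_label[OF barI.hyps] by (simp add: is_label_def prosodic_lc)
  from barI.prems(2) have ty: "typing (T(x := \<gamma>)) M \<delta>"
    unfolding \<beta>(1) typing_lam[OF \<open>lc M\<close>] by blast
  have dec: "decorated sh (T(x := \<gamma>)) L (add_mset (Hyp x B) \<Gamma>)"
    using barI.prems(1) x \<beta>(2) by (rule decorated_Hyp)
  have "mill (tr_left (T(x := \<gamma>)) L (add_mset (Hyp x B) \<Gamma>)) t (tr A \<delta>)"
    by (rule barI.IH[OF dec ty \<beta>(3)])
  moreover have "tr_left (T(x := \<gamma>)) L \<Gamma> = tr_left T L \<Gamma>"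
    by (rule tr_left_cong) (use x in auto)
  ultimately have "mill (add_mset (x, tr B \<gamma>) (tr_left T L \<Gamma>)) t (tr A \<delta>)"
    by (simp add: tr_left_def)
  then show ?case by (simp add: \<beta>(1) mill.lolliI)
next
  case (conv \<Gamma> M t A N)
  note M = hyb_label[OF conv.hyps(1)]
  have "typing T M \<beta>"
    using conv.hyps(2)
  proof
    \<comment> \<open>The typing has to be pulled back along a reduction; the shapes of the
      hypotheses give the prosodic typing that subject expansion requires.\<close>
    assume "red M N"
    then show ?thesis
      using M label_type[OF M conv.prems(1)] conv.prems(2,3)
      by (intro red_typing_converse[of M N T \<beta>]) (auto simp: is_label_def)
  next
    assume "red N M"
    then show ?thesis using conv.prems(2) by (rule red_typing)
  qed
  with conv.prems show ?case by (intro conv.IH)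
qed


section \<open>Counting atoms, and the labels of slash introductions\<close>

section \<open>Balance\<close>

text \<open>The van Benthem count: occurrences of an atom with sign, where passing to the left of an
  arrow changes the sign.\<close>

primrec bal :: "'a \<Rightarrow> 'a ty \<Rightarrow> int" where
  "bal a (TAtom b) = (if a = b then 1 else 0)"
| "bal a (\<beta> \<rightarrow> \<alpha>) = bal a \<alpha> - bal a \<beta>"

lemma bal_fresh: "a \<notin> set_ty \<alpha> \<Longrightarrow> bal a \<alpha> = 0"
  by (induction \<alpha>) auto

lemma typing_balance: "prosodic M \<Longrightarrow> typing T M \<alpha> \<Longrightarrow> (\<Sum>x\<in>fv M. bal a (T x)) = bal a \<alpha>"
proof (induction arbitrary: T \<alpha> rule: prosodic.induct)
  case (var x)
  then show ?case by (simp add: typing_Var)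
next
  case (app M N)
  then show ?case by (fastforce simp: typing_App sum.union_disjoint)
next
  case (abs M x)
  from abs.prems obtain \<beta> \<gamma> where \<alpha>: "\<alpha> = \<beta> \<rightarrow> \<gamma>" "typing (T(x := \<beta>)) M \<gamma>"
    unfolding typing_lam[OF prosodic_lc[OF abs.hyps(1)]] by blast
  have "bal a \<gamma> = (\<Sum>y\<in>fv M. bal a ((T(x := \<beta>)) y))"
    using abs.IH[OF \<alpha>(2)] by simp
  also have "\<dots> = bal a \<beta> + (\<Sum>y\<in>fv M - {x}. bal a ((T(x := \<beta>)) y))"
    using abs.hyps(2) by (simp add: sum.remove[of _ x])
  also have "(\<Sum>y\<in>fv M - {x}. bal a ((T(x := \<beta>)) y)) = (\<Sum>y\<in>fv M - {x}. bal a (T y))"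
    by (rule sum.cong) auto
  finally show ?case using \<alpha>(1) by simp
qed

text \<open>Here \<open>z\<close> contributes one and the other variables nothing, so the count of
  \<open>a\<close> in the result type cannot be zero.\<close>

lemma balance_one:
  assumes "prosodic M" and "typing T M \<alpha>" and "z \<in> fv M" and "T z = TAtom a"
    and "\<And>y. y \<in> fv M \<Longrightarrow> y \<noteq> z \<Longrightarrow> a \<notin> set_ty (T y)"
  shows "a \<in> set_ty \<alpha>"
proof (rule ccontr)
  assume "a \<notin> set_ty \<alpha>"
  then have "(\<Sum>y\<in>fv M. bal a (T y)) = 0"
    using typing_balance[OF assms(1,2), of a] bal_fresh by fastforce
  moreover have "(\<Sum>y\<in>fv M. bal a (T y)) = 1 + (\<Sum>y\<in>fv M - {z}. bal a (T y))"
    using assms(3,4) by (simp add: sum.remove[of _ z])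
  moreover have "(\<Sum>y\<in>fv M - {z}. bal a (T y)) = 0"
    using assms(5) by (intro sum.neutral) (auto intro: bal_fresh)
  ultimately show False by simp
qed


section \<open>Labels of slash introductions\<close>

lemma ne_atoms: "ne M \<Longrightarrow> typing T M \<alpha> \<Longrightarrow> set_ty \<alpha> \<subseteq> set_ty (T (head M))"
proof (induction M arbitrary: \<alpha>)
  case (App M N)
  then show ?case by (fastforce simp: typing_App elim!: ne_AppE)
qed (auto simp: typing_Var elim: ne.cases)

lemma ne_atomic_head: "ne M \<Longrightarrow> typing T M \<alpha> \<Longrightarrow> T (head M) = TAtom a \<Longrightarrow> M = Var (head M) \<and> \<alpha> = TAtom a"
proof (induction M arbitrary: \<alpha>)
  case (App M N)
  then show ?case by (fastforce simp: typing_App elim!: ne_AppE)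
qed (auto simp: typing_Var elim: ne.cases)

lemma ne_string_head:
  "ne M \<Longrightarrow> typing T M \<alpha> \<Longrightarrow> T (head M) = TAtom c \<rightarrow> TAtom d \<Longrightarrow>
    M = Var (head M) \<and> \<alpha> = TAtom c \<rightarrow> TAtom d \<or>
    (\<exists>N. M = App (Var (head M)) N \<and> nf N \<and> typing T N (TAtom c) \<and> \<alpha> = TAtom d)"
proof (induction M arbitrary: \<alpha>)
  case (App M N)
  from App.prems(1) have "ne M" "nf N" by (auto elim: ne_AppE)
  from App.prems(2) obtain \<beta> where \<beta>: "typing T M (\<beta> \<rightarrow> \<alpha>)" "typing T N \<beta>"
    by (auto simp: typing_App)
  from App.IH(1)[OF \<open>ne M\<close> \<beta>(1)] App.prems(3) have "M = Var (head M)" "\<beta> = TAtom c" "\<alpha> = TAtom d"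
    by auto
  with \<beta>(2) \<open>nf N\<close> show ?case by (metis head.simps(2))
qed (auto simp: typing_Var elim: ne.cases)

lemma nf_atom_ne: "nf M \<Longrightarrow> typing T M (TAtom a) \<Longrightarrow> ne M"
  by (cases rule: nf.cases) (auto simp: typing_lam nf_lc)

text \<open>The head has to supply the atom \<open>a\<close>, so it is \<open>z\<close>, and a head
  of atomic type takes no arguments.\<close>

lemma nf_atom_var:
  assumes "nf M" and "typing T M (TAtom a)" and "T z = TAtom a"
    and "\<And>y. y \<in> fv M \<Longrightarrow> y \<noteq> z \<Longrightarrow> a \<notin> set_ty (T y)"
  shows "M = Var z"
proof -
  have ne: "ne M" using assms(1,2) by (rule nf_atom_ne)
  have "head M = z"
    using ne_atoms[OF ne assms(2)] ne_head[OF ne] assms(4) by auto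
  with ne_atomic_head[OF ne assms(2)] assms(3) show ?thesis by auto
qed

text \<open>\<open>N1\<close> is \<open>N\<close> with the application of \<open>x\<close> to
  \<open>z\<close> replaced by a variable \<open>y\<close> of type \<open>d\<close>. Abstracting
  \<open>y\<close> gives the functor label of a right slash.\<close>

definition factor :: "name \<Rightarrow> name \<Rightarrow> 'a \<Rightarrow> (name \<Rightarrow> 'a ty) \<Rightarrow> 'a ty \<Rightarrow> name \<Rightarrow> trm \<Rightarrow> trm \<Rightarrow> bool" where
  "factor x z d T \<alpha> y N N1 \<longleftrightarrow> N = subst y (App (Var x) (Var z)) N1 \<and> prosodic N1 \<and> y \<in> fv N1 \<and>
     x \<notin> fv N1 \<and> z \<notin> fv N1 \<and> fv N1 - {y} = fv N - {x, z} \<and> typing (T(y := TAtom d)) N1 \<alpha>"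

text \<open>
  If \<open>a\<close> occurs only in the types \<open>a\<close> of \<open>z\<close> and \<open>a \<rightarrow> d\<close> of \<open>x\<close>, then the balance of \<open>a\<close>
  forces \<open>z\<close> to be the argument of \<open>x\<close>.
\<close>

lemma factor_ne_nf:
  "(ne N \<longrightarrow> (\<forall>T \<alpha> S. prosodic N \<longrightarrow> typing T N \<alpha> \<longrightarrow> finite S \<longrightarrow> x \<in> fv N \<longrightarrow> z \<in> fv N \<longrightarrow>
      T z = TAtom a \<longrightarrow> T x = TAtom a \<rightarrow> TAtom d \<longrightarrow>
      (\<forall>y\<in>fv N - {x, z}. a \<notin> set_ty (T y)) \<longrightarrow> a \<notin> set_ty \<alpha> \<longrightarrow>
      (\<exists>y N1. y \<notin> S \<and> factor x z d T \<alpha> y N N1))) \<and>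
   (nf N' \<longrightarrow> (\<forall>T \<alpha> S. prosodic N' \<longrightarrow> typing T N' \<alpha> \<longrightarrow> finite S \<longrightarrow> x \<in> fv N' \<longrightarrow> z \<in> fv N' \<longrightarrow>
      T z = TAtom a \<longrightarrow> T x = TAtom a \<rightarrow> TAtom d \<longrightarrow>
      (\<forall>y\<in>fv N' - {x, z}. a \<notin> set_ty (T y)) \<longrightarrow> a \<notin> set_ty \<alpha> \<longrightarrow>
      (\<exists>y N1. y \<notin> S \<and> factor x z d T \<alpha> y N' N1)))"
proof (induction rule: ne_nf.induct)
  case (ne_var y)
  then show ?case by auto
next
  case (ne_app P Q)
  show ?case
  proof (intro allI impI)
    fix T \<alpha> S
    assume pros: "prosodic (App P Q)" and ty: "typing T (App P Q) \<alpha>" and S: "finite (S :: name set)"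
      and x: "x \<in> fv (App P Q)" and z: "z \<in> fv (App P Q)" and Tz: "T z = TAtom a"
      and Tx: "T x = TAtom a \<rightarrow> TAtom d" and other: "\<forall>y\<in>fv (App P Q) - {x, z}. a \<notin> set_ty (T y)"
      and \<alpha>: "a \<notin> set_ty \<alpha>"
    from pros have P: "prosodic P" and Q: "prosodic Q" and disj: "fv P \<inter> fv Q = {}"
      by (auto simp: prosodic_App)
    from ty obtain \<beta> where \<beta>: "typing T P (\<beta> \<rightarrow> \<alpha>)" "typing T Q \<beta>" by (auto simp: typing_App)
    have xz: "x \<noteq> z" using Tx Tz by auto
    have ne: "ne P" and nf: "nf Q" using ne_app by auto
    show "\<exists>y N1. y \<notin> S \<and> factor x z d T \<alpha> y (App P Q) N1"
    proof (cases "head P = x")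
      case True
      from ne_string_head[OF ne \<beta>(1)] Tx True have P_eq: "P = Var x" "\<beta> = TAtom a" "\<alpha> = TAtom d" by auto
      have "Q = Var z"
        by (rule nf_atom_var[OF nf \<beta>(2)[unfolded P_eq(2)] Tz]) (use other disj P_eq in auto)
      moreover obtain y where "y \<notin> insert x (insert z S)"
        using fresh_name[of "insert x (insert z S)"] S by auto
      ultimately have "y \<notin> S \<and> factor x z d T \<alpha> y (App P Q) (Var y)"
        using P_eq xz by (auto simp: factor_def typing_Var intro: prosodic.var)
      then show ?thesis by blast
    next
      case False
      have "head P \<noteq> z" using ne_atomic_head[OF ne \<beta>(1)] Tz by auto
      with False have "a \<notin> set_ty (T (head P))" using other ne_head[OF ne] by auto
      with ne_atoms[OF ne \<beta>(1)] have a: "a \<notin> set_ty (\<beta> \<rightarrow> \<alpha>)" "a \<notin> set_ty \<beta>" by auto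
      show ?thesis
      proof (cases "x \<in> fv P")
        case True
        with disj have "x \<notin> fv Q" by auto
        \<comment> \<open>The head of \<open>P\<close> is neither \<open>x\<close> nor
          \<open>z\<close>, so \<open>\<beta>\<close> does not contain \<open>a\<close>. If
          \<open>Q\<close> contained \<open>z\<close> without \<open>x\<close>, the count would put
          \<open>a\<close> into \<open>\<beta>\<close>.\<close>
        have "z \<in> fv P"
        proof (rule ccontr)
          assume "z \<notin> fv P"
          with z have "z \<in> fv Q" by auto
          from balance_one[OF Q \<beta>(2) this Tz] \<open>x \<notin> fv Q\<close> other a show False by auto
        qed
        from ne_app(3)[rule_format, OF P \<beta>(1) _ True this Tz Tx _ a(1), of "S \<union> fv Q"] S other
        obtain y N1 where N1: "y \<notin> S \<union> fv Q" "factor x z d T (\<beta> \<rightarrow> \<alpha>) y P N1" by auto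
        have "typing (T(y := TAtom d)) Q \<beta>" by (rule typing_cong[OF \<beta>(2)]) (use N1 in auto)
        with N1 have "typing (T(y := TAtom d)) (App N1 Q) \<alpha>"
          unfolding factor_def by (blast intro: typing.app)
        moreover have "z \<notin> fv Q" using disj \<open>z \<in> fv P\<close> by auto
        ultimately have "factor x z d T \<alpha> y (App P Q) (App N1 Q)"
          using N1 Q disj \<open>x \<notin> fv Q\<close> unfolding factor_def
          by (auto simp: subst_fresh prosodic_App)
        with N1 show ?thesis by blast
      next
        case False
        with x have xQ: "x \<in> fv Q" by auto
        have "z \<in> fv Q"
        proof (rule ccontr)
          assume "z \<notin> fv Q"
          with z have "z \<in> fv P" by auto
          from balance_one[OF P \<beta>(1) this Tz] False other a show False by auto
        qed
        from ne_app(4)[rule_format, OF Q \<beta>(2) _ xQ this Tz Tx _ a(2), of "S \<union> fv P"] S other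
        obtain y N1 where N1: "y \<notin> S \<union> fv P" "factor x z d T \<beta> y Q N1" by auto
        have "typing (T(y := TAtom d)) P (\<beta> \<rightarrow> \<alpha>)" by (rule typing_cong[OF \<beta>(1)]) (use N1 in auto)
        with N1 have "typing (T(y := TAtom d)) (App P N1) \<alpha>"
          unfolding factor_def by (blast intro: typing.app)
        moreover have "z \<notin> fv P" using disj \<open>z \<in> fv Q\<close> by auto
        ultimately have "factor x z d T \<alpha> y (App P Q) (App P N1)"
          using N1 P disj False unfolding factor_def
          by (auto simp: subst_fresh prosodic_App)
        with N1 show ?thesis by blast
      qed
    qed
  qed
next
  case (nf_ne N)
  then show ?case by blast
next
  case (nf_lam N w)
  show ?case
  proof (intro allI impI)
    fix T \<alpha> S
    assume pros: "prosodic (lam w N)" and ty: "typing T (lam w N) \<alpha>" and S: "finite (S :: name set)"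
      and x: "x \<in> fv (lam w N)" and z: "z \<in> fv (lam w N)" and Tz: "T z = TAtom a"
      and Tx: "T x = TAtom a \<rightarrow> TAtom d" and other: "\<forall>y\<in>fv (lam w N) - {x, z}. a \<notin> set_ty (T y)"
      and \<alpha>: "a \<notin> set_ty \<alpha>"
    have lc: "lc N" using nf_lam(1) by (rule nf_lc)
    from pros have N: "prosodic N" "w \<in> fv N" by (simp_all add: prosodic_lam[OF lc])
    from ty obtain \<beta> \<gamma> where \<beta>: "\<alpha> = \<beta> \<rightarrow> \<gamma>" "typing (T(w := \<beta>)) N \<gamma>"
      unfolding typing_lam[OF lc] by blast
    have "\<exists>y N1. y \<notin> insert w S \<and> factor x z d (T(w := \<beta>)) \<gamma> y N N1"
      by (rule nf_lam(2)[rule_format, OF N(1) \<beta>(2)]) (use S x z Tz Tx other \<alpha> \<beta>(1) in auto)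
    then obtain y N1 where N1: "y \<notin> insert w S" "factor x z d (T(w := \<beta>)) \<gamma> y N N1" by blast
    have w: "w \<noteq> x" "w \<noteq> z" "w \<noteq> y" using x z N1 by auto
    have "typing (T(y := TAtom d, w := \<beta>)) N1 \<gamma>"
      using N1(2) w(3) unfolding factor_def by (simp only: fun_upd_twist[of w y] simp_thms)
    then have ty1: "typing (T(y := TAtom d)) (lam w N1) \<alpha>"
      unfolding \<beta>(1) by (rule typing.abs)
    have fvN1: "fv N1 - {y} = fv N - {x, z}" using N1(2) by (simp add: factor_def)
    with N(2) w have wN1: "w \<in> fv N1" by blast
    have "fv N1 - {w} - {y} = (fv N1 - {y}) - {w}" by blast
    also have "\<dots> = fv N - {w} - {x, z}" unfolding fvN1 by blast
    finally have "fv (lam w N1) - {y} = fv (lam w N) - {x, z}" by simp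
    moreover have "lam w N = subst y (App (Var x) (Var z)) (lam w N1)"
      using N1(2) w by (simp add: factor_def subst_lam)
    moreover have "prosodic (lam w N1)" "y \<in> fv (lam w N1)" "x \<notin> fv (lam w N1)" "z \<notin> fv (lam w N1)"
      using N1(2) w wN1 by (simp_all add: factor_def prosodic.abs)
    ultimately have "factor x z d T \<alpha> y (lam w N) (lam w N1)"
      using ty1 unfolding factor_def by blast
    with N1(1) show "\<exists>y N1. y \<notin> S \<and> factor x z d T \<alpha> y (lam w N) N1" by blast
  qed
qed

text \<open>A normal form that is an abstraction is opened directly, and a neutral one is
  eta-expanded first. Returning the common reduct \<open>M1\<close> lets \<open>conv\<close> pass
  from \<open>M\<close> to \<open>lam z N\<close>.\<close>

lemma open_nf:
  assumes "prosodic M" and "typing T M (\<beta> \<rightarrow> \<alpha>)" and "finite S"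
  obtains z N M1 where "z \<notin> S \<union> fv M" and "red\<^sup>*\<^sup>* M M1" and "red\<^sup>*\<^sup>* (lam z N) M1" and "nf N"
    and "prosodic N" and "fv N = insert z (fv M)" and "typing (T(z := \<beta>)) N \<alpha>"
proof -
  obtain M1 where M1: "red\<^sup>*\<^sup>* M M1" "nf M1" using normalize[OF assms(1)] by blast
  note p = reds_prosodic[OF M1(1) assms(1)] and ty = reds_typing[OF M1(1) assms(2)]
  have "finite (S \<union> fv M)" using assms(3) by simp
  with M1(2) show thesis
  proof (cases rule: nf_cases_fresh)
    case ne
    obtain z where z: "z \<notin> S \<union> fv M" using fresh_name \<open>finite (S \<union> fv M)\<close> by blast
    have "red (lam z (App M1 (Var z))) M1" using z p by (auto intro: red.eta prosodic_lc)
    moreover have "nf (App M1 (Var z))" using ne by (auto intro: ne_nf.intros)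
    moreover have "prosodic (App M1 (Var z))" "fv (App M1 (Var z)) = insert z (fv M)"
      using p z by (auto simp: prosodic_App intro: prosodic.var)
    moreover have "typing (T(z := \<beta>)) M1 (\<beta> \<rightarrow> \<alpha>)"
      by (rule typing_cong[OF ty]) (use p z in auto)
    then have "typing (T(z := \<beta>)) (App M1 (Var z)) \<alpha>"
      by (rule typing.app) (simp add: typing_Var)
    ultimately show thesis using z M1(1) by (intro that[of z M1 "App M1 (Var z)"]) auto
  next
    case (lam z N)
    have lc: "lc N" using lam(2) by (rule nf_lc)
    have "prosodic N" "z \<in> fv N" using p unfolding lam(1) by (simp_all add: prosodic_lam[OF lc])
    moreover have "typing (T(z := \<beta>)) N \<alpha>" using ty unfolding lam(1) typing_lam[OF lc] by blast
    moreover have "fv N = insert z (fv M)" using p \<open>z \<in> fv N\<close> unfolding lam(1) by auto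
    ultimately show thesis using lam M1(1) by (intro that[of z M1 N]) auto
  qed
qed

text \<open>The atom \<open>a\<close> is the far end of the string \<open>x\<close>, so the body of
  the opened label contains \<open>x\<close> applied to \<open>z\<close>. With \<open>M'\<close> the
  abstraction of that application, \<open>M' \<oplus> Var x\<close> beta-reduces to the opened
  label.\<close>

lemma over_label:
  assumes "prosodic M" and "x \<in> fv M" and "typing T M (TAtom a \<rightarrow> TAtom c)"
    and "T x = TAtom a \<rightarrow> TAtom d" and "a \<noteq> c" and "a \<noteq> d"
    and "\<And>y. y \<in> fv M \<Longrightarrow> y \<noteq> x \<Longrightarrow> a \<notin> set_ty (T y)"
  obtains M' M1 where "red\<^sup>*\<^sup>* M M1" and "red\<^sup>*\<^sup>* (M' \<oplus> Var x) M1" and "prosodic M'"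
    and "fv M' = fv M - {x}" and "typing T M' (TAtom d \<rightarrow> TAtom c)"
proof -
  from assms(1,3) obtain z N M1 where z: "z \<notin> {x} \<union> fv M" and M1: "red\<^sup>*\<^sup>* M M1" "red\<^sup>*\<^sup>* (lam z N) M1"
    and N: "nf N" "prosodic N" "fv N = insert z (fv M)" "typing (T(z := TAtom a)) N (TAtom c)"
    by (rule open_nf[of _ _ _ _ "{x}"]) auto
  have "\<exists>y N1. y \<notin> insert x (insert z (fv M)) \<and> factor x z d (T(z := TAtom a)) (TAtom c) y N N1"
    by (rule factor_ne_nf[THEN conjunct2, rule_format, OF N(1,2,4)])
      (use assms z N(3) in auto)
  then obtain y N1 where y: "y \<notin> insert x (insert z (fv M))"
    and N1: "factor x z d (T(z := TAtom a)) (TAtom c) y N N1" by blast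
  from N1 have N1': "N = subst y (App (Var x) (Var z)) N1" "prosodic N1" "y \<in> fv N1"
    "x \<notin> fv N1" "z \<notin> fv N1" "fv N1 - {y} = fv N - {x, z}"
    "typing (T(z := TAtom a, y := TAtom d)) N1 (TAtom c)" by (auto simp: factor_def)
  have "lam y N1 \<oplus> Var x = lam z (App (lam y N1) (App (Var x) (Var z)))"
    using z N1'(5) by (intro cat_lam) auto
  moreover have "red (App (lam y N1) (App (Var x) (Var z))) N"
    unfolding N1'(1) using N1'(2) by (intro red.beta) (simp_all add: prosodic_lc)
  ultimately have "red (lam y N1 \<oplus> Var x) (lam z N)" by (simp add: red.abs)
  with M1(2) have "red\<^sup>*\<^sup>* (lam y N1 \<oplus> Var x) M1" by simp
  moreover have "typing (T(y := TAtom d)) N1 (TAtom c)"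
    by (rule typing_cong[OF N1'(7)]) (use N1'(5) in auto)
  then have "typing T (lam y N1) (TAtom d \<rightarrow> TAtom c)" by (rule typing.abs)
  moreover have "fv (lam y N1) = fv M - {x}" using N1'(6) N(3) z by auto
  ultimately show thesis using M1(1) N1'(2,3) by (intro that) (auto intro: prosodic.abs)
qed

text \<open>On this side \<open>x\<close> is the outermost string: the result atom \<open>a\<close>
  of the body can come only from \<open>x\<close>, which is therefore the head, and
  \<open>M'\<close> abstracts its argument.\<close>

lemma under_label:
  assumes "prosodic M" and "x \<in> fv M" and "typing T M (TAtom d \<rightarrow> TAtom a)"
    and "T x = TAtom c \<rightarrow> TAtom a" and "a \<noteq> d"
    and "\<And>y. y \<in> fv M \<Longrightarrow> y \<noteq> x \<Longrightarrow> a \<notin> set_ty (T y)"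
  obtains M' M1 where "red\<^sup>*\<^sup>* M M1" and "red\<^sup>*\<^sup>* (Var x \<oplus> M') M1" and "prosodic M'"
    and "fv M' = fv M - {x}" and "typing T M' (TAtom d \<rightarrow> TAtom c)"
proof -
  from assms(1,3) obtain z N M1 where z: "z \<notin> {x} \<union> fv M" and M1: "red\<^sup>*\<^sup>* M M1" "red\<^sup>*\<^sup>* (lam z N) M1"
    and N: "nf N" "prosodic N" "fv N = insert z (fv M)" "typing (T(z := TAtom d)) N (TAtom a)"
    by (rule open_nf[of _ _ _ _ "{x}"]) auto
  have ne: "ne N" using N(1,4) by (rule nf_atom_ne)
  have head: "head N = x"
    using ne_atoms[OF ne N(4)] ne_head[OF ne] assms(5,6) N(3) by (auto split: if_splits)
  with ne_string_head[OF ne N(4), of c a] z assms(4) obtain N2 where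
    N2: "N = App (Var x) N2" "typing (T(z := TAtom d)) N2 (TAtom c)" by auto
  with N(2) have p: "prosodic N2" "x \<notin> fv N2" by (auto simp: prosodic_App)
  have "z \<in> fv N2" using N(3) N2(1) z by auto
  have "Var x \<oplus> lam z N2 = lam z (App (Var x) (App (lam z N2) (Var z)))"
    using z by (intro cat_lam) auto
  moreover have "red (App (lam z N2) (Var z)) (subst z (Var z) N2)"
    using p by (intro red.beta prosodic_lc) (auto intro: prosodic.var)
  moreover have "subst z (Var z) N2 = N2" unfolding subst_msubst by (rule msubst_id) auto
  ultimately have "red (Var x \<oplus> lam z N2) (lam z N)"
    unfolding N2(1) by (auto intro: red.abs red.appR)
  with M1(2) have "red\<^sup>*\<^sup>* (Var x \<oplus> lam z N2) M1" by simp
  moreover have "typing T (lam z N2) (TAtom d \<rightarrow> TAtom c)" using N2(2) by (rule typing.abs)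
  moreover have "fv (lam z N2) = fv M - {x}" using N(3) N2(1) z p by auto
  ultimately show thesis using M1(1) p \<open>z \<in> fv N2\<close> by (intro that) (auto intro: prosodic.abs)
qed


section \<open>Long normal forms and coherence\<close>

section \<open>Long normal forms\<close>

inductive lne :: "(name \<Rightarrow> 'a ty) \<Rightarrow> trm \<Rightarrow> 'a ty \<Rightarrow> bool"
  and lnf :: "(name \<Rightarrow> 'a ty) \<Rightarrow> trm \<Rightarrow> 'a ty \<Rightarrow> bool" where
  lne_var: "lne T (Var x) (T x)"
| lne_app: "lne T M (\<beta> \<rightarrow> \<alpha>) \<Longrightarrow> lnf T N \<beta> \<Longrightarrow> lne T (App M N) \<alpha>"
| lnf_lne: "lne T M (TAtom a) \<Longrightarrow> lnf T M (TAtom a)"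
| lnf_lam: "lnf (T(x := \<beta>)) M \<alpha> \<Longrightarrow> lnf T (lam x M) (\<beta> \<rightarrow> \<alpha>)"

lemma lne_lnf_typing: "(lne (T :: name \<Rightarrow> 'a ty) M \<alpha> \<longrightarrow> typing T M \<alpha>) \<and> (lnf (U :: name \<Rightarrow> 'a ty) N \<beta> \<longrightarrow> typing U N \<beta>)"
  by (rule lne_lnf.induct) (blast intro: typing.intros)+

lemmas lne_typing = lne_lnf_typing[THEN conjunct1, rule_format]
lemmas lnf_typing = lne_lnf_typing[THEN conjunct2, rule_format]

lemma lne_lnf_ne: "(lne (T :: name \<Rightarrow> 'a ty) M \<alpha> \<longrightarrow> ne M) \<and> (lnf (U :: name \<Rightarrow> 'a ty) N \<beta> \<longrightarrow> nf N)"
  by (rule lne_lnf.induct) (blast intro: ne_nf.intros)+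

lemmas lne_ne = lne_lnf_ne[THEN conjunct1, rule_format]

lemma lne_lnf_rename:
  "(lne (T :: name \<Rightarrow> 'a ty) M \<alpha> \<longrightarrow> (\<forall>f T'. (\<forall>z\<in>fv M. T' (f z) = T z) \<longrightarrow> lne T' (msubst (\<lambda>x. Var (f x)) M) \<alpha>)) \<and>
   (lnf (U :: name \<Rightarrow> 'a ty) N \<beta> \<longrightarrow> (\<forall>f T'. (\<forall>z\<in>fv N. T' (f z) = U z) \<longrightarrow> lnf T' (msubst (\<lambda>x. Var (f x)) N) \<beta>))"
proof (induction rule: lne_lnf.induct)
  case (lne_var T x)
  show ?case
  proof (intro allI impI)
    fix f :: "name \<Rightarrow> name" and T' :: "name \<Rightarrow> 'a ty" assume "\<forall>z\<in>fv (Var x). T' (f z) = T z"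
    then show "lne T' (msubst (\<lambda>x. Var (f x)) (Var x)) (T x)"
      using lne_lnf.lne_var[of T' "f x"] by simp
  qed
next
  case (lne_app T M \<beta> \<alpha> N)
  show ?case
  proof (intro allI impI)
    fix f :: "name \<Rightarrow> name" and T' :: "name \<Rightarrow> 'a ty" assume *: "\<forall>z\<in>fv (App M N). T' (f z) = T z"
    have "lne T' (msubst (\<lambda>x. Var (f x)) M) (\<beta> \<rightarrow> \<alpha>)" using lne_app.IH(1) * by simp
    moreover have "lnf T' (msubst (\<lambda>x. Var (f x)) N) \<beta>" using lne_app.IH(2) * by simp
    ultimately show "lne T' (msubst (\<lambda>x. Var (f x)) (App M N)) \<alpha>"
      unfolding msubst.simps by (rule lne_lnf.lne_app)
  qed
next
  case (lnf_lne T M a)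
  then show ?case by (blast intro: lne_lnf.lnf_lne)
next
  case (lnf_lam T x \<beta> M \<alpha>)
  show ?case
  proof (intro allI impI)
    fix f :: "name \<Rightarrow> name" and T' :: "name \<Rightarrow> 'a ty" assume *: "\<forall>z\<in>fv (lam x M). T' (f z) = T z"
    obtain y where y: "y \<notin> f ` fv M" using fresh_name[of "f ` fv M"] by auto
    have "lnf (T'(y := \<beta>)) (msubst (\<lambda>z. Var ((f(x := y)) z)) M) \<alpha>"
      by (rule lnf_lam.IH[rule_format]) (use * y in auto)
    also have "(\<lambda>z. Var ((f(x := y)) z)) = (\<lambda>x. Var (f x))(x := Var y)" by auto
    finally have "lnf T' (lam y (msubst ((\<lambda>x. Var (f x))(x := Var y)) M)) (\<beta> \<rightarrow> \<alpha>)"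
      by (rule lne_lnf.lnf_lam)
    moreover have "msubst (\<lambda>x. Var (f x)) (lam x M) = lam y (msubst ((\<lambda>x. Var (f x))(x := Var y)) M)"
      using y by (intro msubst_lam) auto
    ultimately show "lnf T' (msubst (\<lambda>x. Var (f x)) (lam x M)) (\<beta> \<rightarrow> \<alpha>)" by simp
  qed
qed

lemma lne_cong: "lne T M \<alpha> \<Longrightarrow> (\<And>x. x \<in> fv M \<Longrightarrow> T' x = T x) \<Longrightarrow> lne T' M \<alpha>"
  using lne_lnf_rename[THEN conjunct1, rule_format, of T M \<alpha> T' "\<lambda>x. x"] by simp

lemma lnf_FunE:
  assumes "lnf T P (\<beta> \<rightarrow> \<alpha>)" and "x \<notin> fv P"
  obtains N where "P = lam x N" and "lnf (T(x := \<beta>)) N \<alpha>"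
  using assms(1)
proof cases
  case (lnf_lam y M)
  have "lnf (T(x := \<beta>)) (msubst (\<lambda>z. Var ((id(y := x)) z)) M) \<alpha>"
    by (rule lne_lnf_rename[THEN conjunct2, rule_format, OF lnf_lam(2)])
      (use assms(2) lnf_lam(1) in auto)
  also have "(\<lambda>z. Var ((id(y := x)) z)) = Var(y := Var x)" by auto
  finally have "lnf (T(x := \<beta>)) (msubst (Var(y := Var x)) M) \<alpha>" .
  moreover have "P = lam x (msubst (Var(y := Var x)) M)"
    using assms(2) unfolding lnf_lam(1) by (intro lam_alpha) auto
  ultimately show thesis using that by blast
qed

lemma lnf_AtomE: "lnf T P (TAtom a) \<Longrightarrow> lne T P (TAtom a)"
  by (cases rule: lnf.cases) auto

text \<open>Induction on the type: the new variable is expanded at the argument type, and the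
  resulting application at the smaller result type.\<close>

lemma eta_long:
  "lne T P \<alpha> \<Longrightarrow> prosodic P \<Longrightarrow>
    \<exists>P'. lnf T P' \<alpha> \<and> red\<^sup>*\<^sup>* P' P \<and> prosodic P' \<and> fv P' = fv P"
proof (induction \<alpha> arbitrary: T P)
  case (TAtom a)
  then show ?case by (auto intro: lne_lnf.lnf_lne)
next
  case (Fun \<beta> \<alpha>)
  obtain x where x: "x \<notin> fv P" using fresh_name[of "fv P"] by auto
  let ?T = "T(x := \<beta>)"
  have "lne ?T (Var x) \<beta>" using lne_var[of ?T x] by simp
  from Fun.IH(1)[OF this prosodic.var] obtain X where
    X: "lnf ?T X \<beta>" "red\<^sup>*\<^sup>* X (Var x)" "prosodic X" "fv X = {x}"
    unfolding fv.simps by blast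
  have "lne ?T P (\<beta> \<rightarrow> \<alpha>)" by (rule lne_cong[OF Fun.prems(1)]) (use x in auto)
  then have lne: "lne ?T (App P X) \<alpha>" using X(1) by (rule lne_app)
  have "prosodic (App P X)" using Fun.prems(2) X x by (auto simp: prosodic_App)
  from Fun.IH(2)[OF lne this] obtain P' where
    P': "lnf ?T P' \<alpha>" "red\<^sup>*\<^sup>* P' (App P X)" "prosodic P'" "fv P' = fv (App P X)"
    by blast
  have "red\<^sup>*\<^sup>* P' (App P (Var x))"
    using P'(2) reds_App[OF rtranclp.rtrancl_refl X(2)] by (rule rtranclp_trans)
  then have "red\<^sup>*\<^sup>* (lam x P') (lam x (App P (Var x)))" by (rule reds_lam)
  also have "red (lam x (App P (Var x))) P"
    using Fun.prems(2) x by (auto intro: red.eta prosodic_lc)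
  finally have "red\<^sup>*\<^sup>* (lam x P') P" .
  moreover have "lnf T (lam x P') (\<beta> \<rightarrow> \<alpha>)" using P'(1) by (rule lne_lnf.lnf_lam)
  moreover have "prosodic (lam x P')" "fv (lam x P') = fv P"
    using P'(3,4) X(4) x by (auto intro: prosodic.abs)
  ultimately show ?case by blast
qed

lemma ne_nf_long:
  "(ne M \<longrightarrow> (\<forall>(T :: name \<Rightarrow> 'a ty) \<alpha>. prosodic M \<longrightarrow> typing T M \<alpha> \<longrightarrow>
      (\<exists>P. lne T P \<alpha> \<and> red\<^sup>*\<^sup>* P M \<and> prosodic P \<and> fv P = fv M))) \<and>
   (nf N \<longrightarrow> (\<forall>(T :: name \<Rightarrow> 'a ty) \<alpha>. prosodic N \<longrightarrow> typing T N \<alpha> \<longrightarrow>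
      (\<exists>P. lnf T P \<alpha> \<and> red\<^sup>*\<^sup>* P N \<and> prosodic P \<and> fv P = fv N)))"
proof (induction rule: ne_nf.induct)
  case (ne_var x)
  then show ?case by (auto simp: typing_Var intro!: exI[of _ "Var x"] lne_lnf.lne_var)
next
  case (ne_app M N)
  show ?case
  proof (intro allI impI)
    fix T :: "name \<Rightarrow> 'a ty" and \<alpha> assume p: "prosodic (App M N)" and t: "typing T (App M N) \<alpha>"
    from t obtain \<beta> where \<beta>: "typing T M (\<beta> \<rightarrow> \<alpha>)" "typing T N \<beta>" by (auto simp: typing_App)
    from p have p': "prosodic M" "prosodic N" "fv M \<inter> fv N = {}" by (auto simp: prosodic_App)
    from ne_app.IH(1) \<beta>(1) p' obtain P where
      P: "lne T P (\<beta> \<rightarrow> \<alpha>)" "red\<^sup>*\<^sup>* P M" "prosodic P" "fv P = fv M" by blast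
    from ne_app.IH(2) \<beta>(2) p' obtain Q where
      Q: "lnf T Q \<beta>" "red\<^sup>*\<^sup>* Q N" "prosodic Q" "fv Q = fv N" by blast
    have "lne T (App P Q) \<alpha>" using P(1) Q(1) by (rule lne_lnf.lne_app)
    moreover have "red\<^sup>*\<^sup>* (App P Q) (App M N)" using P(2) Q(2) by (rule reds_App)
    moreover have "prosodic (App P Q)" "fv (App P Q) = fv (App M N)"
      using P Q p' by (auto simp: prosodic_App)
    ultimately show "\<exists>P. lne T P \<alpha> \<and> red\<^sup>*\<^sup>* P (App M N) \<and> prosodic P \<and> fv P = fv (App M N)"
      by blast
  qed
next
  case (nf_ne M)
  show ?case
  proof (intro allI impI)
    fix T :: "name \<Rightarrow> 'a ty" and \<alpha> assume p: "prosodic M" and t: "typing T M \<alpha>"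
    with nf_ne.IH obtain P where P: "lne T P \<alpha>" "red\<^sup>*\<^sup>* P M" "prosodic P" "fv P = fv M" by blast
    from eta_long[OF P(1,3)] obtain P' where
      "lnf T P' \<alpha>" "red\<^sup>*\<^sup>* P' P" "prosodic P'" "fv P' = fv P" by blast
    with P(2,4) show "\<exists>P. lnf T P \<alpha> \<and> red\<^sup>*\<^sup>* P M \<and> prosodic P \<and> fv P = fv M"
      by (metis rtranclp_trans)
  qed
next
  case (nf_lam M x)
  show ?case
  proof (intro allI impI)
    fix T :: "name \<Rightarrow> 'a ty" and \<alpha> assume p: "prosodic (lam x M)" and t: "typing T (lam x M) \<alpha>"
    have lc: "lc M" using nf_lam.hyps by (rule nf_lc)
    from p have p': "prosodic M" "x \<in> fv M" by (simp_all add: prosodic_lam[OF lc])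
    from t obtain \<beta> \<gamma> where \<alpha>: "\<alpha> = \<beta> \<rightarrow> \<gamma>" "typing (T(x := \<beta>)) M \<gamma>"
      unfolding typing_lam[OF lc] by blast
    from nf_lam.IH \<alpha>(2) p' obtain P where
      P: "lnf (T(x := \<beta>)) P \<gamma>" "red\<^sup>*\<^sup>* P M" "prosodic P" "fv P = fv M" by blast
    have "lnf T (lam x P) \<alpha>" unfolding \<alpha>(1) using P(1) by (rule lne_lnf.lnf_lam)
    moreover have "red\<^sup>*\<^sup>* (lam x P) (lam x M)" using P(2) by (rule reds_lam)
    moreover have "prosodic (lam x P)" "fv (lam x P) = fv (lam x M)"
      using P p' by (auto intro: prosodic.abs)
    ultimately show "\<exists>P. lnf T P \<alpha> \<and> red\<^sup>*\<^sup>* P (lam x M) \<and> prosodic P \<and> fv P = fv (lam x M)"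
      by blast
  qed
qed

lemma long_normal_form:
  assumes "prosodic M" and "typing T M \<alpha>"
  obtains P M1 where "lnf T P \<alpha>" and "red\<^sup>*\<^sup>* M M1" and "red\<^sup>*\<^sup>* P M1" and "prosodic P"
    and "fv P = fv M"
proof -
  obtain M1 where M1: "red\<^sup>*\<^sup>* M M1" "nf M1" using normalize[OF assms(1)] by blast
  note p = reds_prosodic[OF M1(1) assms(1)]
  from ne_nf_long[THEN conjunct2, rule_format, OF M1(2) _ reds_typing[OF M1(1) assms(2)]] p
  obtain P where "lnf T P \<alpha>" "red\<^sup>*\<^sup>* P M1" "prosodic P" "fv P = fv M1" by blast
  with M1(1) p show thesis using that by auto
qed


section \<open>Coherence\<close>

primrec pol :: "bool \<Rightarrow> 'a ty \<Rightarrow> 'a multiset" where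
  "pol s (TAtom a) = (if s then {#a#} else {#})"
| "pol s (\<beta> \<rightarrow> \<alpha>) = pol s \<alpha> + pol (\<not> s) \<beta>"

text \<open>The negative occurrences in the whole sequent: an atom that is positive in the type of a
  hypothesis is negative in the sequent.\<close>

definition negs :: "name set \<Rightarrow> (name \<Rightarrow> 'a ty) \<Rightarrow> 'a ty \<Rightarrow> 'a multiset" where
  "negs V T \<alpha> = (\<Sum>x\<in>V. pol True (T x)) + pol False \<alpha>"

primrec arity :: "'a ty \<Rightarrow> nat" where
  "arity (TAtom a) = 0"
| "arity (\<beta> \<rightarrow> \<alpha>) = Suc (arity \<alpha>)"

primrec nargs :: "trm \<Rightarrow> nat" where
  "nargs (Var x) = 0"
| "nargs (App M N) = Suc (nargs M)"
| "nargs (Bound i) = 0"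
| "nargs (Lam M) = 0"
| "nargs (Tup M N) = 0"
| "nargs (LetTup M N) = 0"

inductive_cases lne_VarE: "lne T (Var x) \<alpha>"
inductive_cases lne_AppE: "lne T (App M N) \<alpha>"

lemma lne_arity: "lne T M \<alpha> \<Longrightarrow> arity (T (head M)) = nargs M + arity \<alpha>"
proof (induction M arbitrary: \<alpha>)
  case (Var x)
  then show ?case by (auto elim: lne_VarE)
next
  case (App M N)
  from App.prems obtain \<beta> where "lne T M (\<beta> \<rightarrow> \<alpha>)" by (rule lne_AppE)
  from App.IH(1)[OF this] show ?case by simp
qed (auto dest!: lne_ne elim: ne.cases)

lemma lne_pol: "lne T M \<alpha> \<Longrightarrow> pol True \<alpha> \<subseteq># pol True (T (head M))"
proof (induction M arbitrary: \<alpha>)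
  case (Var x)
  then show ?case by (auto elim: lne_VarE)
next
  case (App M N)
  from App.prems obtain \<beta> where "lne T M (\<beta> \<rightarrow> \<alpha>)" by (rule lne_AppE)
  from App.IH(1)[OF this] have "pol True \<alpha> + pol False \<beta> \<subseteq># pol True (T (head M))" by simp
  then show ?case unfolding head.simps
    by (rule subset_mset.order_trans[OF mset_subset_eq_add_left])
qed (auto dest!: lne_ne elim: ne.cases)

lemma uniq_subset: "uniq B \<Longrightarrow> A \<subseteq># B \<Longrightarrow> uniq A"
  unfolding uniq_def by (meson le_trans mset_subset_eq_count)

lemma sum_two_subset:
  assumes "finite V" and "x \<in> V" and "y \<in> V" and "x \<noteq> y"
  shows "F x + F y \<subseteq># (\<Sum>x\<in>V. F x :: 'a multiset)"
proof -
  have "(\<Sum>x\<in>V. F x) = F x + (F y + (\<Sum>x\<in>V - {x} - {y}. F x))"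
    using assms by (simp add: sum.remove[of V x] sum.remove[of "V - {x}" y])
  then show ?thesis by (simp add: add.assoc[symmetric])
qed

text \<open>
  If every atom occurs at most once negatively, then the goal type determines the head variable.
  The free variables are only bounded by \<open>V\<close>, since the split of the context is not known yet.
\<close>

lemma long_unique:
  "(\<forall>T P \<alpha> P' \<alpha>' V. tsize P = n \<longrightarrow> lne T P \<alpha> \<longrightarrow> lne T P' \<alpha>' \<longrightarrow> head P = head P' \<longrightarrow>
      nargs P = nargs P' \<longrightarrow> prosodic P \<longrightarrow> prosodic P' \<longrightarrow> finite V \<longrightarrow> fv P \<subseteq> V \<longrightarrow> fv P' \<subseteq> V \<longrightarrow>
      uniq (\<Sum>x\<in>V. pol True (T x :: 'a ty)) \<longrightarrow> P = P') \<and>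
   (\<forall>T P \<alpha> P' V. tsize P = n \<longrightarrow> lnf T P \<alpha> \<longrightarrow> lnf T P' \<alpha> \<longrightarrow>
      prosodic P \<longrightarrow> prosodic P' \<longrightarrow> finite V \<longrightarrow> fv P \<subseteq> V \<longrightarrow> fv P' \<subseteq> V \<longrightarrow>
      uniq (negs V T (\<alpha> :: 'a ty)) \<longrightarrow> P = P')"
proof (induction n rule: less_induct)
  case (less n)
  have IH1: "P = P'"
    if "tsize P < n" "lne T P \<alpha>" "lne T P' \<alpha>'" "head P = head P'" "nargs P = nargs P'"
      "prosodic P" "prosodic P'" "finite V" "fv P \<subseteq> V" "fv P' \<subseteq> V"
      "uniq (\<Sum>x\<in>V. pol True (T x))" for T P P' V and \<alpha> \<alpha>' :: "'a ty"
    by (rule less[OF that(1), THEN conjunct1, rule_format, OF HOL.refl that(2-)])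
  have IH2: "P = P'"
    if "tsize P < n" "lnf T P \<alpha>" "lnf T P' \<alpha>"
      "prosodic P" "prosodic P'" "finite V" "fv P \<subseteq> V" "fv P' \<subseteq> V"
      "uniq (negs V T \<alpha>)" for T P P' V and \<alpha> :: "'a ty"
    by (rule less[OF that(1), THEN conjunct2, rule_format, OF HOL.refl that(2-)])
  have lne: "P = P'"
    if n: "tsize P = n" and P: "lne T P \<alpha>" and P': "lne T P' \<alpha>'"
      and h: "head P = head P'" "nargs P = nargs P'"
      and p: "prosodic P" "prosodic P'" and V: "finite V" "fv P \<subseteq> V" "fv P' \<subseteq> V"
      and u: "uniq (\<Sum>x\<in>V. pol True (T x))" for T P P' V and \<alpha> \<alpha>' :: "'a ty"
    using P
  proof (cases rule: lne.cases)
    case (lne_var x)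
    with P' h show ?thesis by (cases rule: lne.cases) auto
  next
    case (lne_app M \<beta> N)
    from P' h(2) lne_app(1) obtain M' N' \<beta>' where
      M': "P' = App M' N'" "lne T M' (\<beta>' \<rightarrow> \<alpha>')" "lnf T N' \<beta>'"
      by (cases rule: lne.cases) auto
    have pM: "prosodic M" "prosodic N" "fv M \<inter> fv N = {}" "prosodic M'" "prosodic N'" "fv M' \<inter> fv N' = {}"
      using p M'(1) lne_app(1) by (auto simp: prosodic_App)
    have M_eq: "M = M'"
      by (rule IH1[OF _ lne_app(2) M'(2) _ _ pM(1,4) V(1) _ _ u]) (use n h V M'(1) lne_app(1) in auto)
    have "(\<beta> \<rightarrow> \<alpha>) = (\<beta>' \<rightarrow> \<alpha>')"
      by (rule ne_typing_unique[OF lne_ne[OF lne_app(2)] lne_typing[OF lne_app(2)]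
          lne_typing[OF M'(2)[folded M_eq]]]) simp
    then have eq: "\<beta>' = \<beta>" by simp
    have hM: "head M \<in> fv M" using lne_app(2) by (intro ne_head lne_ne)
    then have hV: "head M \<in> V" using V(2) lne_app(1) by auto
    \<comment> \<open>By linearity the head does not occur in the argument. Dropping it from the
      context pays for the new goal \<open>\<beta>\<close>, whose negative atoms are already counted
      in the type of the head.\<close>
    let ?V = "V - {head M}"
    have "pol True \<alpha> + pol False \<beta> \<subseteq># pol True (T (head M))"
      using lne_pol[OF lne_app(2)] by simp
    then have "pol False \<beta> \<subseteq># pol True (T (head M))"
      by (rule subset_mset.order_trans[OF mset_subset_eq_add_right])
    then have "negs ?V T \<beta> \<subseteq># (\<Sum>x\<in>V. pol True (T x))"
      unfolding negs_def sum.remove[OF V(1) hV] by (simp add: add.commute)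
    with u have "uniq (negs ?V T \<beta>)" by (rule uniq_subset)
    then have "N = N'"
      by (intro IH2[OF _ lne_app(3) M'(3)[unfolded eq] pM(2,5), of ?V])
        (use n V hM pM M_eq M'(1) lne_app(1) in auto)
    with M_eq M'(1) lne_app(1) show ?thesis by simp
  qed
  have lnf: "P = P'"
    if n: "tsize P = n" and P: "lnf T P \<alpha>" and P': "lnf T P' \<alpha>"
      and p: "prosodic P" "prosodic P'" and V: "finite V" "fv P \<subseteq> V" "fv P' \<subseteq> V"
      and u: "uniq (negs V T \<alpha>)" for T P P' V and \<alpha> :: "'a ty"
  proof (cases \<alpha>)
    case (TAtom a)
    have Q: "lne T P (TAtom a)" "lne T P' (TAtom a)" using P P' TAtom by (auto intro: lnf_AtomE)
    have u': "uniq (\<Sum>x\<in>V. pol True (T x))" using u TAtom by (simp add: negs_def)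
    have a: "{#a#} \<subseteq># pol True (T (head P))" "{#a#} \<subseteq># pol True (T (head P'))"
      using lne_pol[OF Q(1)] lne_pol[OF Q(2)] by auto
    have hV: "head P \<in> V" "head P' \<in> V"
      using ne_head[OF lne_ne[OF Q(1)]] ne_head[OF lne_ne[OF Q(2)]] V by auto
    \<comment> \<open>Each head offers \<open>a\<close> positively, so two different heads would
      make \<open>a\<close> occur twice. The arity of the common head then fixes the number of
      arguments, because the goal is atomic.\<close>
    have h: "head P = head P'"
    proof (rule ccontr)
      assume "head P \<noteq> head P'"
      with hV V(1) have "pol True (T (head P)) + pol True (T (head P')) \<subseteq># (\<Sum>x\<in>V. pol True (T x))"
        by (intro sum_two_subset)
      with subset_mset.add_mono[OF a] have "{#a#} + {#a#} \<subseteq># (\<Sum>x\<in>V. pol True (T x))"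
        by (rule subset_mset.order_trans)
      with u' have "uniq ({#a#} + {#a#})" by (rule uniq_subset)
      then show False by simp
    qed
    then have "nargs P = nargs P'" using lne_arity[OF Q(1)] lne_arity[OF Q(2)] by simp
    from lne[OF n Q h this p V u'] show ?thesis .
  next
    case (Fun \<beta> \<gamma>)
    obtain x where x: "x \<notin> V" using fresh_name[OF V(1)] by blast
    with V have xP: "x \<notin> fv P" "x \<notin> fv P'" by auto
    from P[unfolded Fun] xP(1) obtain M where M: "P = lam x M" "lnf (T(x := \<beta>)) M \<gamma>"
      by (rule lnf_FunE)
    from P'[unfolded Fun] xP(2) obtain N where N: "P' = lam x N" "lnf (T(x := \<beta>)) N \<gamma>"
      by (rule lnf_FunE)
    have lc: "lc M" "lc N" using typing_lc[OF lnf_typing] M(2) N(2) by blast+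
    have "(\<Sum>y\<in>V. pol True ((T(x := \<beta>)) y)) = (\<Sum>y\<in>V. pol True (T y))"
      by (rule sum.cong) (use x in auto)
    then have "negs (insert x V) (T(x := \<beta>)) \<gamma> = negs V T \<alpha>"
      unfolding negs_def sum.insert[OF V(1) x] Fun by (simp add: ac_simps)
    with u have u': "uniq (negs (insert x V) (T(x := \<beta>)) \<gamma>)" by simp
    have "M = N"
      by (rule IH2[OF _ M(2) N(2) _ _ _ _ _ u'])
        (use n p V M(1) N(1) lc in \<open>auto simp: prosodic_lam\<close>)
    with M(1) N(1) show ?thesis by simp
  qed
  show ?case
    by (intro conjI allI impI; ((rule lne; assumption) | (rule lnf; assumption)))
qed

lemma pol_map_ty: "pol s (map_ty h \<alpha>) = image_mset h (pol s \<alpha>)"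
  by (induction \<alpha> arbitrary: s) auto

lemma uniq_image: "uniq (image_mset h A) \<Longrightarrow> uniq A"
  by (induction A) auto

lemma uniq_sum:
  "finite V \<Longrightarrow> (\<And>x. x \<in> V \<Longrightarrow> uniq (F x)) \<Longrightarrow>
    (\<And>x y. x \<in> V \<Longrightarrow> y \<in> V \<Longrightarrow> x \<noteq> y \<Longrightarrow> set_mset (F x) \<inter> set_mset (F y) = {}) \<Longrightarrow>
    uniq (\<Sum>x\<in>V. F x)"
proof (induction rule: finite_induct)
  case (insert x V)
  have "set_mset (F x) \<inter> set_mset (F y) = {}" if "y \<in> V" for y
    using insert.prems(2)[of x y] insert.hyps(2) that by auto
  then have "set_mset (F x) \<inter> set_mset (\<Sum>x\<in>V. F x) = {}"
    by (auto simp: set_mset_sum[OF insert.hyps(1)])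
  with insert show ?case by (simp add: uniq_union)
qed simp

abbreviation same_shapes :: "(name \<Rightarrow> 'a ty) \<Rightarrow> (name \<Rightarrow> 'b ty) \<Rightarrow> trm \<Rightarrow> bool" where
  "same_shapes T T1 M \<equiv> \<forall>x\<in>fv M. shape (T1 x) = shape (T x)"

abbreviation relabels ::
  "(name \<Rightarrow> 'a ty) \<Rightarrow> (name \<Rightarrow> 'b ty) \<Rightarrow> (name \<Rightarrow> 'b ty) \<Rightarrow> trm \<Rightarrow> bool" where
  "relabels T T1 T0 M \<equiv>
     \<forall>x\<in>fv M. shape (T0 x) = shape (T x) \<and> pol True (T0 x) = pol True (T1 x)"

text \<open>In a long normal form, the negative atoms can be chosen freely and determine the positive ones.\<close>

lemma long_labelling:
  "(lne (T :: name \<Rightarrow> 'a ty) P \<alpha> \<longrightarrow> prosodic P \<longrightarrow> (\<forall>T1. same_shapes T T1 P \<longrightarrow>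
      (\<exists>\<kappa>. shape \<kappa> = shape \<alpha> \<and> (\<forall>\<alpha>0 :: 'b ty. shape \<alpha>0 = shape \<alpha> \<and> pol True \<alpha>0 = pol True \<kappa> \<longrightarrow>
        (\<exists>T0. typing T0 P \<alpha>0 \<and> relabels T T1 T0 P))))) \<and>
   (lnf (U :: name \<Rightarrow> 'a ty) Q \<gamma> \<longrightarrow> prosodic Q \<longrightarrow> (\<forall>T1 \<gamma>1. same_shapes U T1 Q \<longrightarrow>
      shape \<gamma>1 = shape \<gamma> \<longrightarrow>
      (\<exists>T0 \<gamma>0 :: 'b ty. typing T0 Q \<gamma>0 \<and> shape \<gamma>0 = shape \<gamma> \<and> pol False \<gamma>0 = pol False \<gamma>1 \<and> relabels U T1 T0 Q)))"
proof (induction rule: lne_lnf.induct)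
  case (lne_var T x)
  show ?case
  proof (intro impI allI)
    fix T1 :: "name \<Rightarrow> 'b ty"
    assume "same_shapes T T1 (Var x)"
    then have "shape (T1 x) = shape (T x)" by simp
    moreover have "typing (\<lambda>_. \<alpha>0) (Var x) \<alpha>0" for \<alpha>0 :: "'b ty" by (simp add: typing_Var)
    ultimately show "\<exists>\<kappa>. shape \<kappa> = shape (T x) \<and> (\<forall>\<alpha>0 :: 'b ty. shape \<alpha>0 = shape (T x) \<and>
        pol True \<alpha>0 = pol True \<kappa> \<longrightarrow> (\<exists>T0. typing T0 (Var x) \<alpha>0 \<and> relabels T T1 T0 (Var x)))"
      by (intro exI[of _ "T1 x"]) auto
  qed
next
  case (lne_app T M \<beta> \<alpha> N)
  show ?case
  proof (intro impI allI)
    fix T1 :: "name \<Rightarrow> 'b ty"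
    assume p: "prosodic (App M N)" and T1: "same_shapes T T1 (App M N)"
    from p have p': "prosodic M" "prosodic N" "fv M \<inter> fv N = {}" by (auto simp: prosodic_App)
    have "same_shapes T T1 M" using T1 by simp
    from lne_app.IH(1)[THEN mp, OF p'(1), THEN spec, THEN mp, OF this] obtain \<kappa> where
      \<kappa>: "shape \<kappa> = shape (\<beta> \<rightarrow> \<alpha>)"
      and M: "\<forall>\<alpha>0 :: 'b ty. shape \<alpha>0 = shape (\<beta> \<rightarrow> \<alpha>) \<and> pol True \<alpha>0 = pol True \<kappa> \<longrightarrow>
        (\<exists>T0. typing T0 M \<alpha>0 \<and> relabels T T1 T0 M)"
      by (elim exE conjE)
    from \<kappa> obtain \<kappa>1 \<kappa>2 where \<kappa>12: "\<kappa> = \<kappa>1 \<rightarrow> \<kappa>2" "shape \<kappa>1 = shape \<beta>" "shape \<kappa>2 = shape \<alpha>"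
      using shape_Fun[of \<kappa>] by auto
    have "same_shapes T T1 N" using T1 by simp
    from lne_app.IH(2)[THEN mp, OF p'(2), THEN spec, THEN spec, THEN mp, OF this, THEN mp, OF \<kappa>12(2)]
    obtain TN \<beta>0 where
      N: "typing TN N \<beta>0" "shape \<beta>0 = shape \<beta>" "pol False \<beta>0 = pol False \<kappa>1"
        "relabels T T1 TN N"
      by (elim exE conjE)
    have "\<exists>T0. typing T0 (App M N) \<alpha>0 \<and> relabels T T1 T0 (App M N)"
      if \<alpha>0: "shape \<alpha>0 = shape \<alpha>" "pol True \<alpha>0 = pol True \<kappa>2" for \<alpha>0 :: "'b ty"
    proof -
      \<comment> \<open>The negative atoms of \<open>\<beta>0\<close> are positive in the arrow. The
        argument \<open>N\<close> was typed to match \<open>\<kappa>1\<close> in exactly these, and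
        its other atoms may differ from those of \<open>\<kappa>1\<close>.\<close>
      have "shape (\<beta>0 \<rightarrow> \<alpha>0) = shape (\<beta> \<rightarrow> \<alpha>)" "pol True (\<beta>0 \<rightarrow> \<alpha>0) = pol True \<kappa>"
        using \<alpha>0 N(2,3) \<kappa>12(1) by simp_all
      with M obtain TM where TM: "typing TM M (\<beta>0 \<rightarrow> \<alpha>0)" "relabels T T1 TM M"
        by blast
      \<comment> \<open>By linearity \<open>M\<close> and \<open>N\<close> share no variables, so
        their assignments can be merged.\<close>
      let ?T = "\<lambda>x. if x \<in> fv M then TM x else TN x"
      have "typing ?T M (\<beta>0 \<rightarrow> \<alpha>0)" by (rule typing_cong[OF TM(1)]) auto
      moreover have "typing ?T N \<beta>0" by (rule typing_cong[OF N(1)]) (use p'(3) in auto)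
      ultimately have "typing ?T (App M N) \<alpha>0" by (rule typing.app)
      with TM(2) N(4) show ?thesis by (intro exI[of _ ?T]) auto
    qed
    with \<kappa>12(3) show "\<exists>\<kappa>. shape \<kappa> = shape \<alpha> \<and> (\<forall>\<alpha>0 :: 'b ty. shape \<alpha>0 = shape \<alpha> \<and>
        pol True \<alpha>0 = pol True \<kappa> \<longrightarrow> (\<exists>T0. typing T0 (App M N) \<alpha>0 \<and> relabels T T1 T0 (App M N)))"
      by blast
  qed
next
  case (lnf_lne T M a)
  show ?case
  proof (intro impI allI)
    fix T1 :: "name \<Rightarrow> 'b ty" and \<gamma>1 :: "'b ty"
    assume p: "prosodic M" and T1: "same_shapes T T1 M"
      and "shape \<gamma>1 = shape (TAtom a)"
    then have "pol False \<gamma>1 = {#}" by (cases \<gamma>1) auto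
    from lnf_lne.IH[THEN mp, OF p, THEN spec, THEN mp, OF T1] obtain \<kappa> where
      \<kappa>: "shape \<kappa> = shape (TAtom a)"
        "\<forall>\<alpha>0 :: 'b ty. shape \<alpha>0 = shape (TAtom a) \<and> pol True \<alpha>0 = pol True \<kappa> \<longrightarrow>
        (\<exists>T0. typing T0 M \<alpha>0 \<and> relabels T T1 T0 M)"
      by (elim exE conjE)
    then obtain T0 where T0: "typing T0 M \<kappa>" "relabels T T1 T0 M"
      by blast
    from \<kappa>(1) have "pol False \<kappa> = {#}" by (cases \<kappa>) auto
    with \<kappa>(1) T0 \<open>pol False \<gamma>1 = {#}\<close>
    show "\<exists>T0 \<gamma>0 :: 'b ty. typing T0 M \<gamma>0 \<and> shape \<gamma>0 = shape (TAtom a) \<and>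
        pol False \<gamma>0 = pol False \<gamma>1 \<and> relabels T T1 T0 M"
      by (intro exI[of _ T0] exI[of _ \<kappa>]) simp
  qed
next
  case (lnf_lam T x \<beta> M \<alpha>)
  show ?case
  proof (intro impI allI)
    fix T1 :: "name \<Rightarrow> 'b ty" and \<gamma>1 :: "'b ty"
    assume p: "prosodic (lam x M)" and T1: "same_shapes T T1 (lam x M)"
      and \<gamma>1: "shape \<gamma>1 = shape (\<beta> \<rightarrow> \<alpha>)"
    have lc: "lc M" using typing_lc[OF lnf_typing[OF lnf_lam.hyps]] .
    from p have p': "prosodic M" "x \<in> fv M" by (simp_all add: prosodic_lam[OF lc])
    from \<gamma>1 obtain \<beta>1 \<alpha>1 where \<beta>1: "\<gamma>1 = \<beta>1 \<rightarrow> \<alpha>1" "shape \<beta>1 = shape \<beta>" "shape \<alpha>1 = shape \<alpha>"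
      using shape_Fun[of \<gamma>1] by auto
    have "\<forall>y\<in>fv M. shape ((T1(x := \<beta>1)) y) = shape ((T(x := \<beta>)) y)"
      using T1 \<beta>1(2) by auto
    from lnf_lam.IH[THEN mp, OF p'(1), THEN spec, THEN spec, THEN mp, OF this, THEN mp, OF \<beta>1(3)]
    obtain T0 \<alpha>0 where
      T0: "typing T0 M \<alpha>0" "shape \<alpha>0 = shape \<alpha>" "pol False \<alpha>0 = pol False \<alpha>1"
      "\<forall>y\<in>fv M. shape (T0 y) = shape ((T(x := \<beta>)) y) \<and>
        pol True (T0 y) = pol True ((T1(x := \<beta>1)) y)"
      by (elim exE conjE)
    have "typing (T0(x := T0 x)) M \<alpha>0" using T0(1) by simp
    then have "typing T0 (lam x M) (T0 x \<rightarrow> \<alpha>0)" by (rule typing.abs)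
    moreover have "shape (T0 x \<rightarrow> \<alpha>0) = shape (\<beta> \<rightarrow> \<alpha>)" "pol False (T0 x \<rightarrow> \<alpha>0) = pol False \<gamma>1"
      using T0(2,3) bspec[OF T0(4) p'(2)] \<beta>1(1) by simp_all
    moreover have "relabels T T1 T0 (lam x M)"
      using T0(4) by auto
    ultimately show "\<exists>T0 \<gamma>0 :: 'b ty. typing T0 (lam x M) \<gamma>0 \<and> shape \<gamma>0 = shape (\<beta> \<rightarrow> \<alpha>) \<and>
        pol False \<gamma>0 = pol False \<gamma>1 \<and> relabels T T1 T0 (lam x M)"
      by blast
  qed
qed

text \<open>Each leaf is labelled through the path that leads to it, so an injective
  \<open>f\<close> makes all atoms of the type distinct.\<close>

primrec label_ty :: "(bool list \<Rightarrow> 'a) \<Rightarrow> unit ty \<Rightarrow> 'a ty" where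
  "label_ty f (TAtom u) = TAtom (f [])"
| "label_ty f (\<beta> \<rightarrow> \<alpha>) = label_ty (\<lambda>p. f (True # p)) \<beta> \<rightarrow> label_ty (\<lambda>p. f (False # p)) \<alpha>"

lemma shape_label_ty [simp]: "shape (label_ty f \<tau>) = \<tau>"
  by (induction \<tau> arbitrary: f) auto

lemma label_ty_pol: "set_mset (pol s (label_ty f \<tau>)) \<subseteq> range f"
proof (induction \<tau> arbitrary: f s)
  case (Fun \<beta> \<alpha>)
  have "range (\<lambda>p. f (b # p)) \<subseteq> range f" for b by auto
  with Fun.IH show ?case by (simp del: image_subset_iff) (meson order_trans)
qed auto

lemma label_ty_uniq: "inj f \<Longrightarrow> uniq (pol s (label_ty f \<tau>))"
proof (induction \<tau> arbitrary: f s)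
  case (Fun \<beta> \<alpha>)
  have "inj (\<lambda>p. f (b # p))" for b using Fun.prems by (auto simp: inj_def)
  moreover have "range (\<lambda>p. f (True # p)) \<inter> range (\<lambda>p. f (False # p)) = {}"
    using Fun.prems by (auto simp: inj_def)
  then have "set_mset (pol s (label_ty (\<lambda>p. f (False # p)) \<alpha>)) \<inter>
      set_mset (pol (\<not> s) (label_ty (\<lambda>p. f (True # p)) \<beta>)) = {}"
    using label_ty_pol[of s "\<lambda>p. f (False # p)" \<alpha>] label_ty_pol[of "\<not> s" "\<lambda>p. f (True # p)" \<beta>]
    by blast
  ultimately show ?case using Fun.IH by (simp add: uniq_union)
qed (simp add: uniq_def)

lemma image_mset_sum': "image_mset h (\<Sum>x\<in>V. F x) = (\<Sum>x\<in>V. image_mset h (F x))"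
  by (induction V rule: infinite_finite_induct) auto

text \<open>Relabel the negative atoms of a long normal form by pairwise distinct ones. The
  resulting typing carries over to \<open>M\<close> and is an instance of the principal one. A
  repeated negative atom of the principal typing would stay repeated in that instance.\<close>

lemma principal_negs_uniq:
  assumes "principal T M \<beta>" and "prosodic M"
  shows "uniq (negs (fv M) T \<beta>)"
proof -
  have ty: "typing T M \<beta>" using assms(1) unfolding principal_def by (rule conjunct1)
  with assms(2) obtain P M1 where P: "lnf T P \<beta>" "red\<^sup>*\<^sup>* M M1" "red\<^sup>*\<^sup>* P M1" "prosodic P" "fv P = fv M"
    by (rule long_normal_form)
  \<comment> \<open>\<open>None\<close> tags the atoms of the goal type and \<open>Some x\<close>
    those of the type of \<open>x\<close>; the list is the path within the type.\<close>
  define f where "f o' p = PVar (to_nat (o' :: name option, p :: bool list))" for o' p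
  have f_eq: "f o1 p1 = f o2 p2 \<longleftrightarrow> o1 = o2 \<and> p1 = p2" for o1 o2 p1 p2
    by (simp add: f_def)
  have f: "inj (f o')" for o' by (rule injI) (simp add: f_eq)
  have f': "range (f o1) \<inter> range (f o2) = {}" if "o1 \<noteq> o2" for o1 o2
    using that by (auto simp: f_eq)
  have u: "uniq (pol s (label_ty (f o') \<tau>))" for s o' \<tau>
    by (rule label_ty_uniq[OF f])
  have disj: "set_mset (pol s (label_ty (f o1) \<tau>)) \<inter> set_mset (pol s' (label_ty (f o2) \<tau>')) = {}"
    if "o1 \<noteq> o2" for s s' o1 o2 \<tau> \<tau>'
  proof -
    have "set_mset (pol s (label_ty (f o1) \<tau>)) \<inter> set_mset (pol s' (label_ty (f o2) \<tau>')) \<subseteq>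
        range (f o1) \<inter> range (f o2)"
      by (intro Int_mono label_ty_pol)
    then show ?thesis by (simp add: f'[OF that])
  qed
  define T1 where "T1 x = label_ty (f (Some x)) (shape (T x))" for x
  define \<beta>1 where "\<beta>1 = label_ty (f None) (shape \<beta>)"
  have "uniq (\<Sum>x\<in>fv M. pol True (T1 x))"
    unfolding T1_def by (rule uniq_sum) (simp_all add: u disj)
  moreover have "set_mset (\<Sum>x\<in>fv M. pol True (T1 x)) \<inter> set_mset (pol False \<beta>1) = {}"
    unfolding T1_def \<beta>1_def set_mset_sum[OF finite_fv]
    by (subst Int_commute) (simp add: Int_UN_distrib disj)
  ultimately have uniq: "uniq (negs (fv M) T1 \<beta>1)"
    unfolding negs_def uniq_union by (simp add: \<beta>1_def u)
  have sh: "\<forall>x\<in>fv P. shape (T1 x) = shape (T x)" "shape \<beta>1 = shape \<beta>"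
    by (simp_all add: T1_def \<beta>1_def)
  from long_labelling[THEN conjunct2, THEN mp, OF P(1), THEN mp, OF P(4), THEN spec, THEN spec,
      THEN mp, OF sh(1), THEN mp, OF sh(2)]
  obtain T0 and \<beta>0 :: "pos ty" where
    T0: "typing T0 P \<beta>0" "shape \<beta>0 = shape \<beta>" "pol False \<beta>0 = pol False \<beta>1"
    "\<forall>x\<in>fv P. shape (T0 x) = shape (T x) \<and> pol True (T0 x) = pol True (T1 x)"
    by (elim exE conjE)
  have shT0: "shape (T0 x) = shape (T x)" and polT0: "pol True (T0 x) = pol True (T1 x)"
    if "x \<in> fv M" for x using T0(4) that P(5) by auto
  \<comment> \<open>The retyping of \<open>P\<close> passes by reduction to the common reduct and
    from there by subject expansion to \<open>M\<close>; the shapes of the original typing supply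
    the prosodic typing of \<open>M\<close>.\<close>
  have "typing T0 M \<beta>0"
  proof (rule reds_typing_converse[OF P(2) assms(2)])
    show "typing T0 M1 \<beta>0" using P(3) T0(1) by (rule reds_typing)
    show "typing (\<lambda>x. shape (T x)) M (shape \<beta>0)" unfolding T0(2) by (rule typing_shape[OF ty])
    show "shape (T x) = shape (T0 x)" if "x \<in> fv M" for x using shT0[OF that] by simp
  qed
  with assms(1) T0(2) shT0 have "\<exists>h. \<beta>0 = map_ty h \<beta> \<and> (\<forall>x\<in>fv M. T0 x = map_ty h (T x))"
    unfolding principal_def by blast
  then obtain h where h: "\<beta>0 = map_ty h \<beta>" "\<And>x. x \<in> fv M \<Longrightarrow> T0 x = map_ty h (T x)"
    by blast
  have "(\<Sum>x\<in>fv M. pol True (T1 x)) = (\<Sum>x\<in>fv M. image_mset h (pol True (T x)))"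
    by (rule sum.cong) (simp_all add: polT0[symmetric] h(2) pol_map_ty)
  then have "image_mset h (negs (fv M) T \<beta>) = negs (fv M) T1 \<beta>1"
    unfolding negs_def T0(3)[symmetric] h(1) pol_map_ty
    by (simp add: image_mset_sum')
  with uniq have "uniq (image_mset h (negs (fv M) T \<beta>))" by simp
  then show ?thesis by (rule uniq_image)
qed

text \<open>Both labels have long normal forms of the same type over the same variables, and
  distinct negative atoms make these equal. The conclusion is a zigzag of reductions, rather than an
  equality of normal forms, because \<open>conv\<close> moves along single steps between
  labels.\<close>

lemma coherence:
  assumes "principal T M \<beta>" and "prosodic M" and "typing T M' \<beta>" and "prosodic M'" and "fv M' = fv M"
  obtains P M1 M1' where "red\<^sup>*\<^sup>* M M1" and "red\<^sup>*\<^sup>* P M1" and "red\<^sup>*\<^sup>* P M1'" and "red\<^sup>*\<^sup>* M' M1'"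
    and "prosodic P" and "fv P = fv M" and "typing T P \<beta>"
proof -
  have "typing T M \<beta>" using assms(1) unfolding principal_def by (rule conjunct1)
  with assms(2) obtain P M1 where
    P: "lnf T P \<beta>" "red\<^sup>*\<^sup>* M M1" "red\<^sup>*\<^sup>* P M1" "prosodic P" "fv P = fv M"
    by (rule long_normal_form)
  from assms(4,3) obtain P' M1' where
    P': "lnf T P' \<beta>" "red\<^sup>*\<^sup>* M' M1'" "red\<^sup>*\<^sup>* P' M1'" "prosodic P'" "fv P' = fv M'"
    by (rule long_normal_form)
  have "P = P'"
    using long_unique[THEN conjunct2, rule_format, OF HOL.refl P(1) P'(1) P(4) P'(4) finite_fv[of M]]
      P(5) P'(5) assms(5) principal_negs_uniq[OF assms(1,2)] by auto
  with P P' show thesis by (intro that[of M1 P M1']) (auto intro: lnf_typing)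
qed


section \<open>Semantic equality and the model\<close>

section \<open>Equality of semantic terms\<close>

lemma sem_eq_beta: "lc M \<Longrightarrow> lc N \<Longrightarrow> App (lam x M) N \<approx> subst x N M"
  by (intro sem_eq.beta_eta red.beta)

lemma sem_eq_appL: "t \<approx> u \<Longrightarrow> App t v \<approx> App u v"
  by (intro sem_eq.app sem_eq.refl)

lemma sem_eq_appR: "t \<approx> u \<Longrightarrow> App v t \<approx> App v u"
  by (intro sem_eq.app sem_eq.refl)

lemma sem_eq_eta:
  assumes "t' \<approx> App t (Var x)" and "lc t" and "x \<notin> fv t"
  shows "lam x t' \<approx> t"
proof -
  have "lam x t' \<approx> lam x (App t (Var x))" using assms(1) by (rule sem_eq.abs)
  moreover have "lam x (App t (Var x)) \<approx> t" using assms(2,3) by (intro sem_eq.beta_eta red.eta)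
  ultimately show ?thesis by (rule sem_eq.trans)
qed

lemma msubst_upd_subst:
  assumes "\<And>v. v \<in> fv u \<Longrightarrow> v \<noteq> x \<Longrightarrow> z \<notin> fv (\<sigma> v)"
  shows "subst z s (msubst (\<sigma>(x := Var z)) u) = msubst (\<sigma>(x := s)) u"
  unfolding subst_msubst msubst_msubst
proof (rule msubst_cong)
  fix v assume v: "v \<in> fv u"
  show "msubst (Var(z := s)) ((\<sigma>(x := Var z)) v) = (\<sigma>(x := s)) v"
  proof (cases "v = x")
    case False
    with assms[OF v] show ?thesis by (auto intro!: msubst_id)
  qed simp
qed

lemma msubst_lam_beta:
  assumes "lc t" and "lc s" and "\<And>v. lc (\<sigma> v)"
  shows "App (msubst \<sigma> (lam x t)) s \<approx> msubst (\<sigma>(x := s)) t"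
proof -
  obtain z where z: "z \<notin> (\<Union>v\<in>fv t. fv (\<sigma> v))"
    using fresh_name[of "\<Union>v\<in>fv t. fv (\<sigma> v)"] by auto
  have "msubst \<sigma> (lam x t) = lam z (msubst (\<sigma>(x := Var z)) t)"
    using z by (intro msubst_lam) auto
  moreover have "lc (msubst (\<sigma>(x := Var z)) t)"
    using assms by (intro lc_at_msubst) auto
  then have "App (lam z (msubst (\<sigma>(x := Var z)) t)) s \<approx> subst z s (msubst (\<sigma>(x := Var z)) t)"
    using assms(2) by (rule sem_eq_beta)
  moreover have "subst z s (msubst (\<sigma>(x := Var z)) t) = msubst (\<sigma>(x := s)) t"
    using z by (intro msubst_upd_subst) auto
  ultimately show ?thesis by simp
qed

lemma msubst_lettup_beta:
  assumes "lc u" and "lc a" and "lc b" and "\<And>v. lc (\<sigma> v)" and "x \<noteq> y"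
  shows "LetTup (Tup a b) (msubst \<sigma> (bind_at 1 x (bind_at 0 y u))) \<approx> msubst (\<sigma>(x := a, y := b)) u"
proof -
  let ?S = "(\<Union>v\<in>fv u. fv (\<sigma> v)) \<union> fv a"
  obtain x' where x': "x' \<notin> ?S" using fresh_name[of ?S] by auto
  \<comment> \<open>\<open>y'\<close> also avoids \<open>a\<close>: the substitution for
    \<open>y'\<close> acts after the one for \<open>x'\<close> and would otherwise change
    \<open>a\<close>.\<close>
  obtain y' where y': "y' \<notin> insert x' ?S" using fresh_name[of "insert x' ?S"] by auto
  let ?u = "msubst (\<sigma>(x := Var x', y := Var y')) u"
  have bind: "msubst \<sigma> (bind_at 1 x (bind_at 0 y u)) = bind_at 1 x' (bind_at 0 y' ?u)"
    using msubst_lettup[of u x y x' \<sigma> y' "Bound 0"] x' y' assms(5) by (auto simp: lettup_def)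
  have "lc ?u" using assms by (intro lc_at_msubst) auto
  then have "lettup (Tup a b) x' y' ?u \<approx> subst y' b (subst x' a ?u)"
    using x' y' assms by (intro sem_eq.tup_beta) auto
  also have "subst y' b (subst x' a ?u) = msubst (\<sigma>(x := a, y := b)) u"
    unfolding subst_msubst msubst_msubst
  proof (rule msubst_cong)
    fix v assume v: "v \<in> fv u"
    have a: "msubst (Var(y' := b)) a = a" using y' by (intro msubst_id) auto
    have "msubst (Var(y' := b)) (msubst (Var(x' := a)) (\<sigma> v)) = \<sigma> v"
      unfolding msubst_msubst by (rule msubst_id) (use x' y' v in auto)
    with a show "msubst (\<lambda>z. msubst (Var(y' := b)) ((Var(x' := a)) z)) ((\<sigma>(x := Var x', y := Var y')) v) =
        (\<sigma>(x := a, y := b)) v"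
      using x' y' by (auto simp: msubst_msubst)
  qed
  finally show ?thesis unfolding lettup_def bind .
qed


section \<open>Invariants of first-order proofs\<close>

lemma lc_inst_form: "lc_form_at k (inst_form k a \<phi>) \<longleftrightarrow> lc_form_at (Suc k) \<phi>"
proof (induction \<phi> arbitrary: k)
  case (Pred p ts)
  have "(\<exists>t\<in>set ts. BVar i = inst_tm k a t) \<longleftrightarrow> BVar i \<in> set ts \<and> i \<noteq> k" for i
  proof -
    have "BVar i = inst_tm k a t \<longleftrightarrow> t = BVar i \<and> i \<noteq> k" for t by (cases t) auto
    then show ?thesis by auto
  qed
  then show ?case by (auto simp: image_iff less_Suc_eq)
qed auto

lemma mill_invariant:
  "mill \<Gamma> t \<phi> \<Longrightarrow> uniq (image_mset fst \<Gamma>) \<and> lc t \<and> lc_form_at 0 \<phi> \<and> (\<forall>p\<in>#\<Gamma>. lc_form_at 0 (snd p))"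
proof (induction rule: mill.induct)
  case (forallI \<Gamma> t \<phi> v)
  then show ?case by (auto intro: lc_all)
next
  case (forallE \<Gamma> t \<phi> a)
  then show ?case by (simp add: lc_inst_form)
next
  case (existsI \<Gamma> t a \<phi>)
  then show ?case by (simp add: lc_inst_form)
next
  case (tensorE \<Gamma> t \<phi> \<psi> x y \<Delta> u \<chi>)
  then show ?case by (auto simp: uniq_union intro: lc_lettup)
next
  case (lolliI x \<phi> \<Gamma> t \<psi>)
  then show ?case by (auto intro: lc_lam)
next
  case (existsE \<Gamma> t \<phi> x v \<Delta> u \<chi>)
  then show ?case by (auto simp: uniq_union intro: lc_subst)
qed (auto simp: uniq_union)


section \<open>A model of first-order linear logic\<close>

primrec val :: "(nat \<Rightarrow> pos) \<Rightarrow> pos \<Rightarrow> pos" where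
  "val \<rho> (Pos n) = Pos n"
| "val \<rho> (PVar v) = \<rho> v"

primrec ev :: "(nat \<Rightarrow> pos) \<Rightarrow> (nat \<Rightarrow> pos) \<Rightarrow> tm \<Rightarrow> pos" where
  "ev \<rho> e (Pt p) = val \<rho> p"
| "ev \<rho> e (BVar i) = e i"

lemma val_PVar [simp]: "val PVar = id"
proof
  fix p show "val PVar p = id p" by (cases p) auto
qed

lemma ev_lift [simp]: "ev \<rho> (case_nat a e) (lift_tm c) = ev \<rho> e c"
  by (cases c) auto

text \<open>The shape fixes the length of each part of the list, hence where to split it. So an
  atomic formula, which sees only a list of points, still determines the type.\<close>

lemma flat_inject: "flat \<alpha> = flat \<beta> \<Longrightarrow> shape \<alpha> = shape \<beta> \<Longrightarrow> \<alpha> = \<beta>"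
proof (induction \<alpha> arbitrary: \<beta>)
  case (TAtom a)
  then show ?case by (cases \<beta>) auto
next
  case (Fun \<alpha>1 \<alpha>2)
  have len: "length (flat \<gamma>) = length (flat (shape \<gamma>))" for \<gamma> :: "'a ty"
    by (simp add: flat_map_ty)
  from Fun.prems(2)[symmetric] obtain \<beta>1 \<beta>2 where
    \<beta>: "\<beta> = \<beta>1 \<rightarrow> \<beta>2" "shape \<alpha>1 = shape \<beta>1" "shape \<alpha>2 = shape \<beta>2"
    using shape_Fun[of \<beta>] by auto
  with Fun.prems(1) have "flat \<alpha>2 = flat \<beta>2 \<and> flat \<alpha>1 = flat \<beta>1"
    using len[of \<alpha>2] len[of \<beta>2] by simp
  with Fun.IH \<beta> show ?case by blast
qed

text \<open>\<open>T\<close> types all names at once, so that worlds need not carry types.\<close>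

locale model =
  fixes sh :: "'b \<Rightarrow> unit ty" and T :: "name \<Rightarrow> pos ty"
  assumes names: "infinite {x. T x = \<alpha>}"
begin

text \<open>The label is existentially quantified and only its type is kept, since first-order
  formulas know only types. The semantic term counts up to \<open>\<approx>\<close>, so that
  meanings are closed under beta and eta.\<close>

definition derivable :: "('a, 'b) hyp multiset \<Rightarrow> trm \<Rightarrow> ('a, 'b) hybrid \<Rightarrow> pos ty \<Rightarrow> bool" where
  "derivable \<Delta> t A \<alpha> \<longleftrightarrow> lc t \<and> (\<forall>h\<in>#\<Delta>. shape (T (hname h)) = hyp_pros sh h) \<and>
     (\<exists>M t'. t' \<approx> t \<and> hyb sh \<Delta> M t' A \<and> typing T M \<alpha>)"

text \<open>Lists of points come from \<open>flat\<close>: \<open>[a, b]\<close> stands for the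
  string type \<open>TAtom b \<rightarrow> TAtom a\<close>, and for the other atoms the type is
  recovered by means of \<open>sh q\<close>.\<close>

definition atom :: "'a + 'b \<Rightarrow> pos list \<Rightarrow> ('a, 'b) hyp multiset \<Rightarrow> trm \<Rightarrow> bool" where
  "atom c ps \<Delta> t \<longleftrightarrow> (case c of
     Inl p \<Rightarrow> (\<exists>a b. ps = [a, b] \<and> derivable \<Delta> t (Lambek (LAtom p)) (TAtom b \<rightarrow> TAtom a))
   | Inr q \<Rightarrow> (\<exists>\<alpha>. ps = flat \<alpha> \<and> shape \<alpha> = sh q \<and> derivable \<Delta> t (HAtom q) \<alpha>))"

text \<open>Tensor and exists are interpreted through their elimination rules with atomic conclusion.\<close>

definition cl ::
  "(('a, 'b) hyp multiset \<Rightarrow> trm \<Rightarrow> bool) \<Rightarrow> ('a, 'b) hyp multiset \<Rightarrow> trm \<Rightarrow> bool" where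
  "cl Y \<Delta> t \<longleftrightarrow> lc t \<and> (\<forall>c ps \<Delta>' k. lc k \<longrightarrow> hnames \<Delta> \<inter> hnames \<Delta>' = {} \<longrightarrow>
     (\<forall>\<Delta>1 s. Y \<Delta>1 s \<longrightarrow> hnames \<Delta>1 \<inter> hnames \<Delta>' = {} \<longrightarrow> atom c ps (\<Delta>1 + \<Delta>') (App k s)) \<longrightarrow>
     atom c ps (\<Delta> + \<Delta>') (App k t))"

primrec sat :: "('a + 'b) form \<Rightarrow> (nat \<Rightarrow> pos) \<Rightarrow> (nat \<Rightarrow> pos) \<Rightarrow>
    ('a, 'b) hyp multiset \<Rightarrow> trm \<Rightarrow> bool" where
  "sat (Pred c ts) \<rho> e = atom c (map (ev \<rho> e) ts)"
| "sat (\<phi> \<multimap> \<psi>) \<rho> e = (\<lambda>\<Delta> t. lc t \<and> (\<forall>\<Delta>' u. sat \<phi> \<rho> e \<Delta>' u \<longrightarrow> hnames \<Delta> \<inter> hnames \<Delta>' = {} \<longrightarrow>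
     sat \<psi> \<rho> e (\<Delta> + \<Delta>') (App t u)))"
| "sat (\<phi> \<otimes> \<psi>) \<rho> e = cl (\<lambda>\<Delta> t. \<exists>\<Delta>1 \<Delta>2 a b. \<Delta> = \<Delta>1 + \<Delta>2 \<and> t = Tup a b \<and>
     hnames \<Delta>1 \<inter> hnames \<Delta>2 = {} \<and> sat \<phi> \<rho> e \<Delta>1 a \<and> sat \<psi> \<rho> e \<Delta>2 b)"
| "sat (Forall \<phi>) \<rho> e = (\<lambda>\<Delta> t. \<forall>a. sat \<phi> \<rho> (case_nat a e) \<Delta> t)"
| "sat (Exists \<phi>) \<rho> e = cl (\<lambda>\<Delta> t. \<exists>a. sat \<phi> \<rho> (case_nat a e) \<Delta> t)"

lemma derivable_sem_eq: "derivable \<Delta> t A \<alpha> \<Longrightarrow> t \<approx> u \<Longrightarrow> lc u \<Longrightarrow> derivable \<Delta> u A \<alpha>"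
  unfolding derivable_def by (blast intro: sem_eq.trans)

lemma atom_sem_eq: "atom c ps \<Delta> t \<Longrightarrow> t \<approx> u \<Longrightarrow> lc u \<Longrightarrow> atom c ps \<Delta> u"
  unfolding atom_def by (cases c) (auto intro: derivable_sem_eq)

lemma atom_lc: "atom c ps \<Delta> t \<Longrightarrow> lc t"
  unfolding atom_def derivable_def by (cases c) auto

lemma cl_lc: "cl Y \<Delta> t \<Longrightarrow> lc t"
  by (simp add: cl_def)

lemma cl_atom:
  assumes "cl Y \<Delta> t" and "lc k" and "hnames \<Delta> \<inter> hnames \<Delta>' = {}"
    and "\<And>\<Delta>1 s. Y \<Delta>1 s \<Longrightarrow> hnames \<Delta>1 \<inter> hnames \<Delta>' = {} \<Longrightarrow> atom c ps (\<Delta>1 + \<Delta>') (App k s)"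
  shows "atom c ps (\<Delta> + \<Delta>') (App k t)"
  by (rule assms(1)[unfolded cl_def, THEN conjunct2, rule_format, OF assms(2,3)]) (rule assms(4))

lemma cl_sem_eq:
  assumes "cl Y \<Delta> t" and "t \<approx> u" and "lc u"
  shows "cl Y \<Delta> u"
  unfolding cl_def
proof (intro conjI allI impI)
  fix c ps \<Delta>' k
  assume k: "lc k" "hnames \<Delta> \<inter> hnames \<Delta>' = {}"
    "\<forall>\<Delta>1 s. Y \<Delta>1 s \<longrightarrow> hnames \<Delta>1 \<inter> hnames \<Delta>' = {} \<longrightarrow> atom c ps (\<Delta>1 + \<Delta>') (App k s)"
  then have "atom c ps (\<Delta> + \<Delta>') (App k t)" by (intro cl_atom[OF assms(1)]) simp_all
  then show "atom c ps (\<Delta> + \<Delta>') (App k u)"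
    using sem_eq_appR[OF assms(2)] by (rule atom_sem_eq) (use k assms in simp)
qed (rule assms(3))

lemma sat_lc: "sat \<phi> \<rho> e \<Delta> t \<Longrightarrow> lc t"
proof (induction \<phi> arbitrary: e)
  case (Pred c ts)
  then show ?case by (auto intro: atom_lc)
qed (auto simp: cl_def)

lemma sat_sem_eq: "sat \<phi> \<rho> e \<Delta> t \<Longrightarrow> t \<approx> u \<Longrightarrow> lc u \<Longrightarrow> sat \<phi> \<rho> e \<Delta> u"
proof (induction \<phi> arbitrary: e \<Delta> t u)
  case (Pred c ts)
  then show ?case by (auto intro: atom_sem_eq)
next
  case (Lolli \<phi> \<psi>)
  have "sat \<psi> \<rho> e (\<Delta> + \<Delta>') (App u v)"
    if "sat \<phi> \<rho> e \<Delta>' v" "hnames \<Delta> \<inter> hnames \<Delta>' = {}" for \<Delta>' v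
    using Lolli.prems that sat_lc[OF that(1)]
    by (intro Lolli.IH(2)[OF _ sem_eq_appL[OF Lolli.prems(2)]]) auto
  then show ?case using Lolli.prems by auto
next
  case (Tensor \<phi> \<psi>)
  then show ?case by (auto intro: cl_sem_eq)
next
  case (Forall \<phi>)
  have "sat \<phi> \<rho> (case_nat a e) \<Delta> u" for a
    by (rule Forall.IH[OF _ Forall.prems(2,3)]) (use Forall.prems(1) in simp)
  then show ?case by simp
next
  case (Exists \<phi>)
  then show ?case by (auto intro: cl_sem_eq)
qed

lemma cl_unit: "Y \<Delta> t \<Longrightarrow> lc t \<Longrightarrow> cl Y \<Delta> t"
  unfolding cl_def by (intro conjI allI impI) simp_all

lemma compose_beta:
  assumes "lc k" and "lc k2" and "lc s" and "z \<notin> fv k \<union> fv k2"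
  shows "App (lam z (App k2 (App k (Var z)))) s \<approx> App k2 (App k s)"
  using sem_eq_beta[of "App k2 (App k (Var z))" s z] assms by (simp add: subst_fresh)

text \<open>The bind of a continuation monad: the continuation for \<open>Y'\<close> is composed
  with \<open>k\<close>, and the resources of both are added.\<close>

lemma cl_bind:
  assumes Y: "cl Y \<Delta> t" and k: "lc k" and disj: "hnames \<Delta> \<inter> hnames \<Delta>' = {}"
    and step: "\<And>\<Delta>1 s. Y \<Delta>1 s \<Longrightarrow> hnames \<Delta>1 \<inter> hnames \<Delta>' = {} \<Longrightarrow> cl Y' (\<Delta>1 + \<Delta>') (App k s)"
  shows "cl Y' (\<Delta> + \<Delta>') (App k t)"
  unfolding cl_def
proof (intro conjI allI impI)
  have t: "lc t" using Y by (rule cl_lc)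
  with k show "lc (App k t)" by simp
  fix c ps \<Delta>'' k2
  assume k2: "lc k2" and disj2: "hnames (\<Delta> + \<Delta>') \<inter> hnames \<Delta>'' = {}"
    and *: "\<forall>\<Delta>1 s. Y' \<Delta>1 s \<longrightarrow> hnames \<Delta>1 \<inter> hnames \<Delta>'' = {} \<longrightarrow> atom c ps (\<Delta>1 + \<Delta>'') (App k2 s)"
  obtain z where z: "z \<notin> fv k \<union> fv k2" using fresh_name[of "fv k \<union> fv k2"] by auto
  let ?k = "lam z (App k2 (App k (Var z)))"
  have lck: "lc ?k" using k k2 by (intro lc_lam) simp
  have atom: "atom c ps (\<Delta>1 + (\<Delta>' + \<Delta>'')) (App ?k s)"
    if s: "Y \<Delta>1 s" "hnames \<Delta>1 \<inter> hnames (\<Delta>' + \<Delta>'') = {}" for \<Delta>1 s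
  proof -
    have cl: "cl Y' (\<Delta>1 + \<Delta>') (App k s)" using s by (intro step) auto
    then have lc: "lc s" by (auto dest: cl_lc)
    have "hnames (\<Delta>1 + \<Delta>') \<inter> hnames \<Delta>'' = {}" using s(2) disj2 by auto
    then have "atom c ps (\<Delta>1 + \<Delta>' + \<Delta>'') (App k2 (App k s))"
      using * by (intro cl_atom[OF cl k2]) simp_all
    from atom_sem_eq[OF this sem_eq.sym[OF compose_beta[OF k k2 lc z]]] lck lc
    show ?thesis by (simp add: add.assoc)
  qed
  have "hnames \<Delta> \<inter> hnames (\<Delta>' + \<Delta>'') = {}" using disj disj2 by auto
  then have "atom c ps (\<Delta> + (\<Delta>' + \<Delta>'')) (App ?k t)"
    by (rule cl_atom[OF Y lck]) (rule atom)
  then show "atom c ps (\<Delta> + \<Delta>' + \<Delta>'') (App k2 (App k t))"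
    using atom_sem_eq[OF _ compose_beta[OF k k2 t z]] k k2 t by (simp add: add.assoc)
qed

text \<open>The closure promises atomic conclusions only; induction on \<open>\<phi>\<close> extends
  it to all formulas. For an implication the argument is absorbed into the continuation, a universal
  is treated instance by instance, and a conclusion that is itself a closure is handled by
  \<open>cl_bind\<close>.\<close>

lemma cl_elim:
  assumes "cl Y \<Delta> t" and "lc k" and "hnames \<Delta> \<inter> hnames \<Delta>' = {}"
    and "\<And>\<Delta>1 s. Y \<Delta>1 s \<Longrightarrow> hnames \<Delta>1 \<inter> hnames \<Delta>' = {} \<Longrightarrow> sat \<phi> \<rho> e (\<Delta>1 + \<Delta>') (App k s)"
  shows "sat \<phi> \<rho> e (\<Delta> + \<Delta>') (App k t)"
  using assms(2-)
proof (induction \<phi> arbitrary: e k \<Delta>')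
  case (Pred c ts)
  then show ?case unfolding sat.simps by (intro cl_atom[OF assms(1)])
next
  case (Lolli \<phi> \<psi>)
  have t: "lc t" using assms(1) by (rule cl_lc)
  have "sat \<psi> \<rho> e (\<Delta> + \<Delta>' + \<Delta>'') (App (App k t) v)"
    if v: "sat \<phi> \<rho> e \<Delta>'' v" "hnames (\<Delta> + \<Delta>') \<inter> hnames \<Delta>'' = {}" for \<Delta>'' v
  proof -
    have lcv: "lc v" using v(1) by (rule sat_lc)
    obtain z where z: "z \<notin> fv k \<union> fv v" using fresh_name[of "fv k \<union> fv v"] by auto
    let ?k = "lam z (App (App k (Var z)) v)"
    have k: "lc ?k" using Lolli.prems(1) lcv by (intro lc_lam) simp
    have beta: "App ?k s \<approx> App (App k s) v" if "lc s" for s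
      using sem_eq_beta[of "App (App k (Var z)) v" s z] that Lolli.prems(1) lcv z
      by (simp add: subst_fresh)
    have "sat \<psi> \<rho> e (\<Delta> + (\<Delta>' + \<Delta>'')) (App ?k t)"
    proof (rule Lolli.IH(2)[OF k])
      show "hnames \<Delta> \<inter> hnames (\<Delta>' + \<Delta>'') = {}" using Lolli.prems(2) v(2) by auto
      fix \<Delta>1 s
      assume s: "Y \<Delta>1 s" "hnames \<Delta>1 \<inter> hnames (\<Delta>' + \<Delta>'') = {}"
      then have *: "sat (\<phi> \<multimap> \<psi>) \<rho> e (\<Delta>1 + \<Delta>') (App k s)" by (intro Lolli.prems(3)) auto
      then have lcs: "lc s" by (auto dest: sat_lc)
      have "hnames (\<Delta>1 + \<Delta>') \<inter> hnames \<Delta>'' = {}" using s(2) v(2) by auto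
      with * v(1) have "sat \<psi> \<rho> e (\<Delta>1 + \<Delta>' + \<Delta>'') (App (App k s) v)" by simp
      from sat_sem_eq[OF this sem_eq.sym[OF beta[OF lcs]]] k lcs
      show "sat \<psi> \<rho> e (\<Delta>1 + (\<Delta>' + \<Delta>'')) (App ?k s)" by (simp add: add.assoc)
    qed
    from sat_sem_eq[OF this beta[OF t]] Lolli.prems(1) t lcv show ?thesis by (simp add: add.assoc)
  qed
  then show ?case using Lolli.prems(1) t by simp
next
  case (Tensor \<phi> \<psi>)
  then show ?case unfolding sat.simps by (intro cl_bind[OF assms(1)])
next
  case (Forall \<phi>)
  have "sat \<phi> \<rho> (case_nat a e) (\<Delta> + \<Delta>') (App k t)" for a
    by (rule Forall.IH[OF Forall.prems(1,2)]) (use Forall.prems(3) in simp)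
  then show ?case by simp
next
  case (Exists \<phi>)
  then show ?case unfolding sat.simps by (intro cl_bind[OF assms(1)])
qed

lemma sat_cong:
  "lc_form_at k \<phi> \<Longrightarrow> (\<And>v. v \<in> fv_form \<phi> \<Longrightarrow> \<rho> v = \<rho>' v) \<Longrightarrow> (\<And>i. i < k \<Longrightarrow> e i = e' i) \<Longrightarrow>
    sat \<phi> \<rho> e = sat \<phi> \<rho>' e'"
proof (induction \<phi> arbitrary: k e e')
  case (Pred c ts)
  have "ev \<rho> e t = ev \<rho>' e' t" if "t \<in> set ts" for t
  proof (cases t)
    case (Pt p)
    with that Pred.prems(2) show ?thesis by (cases p) force+
  next
    case (BVar i)
    with that Pred.prems(1,3) show ?thesis by auto
  qed
  then have "map (ev \<rho> e) ts = map (ev \<rho>' e') ts" by simp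
  then show ?case by (simp only: sat.simps)
next
  case (Lolli \<phi> \<psi>)
  have "sat \<phi> \<rho> e = sat \<phi> \<rho>' e'" "sat \<psi> \<rho> e = sat \<psi> \<rho>' e'"
    using Lolli.prems by (auto intro!: Lolli.IH)
  then show ?case by simp
next
  case (Tensor \<phi> \<psi>)
  have "sat \<phi> \<rho> e = sat \<phi> \<rho>' e'" "sat \<psi> \<rho> e = sat \<psi> \<rho>' e'"
    using Tensor.prems by (auto intro!: Tensor.IH)
  then show ?case by simp
next
  case (Forall \<phi>)
  have "sat \<phi> \<rho> (case_nat a e) = sat \<phi> \<rho>' (case_nat a e')" for a
    using Forall.prems by (intro Forall.IH[of "Suc k"]) (auto split: nat.splits)
  then show ?case by simp
next
  case (Exists \<phi>)
  have "sat \<phi> \<rho> (case_nat a e) = sat \<phi> \<rho>' (case_nat a e')" for a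
    using Exists.prems by (intro Exists.IH[of "Suc k"]) (auto split: nat.splits)
  then show ?case by simp
qed

lemma sat_bind: "lc_form_at k \<phi> \<Longrightarrow> sat (bind_form k v \<phi>) \<rho> e = sat \<phi> (\<rho>(v := e k)) e"
proof (induction \<phi> arbitrary: k e)
  case (Pred c ts)
  have "ev \<rho> e (bind_tm k v t) = ev (\<rho>(v := e k)) e t" for t
  proof (cases t)
    case (Pt p)
    then show ?thesis by (cases p) auto
  qed simp
  then have "map (ev \<rho> e) (map (bind_tm k v) ts) = map (ev (\<rho>(v := e k)) e) ts" by simp
  then show ?case unfolding bind_form.simps sat.simps by (rule arg_cong)
qed simp_all

lemma sat_inst: "sat (inst_form k a \<phi>) \<rho> e = sat \<phi> \<rho> (e(k := val \<rho> a))"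
proof (induction \<phi> arbitrary: k e)
  case (Pred c ts)
  have "ev \<rho> e (inst_tm k a t) = ev \<rho> (e(k := val \<rho> a)) t" for t
    by (cases t) auto
  then have "map (ev \<rho> e) (map (inst_tm k a) ts) = map (ev \<rho> (e(k := val \<rho> a))) ts" by simp
  then show ?case unfolding inst_form.simps sat.simps by (rule arg_cong)
next
  case (Forall \<phi>)
  have "case_nat b (e(k := val \<rho> a)) = (case_nat b e)(Suc k := val \<rho> a)" for b
    by (auto split: nat.splits)
  then show ?case by (simp only: inst_form.simps sat.simps Forall.IH)
next
  case (Exists \<phi>)
  have "case_nat b (e(k := val \<rho> a)) = (case_nat b e)(Suc k := val \<rho> a)" for b
    by (auto split: nat.splits)
  then show ?case by (simp only: inst_form.simps sat.simps Exists.IH)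
qed simp_all

text \<open>\<open>inst_form\<close> leaves larger indices in place, while \<open>case_nat\<close>
  shifts the environment. The two agree because \<open>\<phi>\<close> has no dangling index other
  than \<open>0\<close>.\<close>

lemma sat_inst_0:
  assumes "lc_form_at 1 \<phi>"
  shows "sat (inst_form 0 a \<phi>) \<rho> e = sat \<phi> \<rho> (case_nat (val \<rho> a) e)"
proof -
  have "sat \<phi> \<rho> (e(0 := val \<rho> a)) = sat \<phi> \<rho> (case_nat (val \<rho> a) e)"
    by (rule sat_cong[OF assms]) auto
  then show ?thesis by (simp add: sat_inst)
qed

lemma sat_all:
  assumes "lc_form_at 0 \<phi>"
  shows "sat (all v \<phi>) \<rho> e \<Delta> t \<longleftrightarrow> (\<forall>a. sat \<phi> (\<rho>(v := a)) e \<Delta> t)"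
proof -
  have "sat (bind_form 0 v \<phi>) \<rho> (case_nat a e) = sat \<phi> (\<rho>(v := a)) e" for a
    using sat_bind[OF assms, of v \<rho> "case_nat a e"]
      sat_cong[OF assms, of "\<rho>(v := a)" "\<rho>(v := a)" "case_nat a e" e] by simp
  then show ?thesis by (simp add: all_def)
qed

lemma sat_foldr_all:
  assumes "lc_form_at 0 \<phi>"
  shows "sat (foldr all vs \<phi>) \<rho> e \<Delta> t \<longleftrightarrow> (\<forall>\<rho>'. (\<forall>v. v \<notin> set vs \<longrightarrow> \<rho>' v = \<rho> v) \<longrightarrow> sat \<phi> \<rho>' e \<Delta> t)"
proof (induction vs arbitrary: \<rho>)
  case Nil
  have "\<rho>' = \<rho>" if "\<forall>v. \<rho>' v = \<rho> v" for \<rho>' using that by auto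
  then show ?case by auto
next
  case (Cons v vs)
  have "sat (foldr all (v # vs) \<phi>) \<rho> e \<Delta> t \<longleftrightarrow>
      (\<forall>a \<rho>'. (\<forall>w. w \<notin> set vs \<longrightarrow> \<rho>' w = (\<rho>(v := a)) w) \<longrightarrow> sat \<phi> \<rho>' e \<Delta> t)"
    by (simp add: sat_all lc_foldr_all assms Cons.IH)
  also have "\<dots> \<longleftrightarrow> (\<forall>\<rho>'. (\<forall>w. w \<notin> set (v # vs) \<longrightarrow> \<rho>' w = \<rho> w) \<longrightarrow> sat \<phi> \<rho>' e \<Delta> t)"
  proof (intro iffI allI impI)
    fix \<rho>'
    assume *: "\<forall>a \<rho>'. (\<forall>w. w \<notin> set vs \<longrightarrow> \<rho>' w = (\<rho>(v := a)) w) \<longrightarrow> sat \<phi> \<rho>' e \<Delta> t"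
      and "\<forall>w. w \<notin> set (v # vs) \<longrightarrow> \<rho>' w = \<rho> w"
    then have "\<forall>w. w \<notin> set vs \<longrightarrow> \<rho>' w = (\<rho>(v := \<rho>' v)) w" by simp
    with * show "sat \<phi> \<rho>' e \<Delta> t" by blast
  next
    fix a \<rho>'
    assume *: "\<forall>\<rho>'. (\<forall>w. w \<notin> set (v # vs) \<longrightarrow> \<rho>' w = \<rho> w) \<longrightarrow> sat \<phi> \<rho>' e \<Delta> t"
      and "\<forall>w. w \<notin> set vs \<longrightarrow> \<rho>' w = (\<rho>(v := a)) w"
    then have "\<forall>w. w \<notin> set (v # vs) \<longrightarrow> \<rho>' w = \<rho> w" by simp
    with * show "sat \<phi> \<rho>' e \<Delta> t" by blast
  qed
  finally show ?case .
qed

lemma derivableI: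
  "lc t \<Longrightarrow> \<forall>h\<in>#\<Delta>. shape (T (hname h)) = hyp_pros sh h \<Longrightarrow> t' \<approx> t \<Longrightarrow> hyb sh \<Delta> M t' A \<Longrightarrow>
    typing T M \<alpha> \<Longrightarrow> derivable \<Delta> t A \<alpha>"
  unfolding derivable_def by (intro conjI exI)

lemma derivable_ax:
  "shape (T x) = pros sh A \<Longrightarrow> derivable {#Hyp x A#} (Var x) A (T x)"
  by (rule derivableI[OF _ _ sem_eq.refl hyb.ax typing.var]) simp_all

lemma fresh_typed: "finite S \<Longrightarrow> \<exists>x. x \<notin> S \<and> T x = \<alpha>"
  using infinite_super[OF _ names[of \<alpha>], of S] by blast

text \<open>The new name serves as prosodic label and as semantic variable at once, so it has to
  avoid the world and the term.\<close>

lemma derivable_fresh: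
  assumes t: "lc t" and shape: "shape \<beta> = pros sh B"
  obtains x where "x \<notin> fv t" and "x \<notin> hnames \<Delta>" and "T x = \<beta>"
    and "derivable {#Hyp x B#} (Var x) B \<beta>"
proof -
  have "finite (fv t \<union> hnames \<Delta>)" by simp
  from fresh_typed[OF this, of \<beta>] obtain x where "x \<notin> fv t \<union> hnames \<Delta>" "T x = \<beta>"
    by (elim exE conjE)
  moreover from this(2) have "derivable {#Hyp x B#} (Var x) B \<beta>"
    using derivable_ax[of x B] shape by simp
  ultimately show thesis by (intro that) simp_all
qed

lemma ex_fresh_pos: "\<exists>a :: pos. a \<notin> S" if "finite S" for S
proof -
  have "inj PVar" by (rule injI) simp
  then have "infinite (range PVar)" using finite_image_iff[of PVar UNIV] by simp
  then have "infinite (UNIV :: pos set)" by (rule contrapos_nn) (rule finite_subset[OF subset_UNIV])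
  then show ?thesis using that by (rule ex_new_if_finite)
qed

lemma derivable_overE:
  assumes "derivable \<Delta> t (Lambek (Over A B)) (TAtom d \<rightarrow> TAtom c)"
    and "derivable \<Delta>' u (Lambek B) (TAtom a \<rightarrow> TAtom d)" and "hnames \<Delta> \<inter> hnames \<Delta>' = {}"
  shows "derivable (\<Delta> + \<Delta>') (App t u) (Lambek A) (TAtom a \<rightarrow> TAtom c)"
proof -
  from assms(1) obtain M t' where M: "lc t" "\<forall>h\<in>#\<Delta>. shape (T (hname h)) = hyp_pros sh h"
    "t' \<approx> t" "hyb sh \<Delta> M t' (Lambek (Over A B))" "typing T M (TAtom d \<rightarrow> TAtom c)"
    unfolding derivable_def by (elim exE conjE)
  from assms(2) obtain N u' where N: "lc u" "\<forall>h\<in>#\<Delta>'. shape (T (hname h)) = hyp_pros sh h"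
    "u' \<approx> u" "hyb sh \<Delta>' N u' (Lambek B)" "typing T N (TAtom a \<rightarrow> TAtom d)"
    unfolding derivable_def by (elim exE conjE)
  have lc: "lc M" "lc N" using typing_lc[OF M(5)] typing_lc[OF N(5)] by simp_all
  have "hyb sh (\<Delta> + \<Delta>') (M \<oplus> N) (App t' u') (Lambek A)"
    using M(4) N(4) assms(3) by (rule hyb.overE)
  moreover have "typing T (M \<oplus> N) (TAtom a \<rightarrow> TAtom c)"
    unfolding typing_cat[OF lc] using M(5) N(5) by blast
  moreover have "App t' u' \<approx> App t u" using M(3) N(3) by (rule sem_eq.app)
  moreover have "\<forall>h\<in>#\<Delta> + \<Delta>'. shape (T (hname h)) = hyp_pros sh h"
    using M(2) N(2) by (simp add: ball_Un)
  moreover have "lc (App t u)" using M(1) N(1) by simp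
  ultimately show ?thesis by (intro derivableI)
qed

lemma derivable_underE:
  assumes "derivable \<Delta> t (Lambek (Under B A)) (TAtom d \<rightarrow> TAtom c)"
    and "derivable \<Delta>' u (Lambek B) (TAtom c \<rightarrow> TAtom a)" and "hnames \<Delta> \<inter> hnames \<Delta>' = {}"
  shows "derivable (\<Delta> + \<Delta>') (App t u) (Lambek A) (TAtom d \<rightarrow> TAtom a)"
proof -
  from assms(1) obtain M t' where M: "lc t" "\<forall>h\<in>#\<Delta>. shape (T (hname h)) = hyp_pros sh h"
    "t' \<approx> t" "hyb sh \<Delta> M t' (Lambek (Under B A))" "typing T M (TAtom d \<rightarrow> TAtom c)"
    unfolding derivable_def by (elim exE conjE)
  from assms(2) obtain N u' where N: "lc u" "\<forall>h\<in>#\<Delta>'. shape (T (hname h)) = hyp_pros sh h"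
    "u' \<approx> u" "hyb sh \<Delta>' N u' (Lambek B)" "typing T N (TAtom c \<rightarrow> TAtom a)"
    unfolding derivable_def by (elim exE conjE)
  have lc: "lc N" "lc M" using typing_lc[OF M(5)] typing_lc[OF N(5)] by simp_all
  have "hnames \<Delta>' \<inter> hnames \<Delta> = {}" using assms(3) by blast
  with N(4) M(4) have "hyb sh (\<Delta>' + \<Delta>) (N \<oplus> M) (App t' u') (Lambek A)" by (rule hyb.underE)
  then have "hyb sh (\<Delta> + \<Delta>') (N \<oplus> M) (App t' u') (Lambek A)" by (simp add: add.commute)
  moreover have "typing T (N \<oplus> M) (TAtom d \<rightarrow> TAtom a)"
    unfolding typing_cat[OF lc] using M(5) N(5) by blast
  moreover have "App t' u' \<approx> App t u" using M(3) N(3) by (rule sem_eq.app)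
  moreover have "\<forall>h\<in>#\<Delta> + \<Delta>'. shape (T (hname h)) = hyp_pros sh h"
    using M(2) N(2) by (simp add: ball_Un)
  moreover have "lc (App t u)" using M(1) N(1) by simp
  ultimately show ?thesis by (intro derivableI)
qed

lemma derivable_barE:
  assumes "derivable \<Delta> t (Bar A B) (\<beta> \<rightarrow> \<alpha>)" and "derivable \<Delta>' u B \<beta>"
    and "hnames \<Delta> \<inter> hnames \<Delta>' = {}"
  shows "derivable (\<Delta> + \<Delta>') (App t u) A \<alpha>"
proof -
  from assms(1) obtain M t' where M: "lc t" "\<forall>h\<in>#\<Delta>. shape (T (hname h)) = hyp_pros sh h"
    "t' \<approx> t" "hyb sh \<Delta> M t' (Bar A B)" "typing T M (\<beta> \<rightarrow> \<alpha>)"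
    unfolding derivable_def by (elim exE conjE)
  from assms(2) obtain N u' where N: "lc u" "\<forall>h\<in>#\<Delta>'. shape (T (hname h)) = hyp_pros sh h"
    "u' \<approx> u" "hyb sh \<Delta>' N u' B" "typing T N \<beta>"
    unfolding derivable_def by (elim exE conjE)
  have "hyb sh (\<Delta> + \<Delta>') (App M N) (App t' u') A"
    using M(4) N(4) assms(3) by (rule hyb.barE)
  moreover have "typing T (App M N) \<alpha>" using M(5) N(5) by (rule typing.app)
  moreover have "App t' u' \<approx> App t u" using M(3) N(3) by (rule sem_eq.app)
  moreover have "\<forall>h\<in>#\<Delta> + \<Delta>'. shape (T (hname h)) = hyp_pros sh h"
    using M(2) N(2) by (simp add: ball_Un)
  moreover have "lc (App t u)" using M(1) N(1) by simp
  ultimately show ?thesis by (intro derivableI)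
qed

text \<open>Since \<open>a\<close> occurs nowhere in the types of \<open>\<Delta>\<close>, the label
  is convertible to a concatenation ending in \<open>x\<close>, which is the form that
  \<open>overI\<close> discharges. Eta turns the abstraction of \<open>t'\<close> back into
  \<open>t\<close>.\<close>

lemma derivable_overI:
  assumes "derivable (add_mset (Hyp x (Lambek B)) \<Delta>) (App t (Var x)) (Lambek A) (TAtom a \<rightarrow> TAtom c)"
    and x: "x \<notin> fv t" "x \<notin> hnames \<Delta>" "T x = TAtom a \<rightarrow> TAtom d"
    and a: "a \<noteq> c" "a \<noteq> d" "\<And>y. y \<in> hnames \<Delta> \<Longrightarrow> a \<notin> set_ty (T y)"
  shows "derivable \<Delta> t (Lambek (Over A B)) (TAtom d \<rightarrow> TAtom c)"
proof -
  let ?\<Delta> = "add_mset (Hyp x (Lambek B)) \<Delta>"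
  from assms(1) obtain M t' where M: "lc (App t (Var x))"
    "\<forall>h\<in>#?\<Delta>. shape (T (hname h)) = hyp_pros sh h"
    "t' \<approx> App t (Var x)" "hyb sh ?\<Delta> M t' (Lambek A)" "typing T M (TAtom a \<rightarrow> TAtom c)"
    unfolding derivable_def by (elim exE conjE)
  have pros: "prosodic M"
    using hyb_label[OF M(4)] unfolding is_label_def by (rule conjunct1)
  have "fv M = hnames ?\<Delta>"
    using hyb_label[OF M(4)] unfolding is_label_def by (rule conjunct2[THEN conjunct1])
  then have fv: "fv M = insert x (hnames \<Delta>)" by simp
  have x_fv: "x \<in> fv M" using fv by simp
  have other: "a \<notin> set_ty (T y)" if "y \<in> fv M" "y \<noteq> x" for y
  proof (rule a(3))
    show "y \<in> hnames \<Delta>" using that unfolding fv by simp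
  qed
  obtain M' M1 where
    M': "red\<^sup>*\<^sup>* M M1" "red\<^sup>*\<^sup>* (M' \<oplus> Var x) M1" "prosodic M'" "fv M' = fv M - {x}"
    "typing T M' (TAtom d \<rightarrow> TAtom c)"
    by (rule over_label[OF pros x_fv M(5) x(3) a(1,2) other])
  have fvM': "fv M' = hnames \<Delta>" unfolding M'(4) fv using x(2) by (rule Diff_insert_absorb)
  have lc: "lc M'" "lc (Var x)" using M'(3) by (simp_all add: prosodic_lc)
  have "is_label sh ?\<Delta> (M' \<oplus> Var x) (Lambek A)"
  proof (rule is_labelI)
    show "prosodic (M' \<oplus> Var x)"
      using M'(3) fvM' x(2) by (simp add: prosodic_cat prosodic.var)
    show "typing T (M' \<oplus> Var x) (TAtom a \<rightarrow> TAtom c)"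
      unfolding typing_cat[OF lc] using M'(5) typing.var[of T x, unfolded x(3)] by blast
    show "shape (T (hname h)) = hyp_pros sh h" if "h \<in># ?\<Delta>" for h using M(2) that by blast
  qed (simp_all add: fvM')
  from hyb_expand[OF M'(2) this hyb_reds[OF M'(1) M(4)]] have "hyb sh ?\<Delta> (M' \<oplus> Var x) t' (Lambek A)" .
  then have "hyb sh \<Delta> M' (lam x t') (Lambek (Over A B))"
    using fvM' x(2) by (intro hyb.overI) simp_all
  moreover have "lam x t' \<approx> t" using M(1,3) x(1) by (intro sem_eq_eta) simp_all
  moreover have "\<forall>h\<in>#\<Delta>. shape (T (hname h)) = hyp_pros sh h" using M(2) by simp
  ultimately show ?thesis using M(1) M'(5) by (intro derivableI) simp_all
qed

lemma derivable_underI: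
  assumes "derivable (add_mset (Hyp x (Lambek B)) \<Delta>) (App t (Var x)) (Lambek A) (TAtom d \<rightarrow> TAtom a)"
    and x: "x \<notin> fv t" "x \<notin> hnames \<Delta>" "T x = TAtom c \<rightarrow> TAtom a"
    and a: "a \<noteq> d" "\<And>y. y \<in> hnames \<Delta> \<Longrightarrow> a \<notin> set_ty (T y)"
  shows "derivable \<Delta> t (Lambek (Under B A)) (TAtom d \<rightarrow> TAtom c)"
proof -
  let ?\<Delta> = "add_mset (Hyp x (Lambek B)) \<Delta>"
  from assms(1) obtain M t' where M: "lc (App t (Var x))"
    "\<forall>h\<in>#?\<Delta>. shape (T (hname h)) = hyp_pros sh h"
    "t' \<approx> App t (Var x)" "hyb sh ?\<Delta> M t' (Lambek A)" "typing T M (TAtom d \<rightarrow> TAtom a)"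
    unfolding derivable_def by (elim exE conjE)
  have pros: "prosodic M"
    using hyb_label[OF M(4)] unfolding is_label_def by (rule conjunct1)
  have "fv M = hnames ?\<Delta>"
    using hyb_label[OF M(4)] unfolding is_label_def by (rule conjunct2[THEN conjunct1])
  then have fv: "fv M = insert x (hnames \<Delta>)" by simp
  have x_fv: "x \<in> fv M" using fv by simp
  have other: "a \<notin> set_ty (T y)" if "y \<in> fv M" "y \<noteq> x" for y
  proof (rule a(2))
    show "y \<in> hnames \<Delta>" using that unfolding fv by simp
  qed
  obtain M' M1 where
    M': "red\<^sup>*\<^sup>* M M1" "red\<^sup>*\<^sup>* (Var x \<oplus> M') M1" "prosodic M'" "fv M' = fv M - {x}"
    "typing T M' (TAtom d \<rightarrow> TAtom c)"
    by (rule under_label[OF pros x_fv M(5) x(3) a(1) other])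
  have fvM': "fv M' = hnames \<Delta>" unfolding M'(4) fv using x(2) by (rule Diff_insert_absorb)
  have lc: "lc (Var x)" "lc M'" using M'(3) by (simp_all add: prosodic_lc)
  have "is_label sh ?\<Delta> (Var x \<oplus> M') (Lambek A)"
  proof (rule is_labelI)
    show "prosodic (Var x \<oplus> M')"
      using M'(3) fvM' x(2) by (simp add: prosodic_cat prosodic.var)
    show "typing T (Var x \<oplus> M') (TAtom d \<rightarrow> TAtom a)"
      unfolding typing_cat[OF lc] using M'(5) typing.var[of T x, unfolded x(3)] by blast
    show "shape (T (hname h)) = hyp_pros sh h" if "h \<in># ?\<Delta>" for h using M(2) that by blast
  qed (simp_all add: fvM')
  from hyb_expand[OF M'(2) this hyb_reds[OF M'(1) M(4)]] have "hyb sh ?\<Delta> (Var x \<oplus> M') t' (Lambek A)" .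
  then have "hyb sh \<Delta> M' (lam x t') (Lambek (Under B A))"
    using fvM' x(2) by (intro hyb.underI) simp_all
  moreover have "lam x t' \<approx> t" using M(1,3) x(1) by (intro sem_eq_eta) simp_all
  moreover have "\<forall>h\<in>#\<Delta>. shape (T (hname h)) = hyp_pros sh h" using M(2) by simp
  ultimately show ?thesis using M(1) M'(5) by (intro derivableI) simp_all
qed

lemma derivable_barI:
  assumes "derivable (add_mset (Hyp x B) \<Delta>) (App t (Var x)) A \<alpha>"
    and x: "x \<notin> fv t" "T x = \<beta>"
  shows "derivable \<Delta> t (Bar A B) (\<beta> \<rightarrow> \<alpha>)"
proof -
  let ?\<Delta> = "add_mset (Hyp x B) \<Delta>"
  from assms(1) obtain M t' where M: "lc (App t (Var x))"
    "\<forall>h\<in>#?\<Delta>. shape (T (hname h)) = hyp_pros sh h"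
    "t' \<approx> App t (Var x)" "hyb sh ?\<Delta> M t' A" "typing T M \<alpha>"
    unfolding derivable_def by (elim exE conjE)
  have "typing (T(x := \<beta>)) M \<alpha>" using M(5) x(2) by (simp only: fun_upd_triv flip: x(2))
  then have "typing T (lam x M) (\<beta> \<rightarrow> \<alpha>)" by (rule typing.abs)
  moreover have "hyb sh \<Delta> (lam x M) (lam x t') (Bar A B)" using M(4) by (rule hyb.barI)
  moreover have "lam x t' \<approx> t" using M(1,3) x(1) by (intro sem_eq_eta) simp_all
  moreover have "\<forall>h\<in>#\<Delta>. shape (T (hname h)) = hyp_pros sh h" using M(2) by simp
  ultimately show ?thesis using M(1) by (intro derivableI) simp_all
qed

lemma derivable_lc: "derivable \<Delta> t A \<alpha> \<Longrightarrow> lc t"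
  by (simp add: derivable_def)

text \<open>Elimination rules give reflection and introduction rules give reification. Atoms mean
  derivability itself rather than neutral proofs, so the two merge into an equivalence, as the
  contravariant argument of a slash requires in the induction.\<close>

lemma sat_tr_lambek:
  "sat (tr_lambek A [c, d]) \<rho> e \<Delta> t \<longleftrightarrow>
    derivable \<Delta> t (Lambek A) (TAtom (ev \<rho> e d) \<rightarrow> TAtom (ev \<rho> e c))"
proof (induction A arbitrary: c d e \<Delta> t)
  case (LAtom p)
  then show ?case by (simp add: atom_def)
next
  case (Over A B)
  let ?c = "ev \<rho> e c" and ?d = "ev \<rho> e d"
  have "sat (tr_lambek (Over A B) [c, d]) \<rho> e \<Delta> t \<longleftrightarrow> (\<forall>a. lc t \<and>
      (\<forall>\<Delta>' u. derivable \<Delta>' u (Lambek B) (TAtom a \<rightarrow> TAtom ?d) \<longrightarrow> hnames \<Delta> \<inter> hnames \<Delta>' = {} \<longrightarrow>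
        derivable (\<Delta> + \<Delta>') (App t u) (Lambek A) (TAtom a \<rightarrow> TAtom ?c)))"
    (is "_ \<longleftrightarrow> ?R")
    by (simp add: Over.IH)
  also have "?R \<longleftrightarrow> derivable \<Delta> t (Lambek (Over A B)) (TAtom ?d \<rightarrow> TAtom ?c)"
  proof
    assume *: ?R
    \<comment> \<open>The test position must differ from both ends of the slash and from every atom
      of the world, so that only the tested hypothesis can account for it in the count.\<close>
    have "finite ({?c, ?d} \<union> (\<Union>y\<in>hnames \<Delta>. set_ty (T y)))" by simp
    from ex_fresh_pos[OF this] obtain a where
      a: "a \<noteq> ?c" "a \<noteq> ?d" "\<And>y. y \<in> hnames \<Delta> \<Longrightarrow> a \<notin> set_ty (T y)" by auto
    from * have "lc t" by blast
    then obtain x where x: "x \<notin> fv t" "x \<notin> hnames \<Delta>" "T x = TAtom a \<rightarrow> TAtom ?d"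
      "derivable {#Hyp x (Lambek B)#} (Var x) (Lambek B) (TAtom a \<rightarrow> TAtom ?d)"
      by (rule derivable_fresh[of t "TAtom a \<rightarrow> TAtom ?d" "Lambek B" \<Delta>]) auto
    have "hnames \<Delta> \<inter> hnames {#Hyp x (Lambek B)#} = {}" using x(2) by simp
    from *[THEN spec, THEN conjunct2, THEN spec, THEN spec, THEN mp, OF x(4), THEN mp, OF this]
    have "derivable (add_mset (Hyp x (Lambek B)) \<Delta>) (App t (Var x)) (Lambek A)
        (TAtom a \<rightarrow> TAtom ?c)" by simp
    then show "derivable \<Delta> t (Lambek (Over A B)) (TAtom ?d \<rightarrow> TAtom ?c)"
      using x(1-3) a by (rule derivable_overI)
  next
    assume *: "derivable \<Delta> t (Lambek (Over A B)) (TAtom ?d \<rightarrow> TAtom ?c)"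
    then show ?R
      by (blast intro: derivable_overE derivable_lc)
  qed
  finally show ?case .
next
  case (Under B A)
  let ?c = "ev \<rho> e c" and ?d = "ev \<rho> e d"
  have "sat (tr_lambek (Under B A) [c, d]) \<rho> e \<Delta> t \<longleftrightarrow> (\<forall>a. lc t \<and>
      (\<forall>\<Delta>' u. derivable \<Delta>' u (Lambek B) (TAtom ?c \<rightarrow> TAtom a) \<longrightarrow> hnames \<Delta> \<inter> hnames \<Delta>' = {} \<longrightarrow>
        derivable (\<Delta> + \<Delta>') (App t u) (Lambek A) (TAtom ?d \<rightarrow> TAtom a)))"
    (is "_ \<longleftrightarrow> ?R")
    by (simp add: Under.IH)
  also have "?R \<longleftrightarrow> derivable \<Delta> t (Lambek (Under B A)) (TAtom ?d \<rightarrow> TAtom ?c)"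
  proof
    assume *: ?R
    have "finite ({?d} \<union> (\<Union>y\<in>hnames \<Delta>. set_ty (T y)))" by simp
    from ex_fresh_pos[OF this] obtain a where
      a: "a \<noteq> ?d" "\<And>y. y \<in> hnames \<Delta> \<Longrightarrow> a \<notin> set_ty (T y)" by auto
    from * have "lc t" by blast
    then obtain x where x: "x \<notin> fv t" "x \<notin> hnames \<Delta>" "T x = TAtom ?c \<rightarrow> TAtom a"
      "derivable {#Hyp x (Lambek B)#} (Var x) (Lambek B) (TAtom ?c \<rightarrow> TAtom a)"
      by (rule derivable_fresh[of t "TAtom ?c \<rightarrow> TAtom a" "Lambek B" \<Delta>]) auto
    have "hnames \<Delta> \<inter> hnames {#Hyp x (Lambek B)#} = {}" using x(2) by simp
    from *[THEN spec, THEN conjunct2, THEN spec, THEN spec, THEN mp, OF x(4), THEN mp, OF this]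
    have "derivable (add_mset (Hyp x (Lambek B)) \<Delta>) (App t (Var x)) (Lambek A)
        (TAtom ?d \<rightarrow> TAtom a)" by simp
    then show "derivable \<Delta> t (Lambek (Under B A)) (TAtom ?d \<rightarrow> TAtom ?c)"
      using x(1-3) a by (rule derivable_underI)
  next
    assume *: "derivable \<Delta> t (Lambek (Under B A)) (TAtom ?d \<rightarrow> TAtom ?c)"
    then show ?R
      by (blast intro: derivable_underE derivable_lc)
  qed
  finally show ?case .
qed

lemma sat_tr:
  "shape \<alpha> = pros sh A \<Longrightarrow> sat (tr A \<alpha>) \<rho> e \<Delta> t \<longleftrightarrow> derivable \<Delta> t A (map_ty (val \<rho>) \<alpha>)"
proof (induction A arbitrary: \<alpha> \<Delta> t)
  case (Lambek A)
  then obtain a b where "\<alpha> = TAtom a \<rightarrow> TAtom b" using shape_string[of \<alpha>] by auto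
  then show ?case by (simp add: sat_tr_lambek)
next
  case (HAtom q)
  have ev: "map (ev \<rho> e) (map Pt (flat \<alpha>)) = flat (map_ty (val \<rho>) \<alpha>)"
    by (simp add: flat_map_ty)
  have shape: "shape (map_ty (val \<rho>) \<alpha>) = sh q"
    using HAtom by (simp add: ty.map_comp comp_def)
  have "sat (tr (HAtom q) \<alpha>) \<rho> e \<Delta> t \<longleftrightarrow> (\<exists>\<gamma>. flat (map_ty (val \<rho>) \<alpha>) = flat \<gamma> \<and>
      shape \<gamma> = sh q \<and> derivable \<Delta> t (HAtom q) \<gamma>)"
    unfolding tr.simps sat.simps ev by (simp add: atom_def)
  also have "\<dots> \<longleftrightarrow> derivable \<Delta> t (HAtom q) (map_ty (val \<rho>) \<alpha>)"
    using flat_inject[of "map_ty (val \<rho>) \<alpha>"] shape by metis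
  finally show ?case .
next
  case (Bar A B)
  then obtain \<beta> \<gamma> where \<alpha>: "\<alpha> = \<beta> \<rightarrow> \<gamma>" "shape \<beta> = pros sh B" "shape \<gamma> = pros sh A"
    using shape_Fun[of \<alpha>] by auto
  let ?\<beta> = "map_ty (val \<rho>) \<beta>" and ?\<gamma> = "map_ty (val \<rho>) \<gamma>"
  have shape: "shape ?\<beta> = pros sh B"
    using \<alpha>(2) by (simp add: ty.map_comp comp_def)
  have "sat (tr (Bar A B) \<alpha>) \<rho> e \<Delta> t \<longleftrightarrow> lc t \<and>
      (\<forall>\<Delta>' u. derivable \<Delta>' u B ?\<beta> \<longrightarrow> hnames \<Delta> \<inter> hnames \<Delta>' = {} \<longrightarrow>
        derivable (\<Delta> + \<Delta>') (App t u) A ?\<gamma>)"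
    (is "_ \<longleftrightarrow> ?R")
    by (simp add: \<alpha>(1) Bar.IH(1)[OF \<alpha>(3)] Bar.IH(2)[OF \<alpha>(2)])
  also have "?R \<longleftrightarrow> derivable \<Delta> t (Bar A B) (?\<beta> \<rightarrow> ?\<gamma>)"
  proof
    assume *: ?R
    then have "lc t" ..
    then obtain x where x: "x \<notin> fv t" "x \<notin> hnames \<Delta>" "T x = ?\<beta>"
      "derivable {#Hyp x B#} (Var x) B ?\<beta>"
      using shape by (rule derivable_fresh)
    have "hnames \<Delta> \<inter> hnames {#Hyp x B#} = {}" using x(2) by simp
    from *[THEN conjunct2, THEN spec, THEN spec, THEN mp, OF x(4), THEN mp, OF this]
    have "derivable (add_mset (Hyp x B) \<Delta>) (App t (Var x)) A ?\<gamma>" by simp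
    then show "derivable \<Delta> t (Bar A B) (?\<beta> \<rightarrow> ?\<gamma>)"
      using x(1,3) by (rule derivable_barI)
  next
    assume *: "derivable \<Delta> t (Bar A B) (?\<beta> \<rightarrow> ?\<gamma>)"
    then show ?R
      by (blast intro: derivable_barE derivable_lc)
  qed
  finally show ?case by (simp add: \<alpha>(1))
qed

definition world :: "(name \<Rightarrow> ('a, 'b) hyp multiset) \<Rightarrow> ('a + 'b) ctx \<Rightarrow> ('a, 'b) hyp multiset" where
  "world D \<Gamma> = (\<Sum>p\<in>#\<Gamma>. D (fst p))"

lemma world_add [simp]: "world D (add_mset p \<Gamma>) = D (fst p) + world D \<Gamma>"
  and world_union [simp]: "world D (\<Gamma> + \<Delta>) = world D \<Gamma> + world D \<Delta>"
  and world_empty [simp]: "world D {#} = {#}"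
  by (simp_all add: world_def)

lemma world_cong: "(\<And>x. x \<in> cnames \<Gamma> \<Longrightarrow> D x = D' x) \<Longrightarrow> world D \<Gamma> = world D' \<Gamma>"
  by (induction \<Gamma>) auto

lemma hnames_world: "hnames (world D \<Gamma>) = (\<Union>x\<in>cnames \<Gamma>. hnames (D x))"
  by (induction \<Gamma>) (auto simp: image_Un)

text \<open>\<open>\<sigma>\<close> assigns meanings and \<open>D\<close> the resources they
  consume; linearity is the disjointness of the resources of different names.\<close>

definition env ::
  "(nat \<Rightarrow> pos) \<Rightarrow> (nat \<Rightarrow> pos) \<Rightarrow> (name \<Rightarrow> trm) \<Rightarrow> (name \<Rightarrow> ('a, 'b) hyp multiset) \<Rightarrow> ('a + 'b) ctx \<Rightarrow> bool"
  where
  "env \<rho> e \<sigma> D \<Gamma> \<longleftrightarrow> (\<forall>(x, \<phi>)\<in>#\<Gamma>. sat \<phi> \<rho> e (D x) (\<sigma> x)) \<and> (\<forall>x. lc (\<sigma> x)) \<and>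
     (\<forall>x\<in>cnames \<Gamma>. \<forall>y\<in>cnames \<Gamma>. x \<noteq> y \<longrightarrow> hnames (D x) \<inter> hnames (D y) = {})"

lemma env_lc: "env \<rho> e \<sigma> D \<Gamma> \<Longrightarrow> lc (\<sigma> x)"
  by (simp add: env_def)

lemma env_union:
  assumes "env \<rho> e \<sigma> D (\<Gamma> + \<Delta>)"
  shows "env \<rho> e \<sigma> D \<Gamma>" and "env \<rho> e \<sigma> D \<Delta>"
  using assms unfolding env_def by simp_all

lemma env_disjoint:
  assumes "env \<rho> e \<sigma> D (\<Gamma> + \<Delta>)" and "cnames \<Gamma> \<inter> cnames \<Delta> = {}"
  shows "hnames (world D \<Gamma>) \<inter> hnames (world D \<Delta>) = {}"
proof -
  have "hnames (D x) \<inter> hnames (D y) = {}" if "x \<in> cnames \<Gamma>" "y \<in> cnames \<Delta>" for x y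
  proof -
    have "x \<noteq> y" using that assms(2) by blast
    moreover have "x \<in> cnames (\<Gamma> + \<Delta>)" "y \<in> cnames (\<Gamma> + \<Delta>)" using that by (simp_all add: image_Un)
    ultimately show ?thesis using assms(1) unfolding env_def by blast
  qed
  then show ?thesis unfolding hnames_world by blast
qed

lemma env_add:
  assumes env: "env \<rho> e \<sigma> D \<Gamma>" and x: "x \<notin> cnames \<Gamma>" and sat: "sat \<phi> \<rho> e \<Delta> s"
    and disj: "hnames \<Delta> \<inter> hnames (world D \<Gamma>) = {}"
  shows "env \<rho> e (\<sigma>(x := s)) (D(x := \<Delta>)) (add_mset (x, \<phi>) \<Gamma>)"
    and "world (D(x := \<Delta>)) (add_mset (x, \<phi>) \<Gamma>) = \<Delta> + world D \<Gamma>"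
proof -
  have neq: "y \<noteq> x" if "y \<in> cnames \<Gamma>" for y using that x by blast
  have neq': "y \<noteq> x" if "(y, \<psi>) \<in># \<Gamma>" for y \<psi> using imageI[OF that, of fst] x by auto
  have disj': "hnames \<Delta> \<inter> hnames (D y) = {}" if "y \<in> cnames \<Gamma>" for y
    using disj that unfolding hnames_world by blast
  show "env \<rho> e (\<sigma>(x := s)) (D(x := \<Delta>)) (add_mset (x, \<phi>) \<Gamma>)"
    unfolding env_def
  proof (intro conjI ballI allI impI)
    fix p assume "p \<in># add_mset (x, \<phi>) \<Gamma>"
    then show "case p of (y, \<psi>) \<Rightarrow> sat \<psi> \<rho> e ((D(x := \<Delta>)) y) ((\<sigma>(x := s)) y)"
      using env sat neq' by (auto simp: env_def)
  next
    fix y show "lc ((\<sigma>(x := s)) y)" using env sat_lc[OF sat] by (simp add: env_def)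
  next
    fix y z assume "y \<in> cnames (add_mset (x, \<phi>) \<Gamma>)" "z \<in> cnames (add_mset (x, \<phi>) \<Gamma>)" "y \<noteq> z"
    then consider "y = x" "z \<in> cnames \<Gamma>" | "z = x" "y \<in> cnames \<Gamma>" | "y \<in> cnames \<Gamma>" "z \<in> cnames \<Gamma>"
      by auto
    then show "hnames ((D(x := \<Delta>)) y) \<inter> hnames ((D(x := \<Delta>)) z) = {}"
    proof cases
      case 1
      then show ?thesis using disj'[of z] neq[of z] by simp
    next
      case 2
      then show ?thesis using disj'[of y] neq[of y] by (simp add: Int_commute)
    next
      case 3
      with env \<open>y \<noteq> z\<close> have "hnames (D y) \<inter> hnames (D z) = {}" unfolding env_def by blast
      then show ?thesis using neq[OF 3(1)] neq[OF 3(2)] by simp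
    qed
  qed
  have "world (D(x := \<Delta>)) \<Gamma> = world D \<Gamma>" by (rule world_cong) (use neq in simp)
  then show "world (D(x := \<Delta>)) (add_mset (x, \<phi>) \<Gamma>) = \<Delta> + world D \<Gamma>" by simp
qed

lemma env_val:
  assumes "env \<rho> e \<sigma> D \<Gamma>" and "v \<notin> fv_ctx \<Gamma>" and "\<forall>p\<in>#\<Gamma>. lc_form_at 0 (snd p)"
  shows "env (\<rho>(v := a)) e \<sigma> D \<Gamma>"
proof -
  have "sat \<phi> (\<rho>(v := a)) e = sat \<phi> \<rho> e" if "(x, \<phi>) \<in># \<Gamma>" for x \<phi>
  proof (rule sat_cong[where k = 0])
    show "lc_form_at 0 \<phi>" using assms(3) that by force
    show "(\<rho>(v := a)) w = \<rho> w" if "w \<in> fv_form \<phi>" for w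
      using assms(2) \<open>(x, \<phi>) \<in># \<Gamma>\<close> that unfolding fv_ctx_def by auto
  qed simp
  then show ?thesis using assms(1) unfolding env_def by (auto simp del: fun_upd_apply)
qed

text \<open>The fundamental lemma of the logical relation. It quantifies over all environments
  because rules that discharge hypotheses extend \<open>\<sigma>\<close> and \<open>D\<close>, and
  the quantifier rules change \<open>\<rho>\<close>.\<close>

lemma soundness: "mill \<Gamma> t \<phi> \<Longrightarrow> env \<rho> e \<sigma> D \<Gamma> \<Longrightarrow> sat \<phi> \<rho> e (world D \<Gamma>) (msubst \<sigma> t)"
proof (induction arbitrary: \<rho> \<sigma> D rule: mill.induct)
  case (ax \<phi> x)
  then show ?case by (simp add: env_def)
next
  case (lolliI x \<phi> \<Gamma> t \<psi>)
  note inv = mill_invariant[OF lolliI.hyps]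
  from inv have x: "x \<notin> cnames \<Gamma>" by simp
  from inv have t: "lc t" by blast
  note \<sigma> = env_lc[OF lolliI.prems]
  have lc: "lc (msubst \<sigma> (lam x t))" using t \<sigma> by (intro lc_at_msubst lc_lam)
  have "sat \<psi> \<rho> e (world D \<Gamma> + \<Delta>) (App (msubst \<sigma> (lam x t)) u)"
    if u: "sat \<phi> \<rho> e \<Delta> u" "hnames (world D \<Gamma>) \<inter> hnames \<Delta> = {}" for \<Delta> u
  proof -
    have "hnames \<Delta> \<inter> hnames (world D \<Gamma>) = {}" using u(2) by blast
    note env = env_add[OF lolliI.prems x u(1) this]
    have "sat \<psi> \<rho> e (world D \<Gamma> + \<Delta>) (msubst (\<sigma>(x := u)) t)"
      using lolliI.IH[OF env(1)] unfolding env(2) by (simp only: add.commute)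
    then show ?thesis
      by (rule sat_sem_eq[OF _ sem_eq.sym[OF msubst_lam_beta[OF t sat_lc[OF u(1)] \<sigma>]]])
        (use lc sat_lc[OF u(1)] in simp)
  qed
  with lc show ?case by simp
next
  case (lolliE \<Gamma> t \<phi> \<psi> \<Delta> u)
  have "sat (\<phi> \<multimap> \<psi>) \<rho> e (world D \<Gamma>) (msubst \<sigma> t)" "sat \<phi> \<rho> e (world D \<Delta>) (msubst \<sigma> u)"
    using lolliE.IH env_union[OF lolliE.prems] by blast+
  then show ?case using env_disjoint[OF lolliE.prems lolliE.hyps(3)] by simp
next
  case (tensorI \<Gamma> t \<phi> \<Delta> u \<psi>)
  have t: "sat \<phi> \<rho> e (world D \<Gamma>) (msubst \<sigma> t)" and u: "sat \<psi> \<rho> e (world D \<Delta>) (msubst \<sigma> u)"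
    using tensorI.IH env_union[OF tensorI.prems] by blast+
  show ?case unfolding sat.simps world_union msubst.simps
  proof (rule cl_unit)
    show "lc (Tup (msubst \<sigma> t) (msubst \<sigma> u))" using sat_lc[OF t] sat_lc[OF u] by simp
  qed (use t u env_disjoint[OF tensorI.prems tensorI.hyps(3)] in blast)
next
  case (tensorE \<Gamma> t \<phi> \<psi> x y \<Delta> u \<chi>)
  note inv = mill_invariant[OF tensorE.hyps(2)]
  from inv have x: "x \<notin> cnames (add_mset (y, \<psi>) \<Delta>)" and y: "y \<notin> cnames \<Delta>" by simp_all
  from inv have u: "lc u" by blast
  from x have xy: "x \<noteq> y" by simp
  note \<sigma> = env_lc[OF tensorE.prems] and env = env_union[OF tensorE.prems]
  \<comment> \<open>The body is kept with its two dangling indices, so that abstracting the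
    scrutinee of \<open>LetTup\<close> gives a continuation to which \<open>cl_elim\<close>
    applies.\<close>
  let ?B = "msubst \<sigma> (bind_at 1 x (bind_at 0 y u))"
  obtain z where z: "z \<notin> fv ?B" using fresh_name[OF finite_fv] by blast
  have LetTup_subst: "subst z s (LetTup (Var z) ?B) = LetTup s ?B" for s
    using z by (simp add: subst_fresh)
  have lcB: "lc (LetTup (Var z) ?B)"
  proof -
    have "lc (lettup (Var z) x y u)" using u by (intro lc_lettup) simp_all
    then have "lc (msubst \<sigma>' (lettup (Var z) x y u))" if "\<And>v. lc (\<sigma>' v)" for \<sigma>'
      using that by (intro lc_at_msubst)
    from this[OF \<sigma>] show ?thesis by (simp add: lettup_def)
  qed
  let ?k = "lam z (LetTup (Var z) ?B)"
  have lck: "lc ?k" using lcB by (rule lc_lam)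
  have beta: "App ?k s \<approx> LetTup s ?B" if "lc s" for s
    using sem_eq_beta[OF lcB that, of z] unfolding LetTup_subst .
  have t: "cl (\<lambda>\<Delta> t. \<exists>\<Delta>1 \<Delta>2 a b. \<Delta> = \<Delta>1 + \<Delta>2 \<and> t = Tup a b \<and>
     hnames \<Delta>1 \<inter> hnames \<Delta>2 = {} \<and> sat \<phi> \<rho> e \<Delta>1 a \<and> sat \<psi> \<rho> e \<Delta>2 b) (world D \<Gamma>) (msubst \<sigma> t)"
    using tensorE.IH(1)[OF env(1)] by simp
  have "sat \<chi> \<rho> e (world D \<Gamma> + world D \<Delta>) (App ?k (msubst \<sigma> t))"
  proof (rule cl_elim[OF t lck env_disjoint[OF tensorE.prems tensorE.hyps(3)]])
    fix \<Delta>0 s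
    assume "\<exists>\<Delta>1 \<Delta>2 a b. \<Delta>0 = \<Delta>1 + \<Delta>2 \<and> s = Tup a b \<and>
        hnames \<Delta>1 \<inter> hnames \<Delta>2 = {} \<and> sat \<phi> \<rho> e \<Delta>1 a \<and> sat \<psi> \<rho> e \<Delta>2 b"
      and disj: "hnames \<Delta>0 \<inter> hnames (world D \<Delta>) = {}"
    then obtain \<Delta>1 \<Delta>2 a b where s: "\<Delta>0 = \<Delta>1 + \<Delta>2" "s = Tup a b"
      "hnames \<Delta>1 \<inter> hnames \<Delta>2 = {}" "sat \<phi> \<rho> e \<Delta>1 a" "sat \<psi> \<rho> e \<Delta>2 b" by (elim exE conjE)
    have lcs: "lc a" "lc b" using s(4,5) by (simp_all add: sat_lc)
    have "hnames \<Delta>2 \<inter> hnames (world D \<Delta>) = {}" using disj s(1) by (auto simp: image_Un)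
    note env2 = env_add[OF env(2) y s(5) this]
    have "hnames \<Delta>1 \<inter> hnames (world (D(y := \<Delta>2)) (add_mset (y, \<psi>) \<Delta>)) = {}"
      unfolding env2(2) using disj s(1,3) by (auto simp: image_Un)
    note env1 = env_add[OF env2(1) x s(4) this]
    have "sat \<chi> \<rho> e (\<Delta>0 + world D \<Delta>) (msubst (\<sigma>(y := b, x := a)) u)"
      using tensorE.IH(2)[OF env1(1)] unfolding env1(2) env2(2) s(1) by (simp only: add.assoc)
    also have "\<sigma>(y := b, x := a) = \<sigma>(x := a, y := b)" using xy by (rule fun_upd_twist[symmetric])
    finally have sat: "sat \<chi> \<rho> e (\<Delta>0 + world D \<Delta>) (msubst (\<sigma>(x := a, y := b)) u)" .
    have "App ?k s \<approx> LetTup s ?B" using lcs s(2) by (intro beta) simp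
    moreover have "LetTup s ?B \<approx> msubst (\<sigma>(x := a, y := b)) u"
      unfolding s(2) by (rule msubst_lettup_beta[OF u lcs \<sigma> xy])
    ultimately have "App ?k s \<approx> msubst (\<sigma>(x := a, y := b)) u" by (rule sem_eq.trans)
    from sat_sem_eq[OF sat sem_eq.sym[OF this]] show "sat \<chi> \<rho> e (\<Delta>0 + world D \<Delta>) (App ?k s)"
      using lck lcs s(2) by simp
  qed
  moreover have "lc (msubst \<sigma> t)" using t by (rule cl_lc)
  moreover from this have "lc (LetTup (msubst \<sigma> t) ?B)" using lcB by simp
  ultimately have "sat \<chi> \<rho> e (world D \<Gamma> + world D \<Delta>) (LetTup (msubst \<sigma> t) ?B)"
    using sat_sem_eq beta by blast
  then show ?case by (simp add: lettup_def)
next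
  case (forallI \<Gamma> t \<phi> v)
  note inv = mill_invariant[OF forallI.hyps(1)]
  have "sat \<phi> (\<rho>(v := a)) e (world D \<Gamma>) (msubst \<sigma> t)" for a
    using forallI.prems forallI.hyps(2) inv by (intro forallI.IH env_val) simp_all
  moreover have "lc_form_at 0 \<phi>" using inv by blast
  ultimately show ?case by (simp add: sat_all)
next
  case (forallE \<Gamma> t \<phi> a)
  have "lc_form_at 1 \<phi>" using mill_invariant[OF forallE.hyps] by simp
  then show ?case using forallE.IH[OF forallE.prems] by (simp add: sat_inst_0)
next
  case (existsI \<Gamma> t a \<phi>)
  have "lc_form_at 1 \<phi>" using mill_invariant[OF existsI.hyps] by (simp add: lc_inst_form)
  then have sat: "sat \<phi> \<rho> (case_nat (val \<rho> a) e) (world D \<Gamma>) (msubst \<sigma> t)"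
    using existsI.IH[OF existsI.prems] by (simp add: sat_inst_0)
  show ?case unfolding sat.simps
    by (rule cl_unit) (use sat sat_lc[OF sat] in blast)+
next
  case (existsE \<Gamma> t \<phi> x v \<Delta> u \<chi>)
  note inv = mill_invariant[OF existsE.hyps(2)]
  from inv have x: "x \<notin> cnames \<Delta>" by simp
  from inv have u: "lc u" and \<chi>: "lc_form_at 0 \<chi>" and \<Delta>: "\<forall>p\<in>#\<Delta>. lc_form_at 0 (snd p)" by simp_all
  have \<phi>: "lc_form_at 1 \<phi>" using mill_invariant[OF existsE.hyps(1)] by simp
  note \<sigma> = env_lc[OF existsE.prems] and env = env_union[OF existsE.prems]
  obtain z where z: "z \<notin> (\<Union>w\<in>fv u. fv (\<sigma> w))"
    using fresh_name[of "\<Union>w\<in>fv u. fv (\<sigma> w)"] by auto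
  let ?P = "msubst (\<sigma>(x := Var z)) u"
  have lcP: "lc ?P" using u \<sigma> by (intro lc_at_msubst) simp_all
  \<comment> \<open>Existential elimination is a substitution on terms; abstracting the substituted
    variable turns it into a continuation.\<close>
  let ?k = "lam z ?P"
  have lck: "lc ?k" using lcP by (rule lc_lam)
  have subst_P: "subst z s ?P = msubst (\<sigma>(x := s)) u" for s
    using z by (intro msubst_upd_subst) auto
  have beta: "App ?k s \<approx> msubst (\<sigma>(x := s)) u" if "lc s" for s
    using sem_eq_beta[OF lcP that, of z] unfolding subst_P .
  have t: "cl (\<lambda>\<Delta> t. \<exists>a. sat \<phi> \<rho> (case_nat a e) \<Delta> t) (world D \<Gamma>) (msubst \<sigma> t)"
    using existsE.IH(1)[OF env(1)] by simp
  have "sat \<chi> \<rho> e (world D \<Gamma> + world D \<Delta>) (App ?k (msubst \<sigma> t))"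
  proof (rule cl_elim[OF t lck env_disjoint[OF existsE.prems existsE.hyps(4)]])
    fix \<Delta>1 s
    assume "\<exists>a. sat \<phi> \<rho> (case_nat a e) \<Delta>1 s" and disj: "hnames \<Delta>1 \<inter> hnames (world D \<Delta>) = {}"
    then obtain a where s: "sat \<phi> \<rho> (case_nat a e) \<Delta>1 s" by (elim exE)
    \<comment> \<open>The witness becomes the value of the eigenvariable \<open>v\<close>; by the
      side condition this affects neither \<open>\<phi>\<close>, nor \<open>\<chi>\<close>, nor the
      rest of the context.\<close>
    let ?\<rho> = "\<rho>(v := a)"
    have "sat (inst_form 0 (PVar v) \<phi>) ?\<rho> e = sat \<phi> ?\<rho> (case_nat a e)"
      using sat_inst_0[OF \<phi>, of "PVar v" ?\<rho> e] by simp
    also have "\<dots> = sat \<phi> \<rho> (case_nat a e)"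
      by (rule sat_cong[OF \<phi>]) (use existsE.hyps(3) in auto)
    finally have s': "sat (inst_form 0 (PVar v) \<phi>) ?\<rho> e \<Delta>1 s" using s by simp
    have "env ?\<rho> e \<sigma> D \<Delta>"
      using env(2) existsE.hyps(3) \<Delta> by (intro env_val) simp_all
    note env' = env_add[OF this x s' disj]
    have "sat \<chi> ?\<rho> e (\<Delta>1 + world D \<Delta>) (msubst (\<sigma>(x := s)) u)"
      using existsE.IH(2)[OF env'(1)] unfolding env'(2) .
    also have "sat \<chi> ?\<rho> e = sat \<chi> \<rho> e"
      by (rule sat_cong[OF \<chi>]) (use existsE.hyps(3) in auto)
    finally have sat: "sat \<chi> \<rho> e (\<Delta>1 + world D \<Delta>) (msubst (\<sigma>(x := s)) u)" .
    from sat_sem_eq[OF sat sem_eq.sym[OF beta]] show "sat \<chi> \<rho> e (\<Delta>1 + world D \<Delta>) (App ?k s)"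
      using lck sat_lc[OF s] by simp
  qed
  moreover have lct: "lc (msubst \<sigma> t)" using t by (rule cl_lc)
  moreover have "lc (msubst (\<sigma>(x := msubst \<sigma> t)) u)" using u \<sigma> lct by (intro lc_at_msubst) simp_all
  ultimately have "sat \<chi> \<rho> e (world D \<Gamma> + world D \<Delta>) (msubst (\<sigma>(x := msubst \<sigma> t)) u)"
    using sat_sem_eq beta by blast
  moreover have "msubst \<sigma> (subst x t u) = msubst (\<sigma>(x := msubst \<sigma> t)) u"
    unfolding subst_msubst msubst_msubst by (rule msubst_cong) simp
  ultimately show ?case by simp
qed

end


section \<open>Reading hybrid proofs off the model\<close>

section \<open>From first-order proofs to hybrid proofs\<close>

instance ty :: (countable) countable by countable_datatype

instance pos :: countable by countable_datatype

text \<open>Outside \<open>S\<close> a name is read as the code of a type paired with a counter, so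
  every type is hit infinitely often; this is where countability of types is used.\<close>

lemma ex_rich_typing:
  assumes "finite S"
  shows "\<exists>T' :: name \<Rightarrow> pos ty. (\<forall>x\<in>S. T' x = T x) \<and> (\<forall>\<alpha>. infinite {x. T' x = \<alpha>})"
proof -
  let ?T = "\<lambda>x. if x \<in> S then T x else from_nat (fst (prod_decode x))"
  have "infinite {x. ?T x = \<alpha>}" for \<alpha>
  proof -
    have "inj (\<lambda>n. prod_encode (to_nat \<alpha>, n))" by (rule injI) simp
    then have "infinite (range (\<lambda>n. prod_encode (to_nat \<alpha>, n)))"
      using finite_image_iff[of "\<lambda>n. prod_encode (to_nat \<alpha>, n)" UNIV] by simp
    then have "infinite (range (\<lambda>n. prod_encode (to_nat \<alpha>, n)) - S)"
      using assms by (rule Diff_infinite_finite[rotated])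
    moreover have "range (\<lambda>n. prod_encode (to_nat \<alpha>, n)) - S \<subseteq> {x. ?T x = \<alpha>}" by auto
    ultimately show ?thesis using finite_subset by blast
  qed
  then show ?thesis by (intro exI[of _ ?T]) simp
qed

lemma mill_hyb:
  fixes sh :: "'b \<Rightarrow> unit ty" and \<Gamma> :: "('a, 'b) hyp multiset"
  assumes seq: "principal_sequent sh T L \<Gamma> M \<beta> B"
    and mill: "mill (tr_left T L \<Gamma>) t (tr_right T L \<Gamma> B \<beta>)"
  shows "\<exists>t'. t' \<approx> t \<and> hyb sh \<Gamma> M t' B"
proof -
  from seq have uniq: "uniq (image_mset hname \<Gamma>)" and label: "is_label sh \<Gamma> M B"
    and shapes: "\<And>h. h \<in># \<Gamma> \<Longrightarrow> shape (T (hname h)) = hyp_pros sh h" and \<beta>: "shape \<beta> = pros sh B"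
    and princ: "principal T M \<beta>"
    and lex: "\<And>w W A. Lex w W A \<in># \<Gamma> \<Longrightarrow> is_label sh {#Lex w W A#} W A \<and>
        (\<exists>i j. T w = TAtom (Pos j) \<rightarrow> TAtom (Pos i)) \<and> shape (L w) = pros sh A \<and> principal T W (L w)"
    unfolding principal_sequent_def uniq_def by blast+
  have pros: "prosodic M" using label unfolding is_label_def by (rule conjunct1)
  have fv: "fv M = hnames \<Gamma>" using label unfolding is_label_def by (rule conjunct2[THEN conjunct1])
  have "finite (hnames \<Gamma>)" by simp
  from ex_rich_typing[OF this, of T] obtain T' where
    T'_eq: "\<forall>x\<in>hnames \<Gamma>. T' x = T x" and rich: "\<forall>\<alpha>. infinite {x. T' x = \<alpha>}" by (elim exE conjE)
  interpret model sh T' by unfold_locales (rule rich[THEN spec])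
  have T'h: "T' (hname h) = T (hname h)" if "h \<in># \<Gamma>" for h using bspec[OF T'_eq imageI[OF that]] .
  \<comment> \<open>The world of a name is the one hypothesis that carries it; together these worlds
    add up to \<open>\<Gamma>\<close>.\<close>
  define D where "D x = filter_mset (\<lambda>h. hname h = x) \<Gamma>" for x
  have D: "D (hname h) = {#h#}" if "h \<in># \<Gamma>" for h
    using uniq that unfolding D_def
  proof (induction \<Gamma>)
    case (add g \<Gamma>)
    have "hname g \<notin> hnames \<Gamma>" using add.prems(1) by simp
    then have "filter_mset (\<lambda>h'. hname h' = hname g) \<Gamma> = filter_mset (\<lambda>_. False) \<Gamma>"
      by (intro filter_mset_cong) (simp_all add: hname_neq)
    then have none: "filter_mset (\<lambda>h'. hname h' = hname g) \<Gamma> = {#}" by simp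
    show ?case
    proof (cases "h = g")
      case True
      with none show ?thesis by simp
    next
      case False
      with add.prems have h: "h \<in># \<Gamma>" by simp
      have "hname g \<noteq> hname h" using add.prems(1) imageI[OF h, of hname] by auto
      with add.IH h add.prems(1) show ?thesis by simp
    qed
  qed simp
  have world: "world D (tr_left T L \<Gamma>) = \<Gamma>"
  proof -
    have "world D (tr_left T L \<Gamma>) = (\<Sum>h\<in>#\<Gamma>. D (hname h))"
      by (simp add: world_def tr_left_def image_mset.compositionality comp_def)
    also have "\<dots> = (\<Sum>h\<in>#\<Gamma>. {#h#})"
      by (rule arg_cong[where f = sum_mset]) (rule image_mset_cong, rule D)
    finally show ?thesis by simp
  qed
  have sat: "sat (snd (tr_hyp T L h)) PVar e {#h#} (Var (hname h))" if h: "h \<in># \<Gamma>" for h e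
  proof (cases h)
    case (Hyp x A)
    have "shape (T x) = pros sh A" "T' x = T x" using shapes[OF h] T'h[OF h] Hyp by simp_all
    then show ?thesis
      using derivable_ax[of x A] Hyp by (simp add: sat_tr ty.map_id)
  next
    case (Lex w W A)
    from lex[OF h[unfolded Lex]] obtain i j where lbl: "is_label sh {#Lex w W A#} W A"
      and T: "T w = TAtom (Pos j) \<rightarrow> TAtom (Pos i)"
      and L: "shape (L w) = pros sh A" "principal T W (L w)" by blast
    \<comment> \<open>The universal closure asks for every valuation \<open>\<rho>\<close>. It may
      change the type variables of \<open>L w\<close> but not \<open>T w\<close>, which consists of
      two fixed positions, so \<open>W\<close> keeps serving as the label.\<close>
    have "sat (tr A (L w)) \<rho> e {#Lex w W A#} (Var w)" for \<rho>
    proof -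
      have "typing T W (L w)" using L(2) unfolding principal_def by (rule conjunct1)
      then have "typing (\<lambda>x. map_ty (val \<rho>) (T x)) W (map_ty (val \<rho>) (L w))" by (rule typing_map_ty)
      moreover have "fv W = {w}" using lbl by (simp add: is_label_def)
      then have "map_ty (val \<rho>) (T x) = T' x" if "x \<in> fv W" for x
        using that T T'h[OF h] Lex by simp
      ultimately have "typing T' W (map_ty (val \<rho>) (L w))" by (rule typing_cong)
      moreover have "\<forall>h\<in>#{#Lex w W A#}. shape (T' (hname h)) = hyp_pros sh h"
        using shapes[OF h] T'h[OF h] Lex by simp
      ultimately have "derivable {#Lex w W A#} (Var w) A (map_ty (val \<rho>) (L w))"
        using hyb.lex[OF lbl] by (intro derivableI[OF _ _ sem_eq.refl]) simp_all
      then show ?thesis by (simp add: sat_tr[OF L(1)])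
    qed
    then show ?thesis by (simp add: Lex all_over_def sat_foldr_all tr_lc[OF L(1)])
  qed
  \<comment> \<open>The identity environment: every first-order variable and every name stands for
    itself.\<close>
  have "env PVar e Var D (tr_left T L \<Gamma>)" for e
    unfolding env_def
  proof (intro conjI ballI allI impI)
    fix p assume "p \<in># tr_left T L \<Gamma>"
    then obtain h where "h \<in># \<Gamma>" "p = tr_hyp T L h" by (auto simp: tr_left_def)
    with sat[of h e] D[of h] show "case p of (x, \<phi>) \<Rightarrow> sat \<phi> PVar e (D x) (Var x)"
      by (simp add: case_prod_unfold)
  next
    fix x y :: name assume "x \<noteq> y"
    then show "hnames (D x) \<inter> hnames (D y) = {}" by (auto simp: D_def)
  qed simp
  from soundness[OF mill this]
  have "sat (tr_right T L \<Gamma> B \<beta>) PVar PVar \<Gamma> t" unfolding world msubst_Var .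
  then have "sat (tr B \<beta>) PVar PVar \<Gamma> t"
    by (simp add: tr_right_def all_over_def sat_foldr_all tr_lc[OF \<beta>])
  then have "derivable \<Gamma> t B \<beta>" by (simp add: sat_tr[OF \<beta>] ty.map_id)
  then obtain M' t' where M': "t' \<approx> t" "hyb sh \<Gamma> M' t' B" "typing T' M' \<beta>"
    unfolding derivable_def by (elim exE conjE)
  have pros': "prosodic M'"
    using hyb_label[OF M'(2)] unfolding is_label_def by (rule conjunct1)
  have fv': "fv M' = fv M"
    using hyb_label[OF M'(2)] unfolding is_label_def fv by (rule conjunct2[THEN conjunct1])
  have "typing T M' \<beta>" by (rule typing_cong[OF M'(3)]) (use T'_eq fv' fv in blast)
  from coherence[OF princ pros this pros' fv'] obtain P M1 M1' where
    P: "red\<^sup>*\<^sup>* M M1" "red\<^sup>*\<^sup>* P M1" "red\<^sup>*\<^sup>* P M1'" "red\<^sup>*\<^sup>* M' M1'" "prosodic P" "fv P = fv M"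
    "typing T P \<beta>" .
  have labelP: "is_label sh \<Gamma> P B"
    using P(5) P(6)[unfolded fv] P(7) \<beta> shapes by (rule is_labelI)
  have "hyb sh \<Gamma> P t' B" by (rule hyb_expand[OF P(3) labelP hyb_reds[OF P(4) M'(2)]])
  then have "hyb sh \<Gamma> M t' B" by (rule hyb_expand[OF P(1) label hyb_reds[OF P(2)]])
  with M'(1) show ?thesis by blast
qed

theorem theorem3:
  fixes sh :: "'b \<Rightarrow> unit ty"
    and \<Gamma> :: "('a, 'b) hyp multiset" and M :: trm and B :: "('a, 'b) hybrid"
    and T L :: "name \<Rightarrow> pos ty" and \<beta> :: "pos ty"
  assumes "principal_sequent sh T L \<Gamma> M \<beta> B"
  shows "((\<exists>t. hyb sh \<Gamma> M t B) \<longleftrightarrow> (\<exists>t. mill (tr_left T L \<Gamma>) t (tr_right T L \<Gamma> B \<beta>))) \<and>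
         (\<forall>t. hyb sh \<Gamma> M t B \<longrightarrow> mill (tr_left T L \<Gamma>) t (tr_right T L \<Gamma> B \<beta>)) \<and>
         (\<forall>t. mill (tr_left T L \<Gamma>) t (tr_right T L \<Gamma> B \<beta>) \<longrightarrow> (\<exists>t'. t' \<approx> t \<and> hyb sh \<Gamma> M t' B))"
proof -
  have dec: "decorated sh T L \<Gamma>"
    using assms unfolding principal_sequent_def decorated_def lexical_def by blast
  have \<beta>: "typing T M \<beta>" "shape \<beta> = pros sh B"
    using assms unfolding principal_sequent_def principal_def by blast+
  \<comment> \<open>The right-hand closure ranges over variables not free on the left, which is the
    side condition of \<open>forallI\<close>.\<close>
  have hyb: "mill (tr_left T L \<Gamma>) t (tr_right T L \<Gamma> B \<beta>)" if "hyb sh \<Gamma> M t B" for t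
    unfolding tr_right_def by (rule mill_all_over[OF hyb_mill[OF that dec \<beta>]]) auto
  have mill: "\<exists>t'. t' \<approx> t \<and> hyb sh \<Gamma> M t' B" if "mill (tr_left T L \<Gamma>) t (tr_right T L \<Gamma> B \<beta>)" for t
    using assms that by (rule mill_hyb)
  from hyb mill show ?thesis by blast
qed

end
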